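(* Consider the online probing problem with reward distributions of finite support of size $m$. Let $v^{\mathrm{off}}$ be the expected total reward of the Offline controller and let $v^{\mathrm{on}}$ be the expected total reward of the Probing RABBI policy (both defined in the context). Then there is a constant $M$ depending only on $(n,m,\mathbf q,\mathbf p,\mathbf r)$, and in particular not on the horizon $T$, the resource budget $B_h$ or the probing budget $B_p$, such that for all $T,B_h,B_p\in\mathbb N$, $$\mathbb E[\mathrm{Regret}] := v^{\mathrm{off}}-v^{\mathrm{on}}\le M .$$
   Context: **Online probing problem.** There are periods $t=T,T-1,\dots,1$, where $t$ is the time-to-go, a resource (hiring) budget $B_h\in\mathbb N$ and a probing budget $B_p\in\mathbb N$. In each period an item arrives whose type $\xi^t\in[n]$ is drawn i.i.d. from a known distribution $\mathbf p=(p_1,\dots,p_n)$. A type-$j$ item has a random reward $R_j\in\{r_{jk}:k\in[m]\}$ with $\Pr[R_j=r_{jk}]=q_{jk}$, drawn independently of everything else; $\mathbf r=(r_{jk})$ and $\mathbf q=(q_{jk})$ are known. Let $\bar r_j=\sum_k q_{jk}r_{jk}$. All items have unit weight. The controller first sees the type $j$ and chooses to accept ($\mathtt a$), reject ($\mathtt r$) or probe ($\mathtt p$). Accepting without probing uses one unit of the resource budget and collects the random reward $R_j$ (mean $\bar r_j$). Rejecting collects $0$. Probing uses one unit of the probing budget and reveals the realized reward $R_j=r_{jk}$ (the sub-type $(j,k)$), after which the controller either accepts (collecting $r_{jk}$ and using one unit of the resource budget) or rejects (collecting $0$). Budgets may never become negative. **Offline controller.** Offline knows in advance all arrival types $\xi^T,\dots,\xi^1$,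 but learns reward realizations (sub-types) only as the process unfolds, exactly when the process reveals them; it plays an optimal policy for this information structure respecting the budgets. $v^{\mathrm{off}}$ is its expected total reward, the expectation being also over the types. **LP.** For $(b_h,b_p,\mathbf z)\in\mathbb N^2\times\mathbb R_{\ge0}^n$ let $P[b_h,b_p,\mathbf z]$ be the linear program in variables $x_{j\mathtt a},x_{j\mathtt p},x_{j\mathtt r},x_{jk\mathtt a},x_{jk\mathtt r}\ge 0$ ($j\in[n],k\in[m]$): maximize $\sum_{j,k}r_{jk}x_{jk\mathtt a}+\sum_j\bar r_jx_{j\mathtt a}$ subject to $\sum_{j,k}x_{jk\mathtt a}+\sum_jx_{j\mathtt a}\le b_h$; $\sum_jx_{j\mathtt p}\le b_p$; $x_{j\mathtt a}+x_{j\mathtt p}+x_{j\mathtt r}=z_j$ for all $j$; $x_{jk\mathtt a}+x_{jk\mathtt r}=q_{jk}x_{j\mathtt p}$ for all $j,k$. **Probing RABBI policy.** Start with budgets $(B_h,B_p)$. In each period $t=T,\dots,1$ with current budgets $(B_h^t,B_p^t)$: compute an optimal solution $X^t$ of $P[B_h^t,B_p^t,t\mathbf p]$ (here $t\mathbf p=\mathbb E[Z^t]$, where $Z^t_j$ is the number of type-$j$ arrivals in the last $t$ periods); observe the arriving type $j$ and take an action $u\in\{\mathtt a,\mathtt p,\mathtt r\}$ maximizing $X^t_{j,u}$; if the action is to probe and the observed reward is $r_{jk}$, then take the action $u\in\{\mathtt a,\mathtt r\}$ maximizing $X^t_{j,k,u}$; update the budgets. Ties are broken arbitrarily. *)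

theory Defs
  imports "HOL-Probability.Probability"
begin

text \<open>
  The finite types \<open>'n\<close> and \<open>'m\<close> index item types and reward values. An item \<open>(j, k)\<close> carries
  its public type \<open>j\<close> together with the latent index \<open>k\<close> of its reward \<open>r j k\<close>.
\<close>

definition item_pmf :: "'n pmf \<Rightarrow> ('n \<Rightarrow> 'm pmf) \<Rightarrow> ('n \<times> 'm) pmf" where
  "item_pmf p q = bind_pmf p (\<lambda>j. map_pmf (Pair j) (q j))"

text \<open>Items are listed in order of arrival, so the head is the item at time-to-go \<open>T\<close>.\<close>

definition arrivals :: "'n pmf \<Rightarrow> ('n \<Rightarrow> 'm pmf) \<Rightarrow> nat \<Rightarrow> ('n \<times> 'm) list pmf" where
  "arrivals p q T = replicate_pmf T (item_pmf p q)"

datatype action = Accept | Probe | Reject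

datatype verdict = Take | Leave

text \<open>
  An event is what the controller has seen of one period. Accepting without probing collects the
  reward and thereby reveals it; rejecting without probing does not.
\<close>

datatype ('n, 'm) event =
    Rejected 'n
  | Accepted 'n 'm
  | Probed_Taken 'n 'm
  | Probed_Left 'n 'm

fun hires :: "('n, 'm) event \<Rightarrow> nat" where
  "hires (Rejected j) = 0"
| "hires (Accepted j k) = 1"
| "hires (Probed_Taken j k) = 1"
| "hires (Probed_Left j k) = 0"

fun probes :: "('n, 'm) event \<Rightarrow> nat" where
  "probes (Rejected j) = 0"
| "probes (Accepted j k) = 0"
| "probes (Probed_Taken j k) = 1"
| "probes (Probed_Left j k) = 1"

fun gain :: "('n \<Rightarrow> 'm \<Rightarrow> real) \<Rightarrow> ('n, 'm) event \<Rightarrow> real" where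
  "gain r (Rejected j) = 0"
| "gain r (Accepted j k) = r j k"
| "gain r (Probed_Taken j k) = r j k"
| "gain r (Probed_Left j k) = 0"

text \<open>Histories list the past events, most recent first.\<close>

type_synonym ('n, 'm) history = "('n, 'm) event list"

definition hires_used :: "('n, 'm) history \<Rightarrow> nat" where
  "hires_used h = sum_list (map hires h)"

definition probes_used :: "('n, 'm) history \<Rightarrow> nat" where
  "probes_used h = sum_list (map probes h)"

definition total_gain :: "('n \<Rightarrow> 'm \<Rightarrow> real) \<Rightarrow> ('n, 'm) history \<Rightarrow> real" where
  "total_gain r h = sum_list (map (gain r) h)"

text \<open>
  A policy chooses an action from the past and the type of the current item, and after a probe a
  verdict that may also depend on the revealed reward index.
\<close>

datatype ('n, 'm) policy = Policy
  (act: "('n, 'm) history \<Rightarrow> 'n \<Rightarrow> action")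
  (after_probe: "('n, 'm) history \<Rightarrow> 'n \<Rightarrow> 'm \<Rightarrow> verdict")

definition play :: "('n, 'm) policy \<Rightarrow> ('n, 'm) history \<Rightarrow> 'n \<times> 'm \<Rightarrow> ('n, 'm) event" where
  "play \<pi> h = (\<lambda>(j, k). case act \<pi> h j of
       Accept \<Rightarrow> Accepted j k
     | Probe \<Rightarrow> (case after_probe \<pi> h j k of Take \<Rightarrow> Probed_Taken j k | Leave \<Rightarrow> Probed_Left j k)
     | Reject \<Rightarrow> Rejected j)"

definition run :: "('n, 'm) policy \<Rightarrow> ('n \<times> 'm) list \<Rightarrow> ('n, 'm) history" where
  "run \<pi> \<omega> = foldl (\<lambda>h i. play \<pi> h i # h) [] \<omega>"

definition v_on ::
  "'n pmf \<Rightarrow> ('n \<Rightarrow> 'm pmf) \<Rightarrow> ('n \<Rightarrow> 'm \<Rightarrow> real) \<Rightarrow> nat \<Rightarrow> ('n, 'm) policy \<Rightarrow> real" where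
  "v_on p q r T \<pi> =
     measure_pmf.expectation (arrivals p q T) (\<lambda>\<omega>. total_gain r (run \<pi> \<omega>))"

text \<open>
  An offline strategy picks its policy knowing the public types of all arrivals, but none of the
  rewards. Consumption is nondecreasing along a run, so it suffices to bound it at the horizon.
\<close>

definition offline_admissible ::
  "'n pmf \<Rightarrow> ('n \<Rightarrow> 'm pmf) \<Rightarrow> nat \<Rightarrow> nat \<Rightarrow> nat \<Rightarrow> ('n list \<Rightarrow> ('n, 'm) policy) \<Rightarrow> bool" where
  "offline_admissible p q T Bh Bp F \<longleftrightarrow>
     (\<forall>\<omega> \<in> set_pmf (arrivals p q T).
        hires_used (run (F (map fst \<omega>)) \<omega>) \<le> Bh \<and> probes_used (run (F (map fst \<omega>)) \<omega>) \<le> Bp)"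

definition v_off ::
  "'n pmf \<Rightarrow> ('n \<Rightarrow> 'm pmf) \<Rightarrow> ('n \<Rightarrow> 'm \<Rightarrow> real) \<Rightarrow> nat \<Rightarrow> nat \<Rightarrow> nat \<Rightarrow> real" where
  "v_off p q r T Bh Bp =
     (SUP F \<in> {F. offline_admissible p q T Bh Bp F}.
        measure_pmf.expectation (arrivals p q T) (\<lambda>\<omega>. total_gain r (run (F (map fst \<omega>)) \<omega>)))"

definition mean_reward :: "('n \<Rightarrow> 'm::finite pmf) \<Rightarrow> ('n \<Rightarrow> 'm \<Rightarrow> real) \<Rightarrow> 'n \<Rightarrow> real" where
  "mean_reward q r j = (\<Sum>k\<in>UNIV. pmf (q j) k * r j k)"

text \<open>
  The linear program \<open>P[bh, bp, z]\<close>: \<open>x j u\<close> are the variables for items on arrival, \<open>y j k u\<close>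
  those for probed items.
\<close>

definition lp_feasible ::
  "('n::finite \<Rightarrow> 'm::finite pmf) \<Rightarrow> nat \<Rightarrow> nat \<Rightarrow> ('n \<Rightarrow> real) \<Rightarrow>
   ('n \<Rightarrow> action \<Rightarrow> real) \<Rightarrow> ('n \<Rightarrow> 'm \<Rightarrow> verdict \<Rightarrow> real) \<Rightarrow> bool" where
  "lp_feasible q bh bp z x y \<longleftrightarrow>
     (\<forall>j u. 0 \<le> x j u) \<and> (\<forall>j k u. 0 \<le> y j k u) \<and>
     (\<Sum>j\<in>UNIV. \<Sum>k\<in>UNIV. y j k Take) + (\<Sum>j\<in>UNIV. x j Accept) \<le> real bh \<and>
     (\<Sum>j\<in>UNIV. x j Probe) \<le> real bp \<and>
     (\<forall>j. x j Accept + x j Probe + x j Reject = z j) \<and>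
     (\<forall>j k. y j k Take + y j k Leave = pmf (q j) k * x j Probe)"

definition lp_value ::
  "('n::finite \<Rightarrow> 'm::finite pmf) \<Rightarrow> ('n \<Rightarrow> 'm \<Rightarrow> real) \<Rightarrow>
   ('n \<Rightarrow> action \<Rightarrow> real) \<Rightarrow> ('n \<Rightarrow> 'm \<Rightarrow> verdict \<Rightarrow> real) \<Rightarrow> real" where
  "lp_value q r x y =
     (\<Sum>j\<in>UNIV. \<Sum>k\<in>UNIV. r j k * y j k Take) + (\<Sum>j\<in>UNIV. mean_reward q r j * x j Accept)"

definition lp_optimal ::
  "('n::finite \<Rightarrow> 'm::finite pmf) \<Rightarrow> ('n \<Rightarrow> 'm \<Rightarrow> real) \<Rightarrow> nat \<Rightarrow> nat \<Rightarrow> ('n \<Rightarrow> real) \<Rightarrow>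
   ('n \<Rightarrow> action \<Rightarrow> real) \<Rightarrow> ('n \<Rightarrow> 'm \<Rightarrow> verdict \<Rightarrow> real) \<Rightarrow> bool" where
  "lp_optimal q r bh bp z x y \<longleftrightarrow>
     lp_feasible q bh bp z x y \<and>
     (\<forall>x' y'. lp_feasible q bh bp z x' y' \<longrightarrow> lp_value q r x' y' \<le> lp_value q r x y)"

text \<open>
  The policies that follow Probing RABBI from budgets \<open>(Bh, Bp)\<close>, one for each way of picking the
  optimal solution and breaking ties; these choices may depend on the whole history. The
  solution is fixed before the arriving type is seen.

  The truncated subtractions matter only on histories of probability zero: an action (verdict)
  maximising the solution has a positive variable whenever the arriving type (sub-type) has
  positive probability, so by the budget constraints of the linear program the policy almost surely
  stays within its budgets.
\<close>

definition probing_rabbi ::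
  "'n::finite pmf \<Rightarrow> ('n \<Rightarrow> 'm::finite pmf) \<Rightarrow> ('n \<Rightarrow> 'm \<Rightarrow> real) \<Rightarrow> nat \<Rightarrow> nat \<Rightarrow> nat \<Rightarrow>
   ('n, 'm) policy \<Rightarrow> bool" where
  "probing_rabbi p q r T Bh Bp \<pi> \<longleftrightarrow>
     (\<forall>h. length h < T \<longrightarrow>
        (\<exists>x y.
           lp_optimal q r (Bh - hires_used h) (Bp - probes_used h)
             (\<lambda>j. real (T - length h) * pmf p j) x y \<and>
           (\<forall>j. (\<forall>u. x j u \<le> x j (act \<pi> h j)) \<and>
                (act \<pi> h j = Probe \<longrightarrow> (\<forall>k u. y j k u \<le> y j k (after_probe \<pi> h j k))))))"

end

theory Submission
  imports Defs
begin

text \<open>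
  Regret stays bounded because offline and online can be compared at one and the same pair of
  prices \<open>L = (\<lambda>, \<mu>)\<close>, for a hire and for a probe, which is read off the
  end of the online run.

  Charging these prices turns every period into a choice between \<^emph>\<open>plans\<close> (an
  action together with a verdict for each reward), and the \<^emph>\<open>loss\<close> of a plan
  is its distance from the best plan for the type. Write \<open>N\<close> for the hires of a run
  minus their conditional expectations. Up to martingale terms, the gain of any run within the
  budgets is at most the dual bound at \<open>L\<close>, minus \<open>\<lambda> N\<close>, minus
  its losses and the price of its unspent probes; a run without losses that spends what is priced
  attains this (\<open>gain_sum_eq\<close>). Two things are therefore needed.

  First, online must be lossless at the prices \<open>L\<close> that are used. By linear
  programming duality a finite set of prices suffices for all budgets and all horizons
  (\<open>finite_price_system\<close>), and an action that maximises the optimal solution carries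
  a fixed fraction of its type. So it is lossless at each price whose dual bound is within a
  small multiple of the time-to-go of the optimum (\<open>near_lossless\<close>). Once a price
  falls behind by more than that, it tends to stay behind, because its gap has no downward drift
  while it is small and the time-to-go shrinks. Hence, except for the last few periods, a bounded
  number in expectation, some price is nearly optimal all along the run
  (\<open>expected_idle\<close>), and \<open>L\<close> is chosen among these.

  Second, \<open>\<lambda> (N_online - N_offline)\<close> must be bounded in expectation although
  \<open>L\<close> depends on the online run. Neither noise is bounded, and comparing with the
  value of the linear program would lose the order of the square root of the horizon. The two
  runs are coupled instead: the \<open>i\<close>-th online plan with hiring probability
  \<open>c\<close> reuses the hire outcome of the \<open>i\<close>-th offline plan with the same
  \<open>c\<close> (\<open>run_exp_coupled\<close>). Offline outcomes that online does not reuse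
  are independent of \<open>L\<close> (\<open>run_exp_unread\<close>), so only the outcomes that
  online draws afresh matter. If online is lossless at two prices with different
  \<open>\<lambda>\<close>, the probes on which the two runs can differ without loss all have the
  same hiring probability, and their number is fixed by the probing budget; so for every
  \<open>c\<close> the surplus of online plans is bounded by the cost of offline at these prices
  (\<open>class_excess_le\<close>). The fresh noise is then charged at the candidate price that
  is cheapest for offline, where it is a martingale; at any other \<open>\<lambda>\<close> the
  difference is a martingale with at most as many steps as a multiple of offline's cost, so that
  the cost dominates it (\<open>run_exp_shift_weight\<close>, \<open>shift_steps_le\<close>).
\<close>

section \<open>Plans, prices and weak duality\<close>

instance action :: finite
proof
  have "UNIV = {Accept, Probe, Reject}"
    using action.exhaust by blast
  then show "finite (UNIV :: action set)"
    by (metis finite.emptyI finite_insert)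
qed

instance verdict :: finite
proof
  have "UNIV = {Take, Leave}"
    using verdict.exhaust by blast
  then show "finite (UNIV :: verdict set)"
    by (metis finite.emptyI finite_insert)
qed

definition hired :: "action \<Rightarrow> ('m \<Rightarrow> verdict) \<Rightarrow> 'm \<Rightarrow> bool" where
  "hired a w k \<longleftrightarrow> a = Accept \<or> a = Probe \<and> w k = Take"

text \<open>
  The price of a hire and the price of a probe.
\<close>

type_synonym price = "real \<times> real"

lemma sum_pmf_UNIV: "(\<Sum>k\<in>UNIV. pmf (P :: 'm::finite pmf) k) = 1"
  using sum_pmf_eq_1[of UNIV P] by simp

locale probing =
  fixes p :: "'n::finite pmf"
    and q :: "'n \<Rightarrow> 'm::finite pmf"
    and r :: "'n \<Rightarrow> 'm \<Rightarrow> real"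
begin

definition rate :: "'n \<Rightarrow> action \<Rightarrow> ('m \<Rightarrow> verdict) \<Rightarrow> real" where
  "rate j a w = (\<Sum>k\<in>UNIV. pmf (q j) k * of_bool (hired a w k))"

definition plan_gain :: "'n \<Rightarrow> action \<Rightarrow> ('m \<Rightarrow> verdict) \<Rightarrow> real" where
  "plan_gain j a w = (\<Sum>k\<in>UNIV. pmf (q j) k * (of_bool (hired a w k) * r j k))"

definition payoff :: "'n \<Rightarrow> action \<Rightarrow> ('m \<Rightarrow> verdict) \<Rightarrow> price \<Rightarrow> real" where
  "payoff j a w L = plan_gain j a w - fst L * rate j a w - snd L * of_bool (a = Probe)"

text \<open>
  Verdicts are part of a plan even when it does not probe, so that the plans of all types range
  over one finite set. Payoffs are affine in the price.
\<close>

definition best :: "'n \<Rightarrow> price \<Rightarrow> real" where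
  "best j L = Max (range (\<lambda>(a, w). payoff j a w L))"

definition loss :: "'n \<Rightarrow> action \<Rightarrow> ('m \<Rightarrow> verdict) \<Rightarrow> price \<Rightarrow> real" where
  "loss j a w L = best j L - payoff j a w L"

lemma payoff_le_best: "payoff j a w L \<le> best j L"
  unfolding best_def by (rule Max_ge) (auto intro!: range_eqI[where x = "(a, w)"])

lemma loss_nonneg: "0 \<le> loss j a w L"
  using payoff_le_best by (simp add: loss_def)

lemma best_attained: obtains a w where "best j L = payoff j a w L"
proof -
  have "best j L \<in> range (\<lambda>(a, w). payoff j a w L)"
    unfolding best_def by (rule Max_in) auto
  then show thesis using that by auto
qed

lemma rate_simps [simp]: "rate j Accept w = 1" "rate j Reject w = 0"
  by (simp_all add: rate_def hired_def sum_pmf_UNIV)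

lemma plan_gain_simps [simp]: "plan_gain j Accept w = mean_reward q r j" "plan_gain j Reject w = 0"
  by (simp_all add: plan_gain_def hired_def mean_reward_def)

lemma best_nonneg: "0 \<le> best j L"
  using payoff_le_best[of j Reject undefined L] by (simp add: payoff_def)

lemma rate_range: "0 \<le> rate j a w" "rate j a w \<le> 1"
proof -
  show "0 \<le> rate j a w" unfolding rate_def by (intro sum_nonneg) auto
  have "rate j a w \<le> (\<Sum>k\<in>UNIV. pmf (q j) k)" unfolding rate_def by (intro sum_mono) auto
  then show "rate j a w \<le> 1" by (simp add: sum_pmf_UNIV)
qed

lemma payoff_Probe: "payoff j Probe w L = (\<Sum>k\<in>UNIV. pmf (q j) k * (of_bool (w k = Take) * (r j k - fst L))) - snd L"
proof -
  have "(\<Sum>k\<in>UNIV. pmf (q j) k * (of_bool (w k = Take) * (r j k - fst L))) =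
      (\<Sum>k\<in>UNIV. pmf (q j) k * (of_bool (w k = Take) * r j k) - fst L * (pmf (q j) k * of_bool (w k = Take)))"
    by (intro sum.cong) (auto simp: algebra_simps)
  then show ?thesis
    unfolding payoff_def plan_gain_def rate_def hired_def sum_distrib_left
    by (simp only: sum_subtractf) simp
qed

text \<open>
  The objective of the dual linear program, with the dual variables of the types eliminated.
\<close>

definition dual_bound :: "price \<Rightarrow> real \<Rightarrow> real \<Rightarrow> ('n \<Rightarrow> real) \<Rightarrow> real" where
  "dual_bound L bh bp z = fst L * bh + snd L * bp + (\<Sum>j\<in>UNIV. z j * best j L)"

text \<open>
  Feasibility except for the two budget constraints, which are the ones that prices replace.
\<close>

definition lp_local :: "('n \<Rightarrow> real) \<Rightarrow> ('n \<Rightarrow> action \<Rightarrow> real) \<Rightarrow> ('n \<Rightarrow> 'm \<Rightarrow> verdict \<Rightarrow> real) \<Rightarrow> bool" where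
  "lp_local z x y \<longleftrightarrow>
     (\<forall>j u. 0 \<le> x j u) \<and> (\<forall>j k u. 0 \<le> y j k u) \<and>
     (\<forall>j. x j Accept + x j Probe + x j Reject = z j) \<and>
     (\<forall>j k. y j k Take + y j k Leave = pmf (q j) k * x j Probe)"

definition lp_hires :: "('n \<Rightarrow> action \<Rightarrow> real) \<Rightarrow> ('n \<Rightarrow> 'm \<Rightarrow> verdict \<Rightarrow> real) \<Rightarrow> real" where
  "lp_hires x y = (\<Sum>j\<in>UNIV. \<Sum>k\<in>UNIV. y j k Take) + (\<Sum>j\<in>UNIV. x j Accept)"

definition lp_probes :: "('n \<Rightarrow> action \<Rightarrow> real) \<Rightarrow> real" where
  "lp_probes x = (\<Sum>j\<in>UNIV. x j Probe)"

lemma lp_feasible_iff: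
  "lp_feasible q bh bp z x y \<longleftrightarrow> lp_local z x y \<and> lp_hires x y \<le> real bh \<and> lp_probes x \<le> real bp"
  unfolding lp_feasible_def lp_local_def lp_hires_def lp_probes_def by auto

text \<open>
  What a type loses through its probed mass \<open>xp\<close> when the verdicts are split as in
  \<open>yj\<close>.
\<close>

definition probe_gap :: "'n \<Rightarrow> real \<Rightarrow> ('m \<Rightarrow> verdict \<Rightarrow> real) \<Rightarrow> price \<Rightarrow> real" where
  "probe_gap j xp yj L =
     xp * best j L - ((\<Sum>k\<in>UNIV. (r j k - fst L) * yj k Take) - snd L * xp)"

lemma duality_gap:
  assumes "lp_local z x y"
  shows "dual_bound L bh bp z - lp_value q r x y =
    fst L * (bh - lp_hires x y) + snd L * (bp - lp_probes x) +
    (\<Sum>j\<in>UNIV. x j Accept * loss j Accept undefined L + x j Reject * loss j Reject undefined L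
       + probe_gap j (x j Probe) (y j) L)"
proof -
  have z: "z j = x j Accept + x j Probe + x j Reject" for j
    using assms by (simp add: lp_local_def)
  have "x j Accept * loss j Accept undefined L + x j Reject * loss j Reject undefined L
       + probe_gap j (x j Probe) (y j) L =
      z j * best j L - x j Accept * mean_reward q r j + fst L * x j Accept
      - (\<Sum>k\<in>UNIV. r j k * y j k Take) + fst L * (\<Sum>k\<in>UNIV. y j k Take) + snd L * x j Probe" for j
    unfolding z probe_gap_def loss_def payoff_def
    by (simp add: algebra_simps sum_subtractf sum_distrib_left)
  then have "(\<Sum>j\<in>UNIV. x j Accept * loss j Accept undefined L + x j Reject * loss j Reject undefined L
       + probe_gap j (x j Probe) (y j) L) =
     (\<Sum>j\<in>UNIV. z j * best j L - x j Accept * mean_reward q r j + fst L * x j Accept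
      - (\<Sum>k\<in>UNIV. r j k * y j k Take) + fst L * (\<Sum>k\<in>UNIV. y j k Take) + snd L * x j Probe)"
    by simp
  also have "\<dots> = (\<Sum>j\<in>UNIV. z j * best j L) - (\<Sum>j\<in>UNIV. x j Accept * mean_reward q r j)
      + fst L * (\<Sum>j\<in>UNIV. x j Accept)
      - (\<Sum>j\<in>UNIV. \<Sum>k\<in>UNIV. r j k * y j k Take) + fst L * (\<Sum>j\<in>UNIV. \<Sum>k\<in>UNIV. y j k Take)
      + snd L * (\<Sum>j\<in>UNIV. x j Probe)"
    by (simp add: sum.distrib sum_subtractf sum_distrib_left)
  finally show ?thesis
    unfolding dual_bound_def lp_value_def lp_hires_def lp_probes_def
    by (simp add: algebra_simps)
qed

text \<open>
  A verdict that maximises the solution carries at least half of its sub-type, so the solution pays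
  at least half of what this verdict loses against the better one.
\<close>

lemma probe_gap_ge_half_loss:
  assumes xp: "0 \<le> xp" and y0: "\<And>k u. 0 \<le> yj k u"
    and y: "\<And>k. yj k Take + yj k Leave = pmf (q j) k * xp"
    and w: "\<And>k u. yj k u \<le> yj k (w k)"
  shows "xp * loss j Probe w L \<le> 2 * probe_gap j xp yj L"
proof -
  \<comment> \<open>the better verdict at this price; the split in the solution earns at most the average of \<open>v\<close> and \<open>w\<close>\<close>
  define v where "v k = (if r j k \<ge> fst L then Take else Leave)" for k
  have key: "2 * ((r j k - fst L) * yj k Take) \<le> xp * (pmf (q j) k * (of_bool (w k = Take) * (r j k - fst L)))
     + xp * (pmf (q j) k * (of_bool (v k = Take) * (r j k - fst L)))" for k
  proof -
    let ?d = "r j k - fst L" and ?m = "pmf (q j) k * xp"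
    have T: "0 \<le> yj k Take" "yj k Take \<le> ?m" using y0[of k Take] y0[of k Leave] y[of k] by linarith+
    show ?thesis
    proof (cases "w k = Take")
      case True
      then have half: "?m \<le> 2 * yj k Take" using w[of k Leave] y[of k] by simp
      show ?thesis
      proof (cases "?d \<ge> 0")
        case True
        have "?d * yj k Take \<le> ?d * ?m" using True T by (intro mult_left_mono) auto
        then show ?thesis using True \<open>w k = Take\<close> by (simp add: v_def algebra_simps)
      next
        case False
        have "?d * (2 * yj k Take) \<le> ?d * ?m" using False half by (intro mult_left_mono_neg) auto
        then show ?thesis using False \<open>w k = Take\<close> by (simp add: v_def algebra_simps)
      qed
    next
      case False
      then have wL: "w k = Leave" using verdict.exhaust by blast
      then have half: "2 * yj k Take \<le> ?m" using w[of k Take] y[of k] by simp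
      show ?thesis
      proof (cases "?d \<ge> 0")
        case True
        have "?d * (2 * yj k Take) \<le> ?d * ?m" using True half by (intro mult_left_mono) auto
        then show ?thesis using True wL by (simp add: v_def algebra_simps)
      next
        case False
        have "?d * yj k Take \<le> 0" using False T by (simp add: mult_nonpos_nonneg)
        then show ?thesis using False wL by (simp add: v_def mult.commute)
      qed
    qed
  qed
  have "2 * (\<Sum>k\<in>UNIV. (r j k - fst L) * yj k Take) \<le>
      xp * (payoff j Probe w L + snd L) + xp * (payoff j Probe v L + snd L)"
    using sum_mono[of UNIV "\<lambda>k. 2 * ((r j k - fst L) * yj k Take)", OF key]
    unfolding payoff_Probe by (simp add: sum_distrib_left sum.distrib)
  moreover have "xp * payoff j Probe v L \<le> xp * best j L"
    using payoff_le_best xp by (intro mult_left_mono) auto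
  ultimately show ?thesis
    unfolding probe_gap_def loss_def by (simp add: algebra_simps)
qed

lemma probe_gap_nonneg:
  assumes "lp_local z x y"
  shows "0 \<le> probe_gap j (x j Probe) (y j) L"
proof -
  define w where "w k = (if y j k Take \<ge> y j k Leave then Take else Leave)" for k
  have "y j k u \<le> y j k (w k)" for k u by (cases u) (auto simp: w_def)
  then have "x j Probe * loss j Probe w L \<le> 2 * probe_gap j (x j Probe) (y j) L"
    using assms by (intro probe_gap_ge_half_loss) (auto simp: lp_local_def)
  moreover have "0 \<le> x j Probe * loss j Probe w L"
    using assms loss_nonneg by (simp add: lp_local_def)
  ultimately show ?thesis by linarith
qed

lemma duality_gap_ge_type:
  assumes loc: "lp_local z x y" and L: "0 \<le> fst L" "0 \<le> snd L"
    and bud: "lp_hires x y \<le> bh" "lp_probes x \<le> bp"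
  shows "(\<Sum>j\<in>J. x j Accept * loss j Accept undefined L + x j Reject * loss j Reject undefined L
       + probe_gap j (x j Probe) (y j) L) \<le> dual_bound L bh bp z - lp_value q r x y"
proof -
  have "(\<Sum>j\<in>J. x j Accept * loss j Accept undefined L + x j Reject * loss j Reject undefined L
       + probe_gap j (x j Probe) (y j) L) \<le> (\<Sum>j\<in>UNIV. x j Accept * loss j Accept undefined L + x j Reject * loss j Reject undefined L
       + probe_gap j (x j Probe) (y j) L)"
    using probe_gap_nonneg[OF loc] loc loss_nonneg
    by (intro sum_mono2) (auto simp: lp_local_def)
  moreover have "0 \<le> fst L * (bh - lp_hires x y)" "0 \<le> snd L * (bp - lp_probes x)"
    using L bud by simp_all
  ultimately show ?thesis unfolding duality_gap[OF loc] by linarith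
qed

end

section \<open>Strong duality with finitely many prices\<close>

context probing
begin

lemma lp_local_convex:
  assumes "lp_local z x y" "lp_local z x' y'" "0 \<le> u" "0 \<le> v" "u + v = 1"
  shows "lp_local z (\<lambda>j a. u * x j a + v * x' j a) (\<lambda>j k a. u * y j k a + v * y' j k a)"
proof -
  have "u * x j Accept + v * x' j Accept + (u * x j Probe + v * x' j Probe) + (u * x j Reject + v * x' j Reject) = z j" for j
  proof -
    have "u * x j Accept + v * x' j Accept + (u * x j Probe + v * x' j Probe) + (u * x j Reject + v * x' j Reject)
      = u * (x j Accept + x j Probe + x j Reject) + v * (x' j Accept + x' j Probe + x' j Reject)"
      by (simp add: algebra_simps)
    also have "\<dots> = (u + v) * z j" using assms(1,2) by (simp add: lp_local_def distrib_right)
    finally show ?thesis using assms by simp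
  qed
  moreover have "u * y j k Take + v * y' j k Take + (u * y j k Leave + v * y' j k Leave) =
      pmf (q j) k * (u * x j Probe + v * x' j Probe)" for j k
  proof -
    have "u * y j k Take + v * y' j k Take + (u * y j k Leave + v * y' j k Leave) =
      u * (y j k Take + y j k Leave) + v * (y' j k Take + y' j k Leave)" by (simp add: algebra_simps)
    also have "\<dots> = u * (pmf (q j) k * x j Probe) + v * (pmf (q j) k * x' j Probe)"
      using assms(1,2) unfolding lp_local_def by metis
    finally show ?thesis by (simp add: algebra_simps)
  qed
  ultimately show ?thesis using assms by (simp add: lp_local_def)
qed

lemma lp_value_affine:
  "lp_value q r (\<lambda>j a. u * x j a + v * x' j a) (\<lambda>j k a. u * y j k a + v * y' j k a) =
    u * lp_value q r x y + v * lp_value q r x' y'"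
  by (simp add: lp_value_def algebra_simps sum.distrib sum_distrib_left)

lemma lp_hires_affine:
  "lp_hires (\<lambda>j a. u * x j a + v * x' j a) (\<lambda>j k a. u * y j k a + v * y' j k a) =
    u * lp_hires x y + v * lp_hires x' y'"
  by (simp add: lp_hires_def algebra_simps sum.distrib sum_distrib_left)

lemma lp_probes_affine:
  "lp_probes (\<lambda>j a. u * x j a + v * x' j a) = u * lp_probes x + v * lp_probes x'"
  by (simp add: lp_probes_def algebra_simps sum.distrib sum_distrib_left)

definition rmax :: real where
  "rmax = (\<Sum>j\<in>UNIV. \<Sum>k\<in>UNIV. \<bar>r j k\<bar>)"

lemma r_le_rmax: "\<bar>r j k\<bar> \<le> rmax"
proof -
  have "\<bar>r j k\<bar> \<le> (\<Sum>k\<in>UNIV. \<bar>r j k\<bar>)" by (rule member_le_sum) auto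
  also have "\<dots> \<le> rmax" unfolding rmax_def
    by (rule member_le_sum[where f = "\<lambda>j. \<Sum>k\<in>UNIV. \<bar>r j k\<bar>"]) (auto intro: sum_nonneg)
  finally show ?thesis .
qed

lemma rmax_nonneg: "0 \<le> rmax"
  by (simp add: rmax_def sum_nonneg)

lemma plan_gain_abs_le: "\<bar>plan_gain j a w\<bar> \<le> rmax * rate j a w"
proof -
  have "\<bar>plan_gain j a w\<bar> \<le> (\<Sum>k\<in>UNIV. \<bar>pmf (q j) k * (of_bool (hired a w k) * r j k)\<bar>)"
    unfolding plan_gain_def by (rule sum_abs)
  also have "\<dots> \<le> (\<Sum>k\<in>UNIV. rmax * (pmf (q j) k * of_bool (hired a w k)))"
    using r_le_rmax by (intro sum_mono) (auto simp: abs_mult mult.commute intro: mult_right_mono)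
  finally show ?thesis unfolding rate_def sum_distrib_left .
qed

lemma mean_reward_le_rmax: "mean_reward q r j \<le> rmax"
  using plan_gain_abs_le[of j Accept undefined] by simp

lemma lp_value_le:
  assumes "lp_local z x y"
  shows "lp_value q r x y \<le> rmax * lp_hires x y"
proof -
  have "(\<Sum>k\<in>UNIV. r j k * y j k Take) \<le> (\<Sum>k\<in>UNIV. rmax * y j k Take)" for j
    using assms r_le_rmax by (intro sum_mono mult_right_mono) (auto simp: lp_local_def abs_le_iff)
  then have "(\<Sum>j\<in>UNIV. \<Sum>k\<in>UNIV. r j k * y j k Take) \<le> (\<Sum>j\<in>UNIV. \<Sum>k\<in>UNIV. rmax * y j k Take)"
    by (rule sum_mono)
  moreover have "(\<Sum>j\<in>UNIV. mean_reward q r j * x j Accept) \<le> (\<Sum>j\<in>UNIV. rmax * x j Accept)"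
    using assms mean_reward_le_rmax by (intro sum_mono mult_right_mono) (auto simp: lp_local_def)
  ultimately show ?thesis
    by (simp add: lp_value_def lp_hires_def sum_distrib_left distrib_left)
qed

text \<open>
  Probed mass in excess of a budget can be rejected instead, at a cost of at most
  \<open>rmax\<close> per unit.
\<close>

lemma cut_probes:
  assumes loc: "lp_local z x y" and bp: "0 \<le> bp"
  obtains x' y' where "lp_local z x' y'" "lp_hires x' y' \<le> lp_hires x y" "lp_probes x' \<le> bp"
    "lp_value q r x y \<le> lp_value q r x' y' + rmax * max 0 (lp_probes x - bp)"
proof (cases "lp_probes x \<le> bp")
  case True
  have "0 \<le> rmax * max 0 (lp_probes x - bp)" using rmax_nonneg by (simp add: mult_nonneg_nonneg)
  then show thesis using True loc by (intro that[of x y]) auto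
next
  case False
  define \<theta> where "\<theta> = bp / lp_probes x"
  have pos: "lp_probes x > 0" using False bp by linarith
  have \<theta>: "0 \<le> \<theta>" "\<theta> \<le> 1" "\<theta> * lp_probes x = bp"
    using False bp pos by (auto simp: \<theta>_def field_simps)
  define x' where "x' j a = (case a of Accept \<Rightarrow> x j Accept | Probe \<Rightarrow> \<theta> * x j Probe
     | Reject \<Rightarrow> x j Reject + (1 - \<theta>) * x j Probe)" for j a
  define y' where "y' j k v = \<theta> * y j k v" for j :: 'n and k :: 'm and v
  have x0: "0 \<le> x j a" and y0: "0 \<le> y j k v" for j a k v using loc by (auto simp: lp_local_def)
  have "0 \<le> x' j a" for j a using x0 \<theta> by (cases a) (auto simp: x'_def)
  moreover have "x' j Accept + x' j Probe + x' j Reject = z j" for j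
    using loc by (simp add: x'_def lp_local_def algebra_simps)
  moreover have "y' j k Take + y' j k Leave = pmf (q j) k * x' j Probe" for j k
    using loc by (simp add: x'_def y'_def lp_local_def algebra_simps flip: distrib_left)
  ultimately have loc': "lp_local z x' y'"
    using y0 \<theta> by (simp add: lp_local_def y'_def)
  have hir: "lp_hires x' y' \<le> lp_hires x y"
    unfolding lp_hires_def x'_def y'_def using y0 \<theta>
    by (intro add_mono sum_mono) (auto intro: mult_left_le_one_le)
  have pro: "lp_probes x' = bp" using \<theta>(3) by (simp add: lp_probes_def x'_def flip: sum_distrib_left)
  have "lp_value q r x y - lp_value q r x' y' = (1 - \<theta>) * (\<Sum>j\<in>UNIV. \<Sum>k\<in>UNIV. r j k * y j k Take)"
    unfolding lp_value_def x'_def y'_def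
    by (simp add: left_diff_distrib mult.left_commute[of "r _ _"] flip: sum_distrib_left)
  also have "\<dots> \<le> (1 - \<theta>) * (\<Sum>j\<in>UNIV. rmax * x j Probe)"
  proof (intro mult_left_mono sum_mono)
    fix j
    have yle: "y j k Take \<le> pmf (q j) k * x j Probe" for k
    proof -
      have "y j k Take + y j k Leave = pmf (q j) k * x j Probe" using loc by (simp add: lp_local_def)
      then show ?thesis using y0[of j k Leave] by linarith
    qed
    have "(\<Sum>k\<in>UNIV. r j k * y j k Take) \<le> (\<Sum>k\<in>UNIV. rmax * (pmf (q j) k * x j Probe))"
    proof (intro sum_mono)
      fix k
      have "r j k * y j k Take \<le> rmax * y j k Take"
        using r_le_rmax[of j k] y0 by (intro mult_right_mono) auto
      also have "\<dots> \<le> rmax * (pmf (q j) k * x j Probe)"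
        using yle rmax_nonneg by (intro mult_left_mono) auto
      finally show "r j k * y j k Take \<le> rmax * (pmf (q j) k * x j Probe)" .
    qed
    also have "\<dots> = rmax * x j Probe * (\<Sum>k\<in>UNIV. pmf (q j) k)"
      by (simp add: sum_distrib_left mult_ac)
    finally show "(\<Sum>k\<in>UNIV. r j k * y j k Take) \<le> rmax * x j Probe" by (simp add: sum_pmf_UNIV)
  qed (use \<theta> in auto)
  also have "\<dots> = rmax * (lp_probes x - bp)"
    using \<theta>(3) by (simp add: lp_probes_def algebra_simps flip: sum_distrib_left)
  finally show thesis using that[OF loc' hir] pro False by simp
qed

text \<open>
  Mixing with the solution that rejects everything repairs the hiring constraint: the value is at
  most \<open>rmax\<close> per hire, so scaling costs at most \<open>rmax\<close> per hire given
  up.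
\<close>

lemma cut_hires:
  assumes loc: "lp_local z x y" and bh: "0 \<le> bh"
  obtains x' y' where "lp_local z x' y'" "lp_hires x' y' \<le> bh" "lp_probes x' \<le> lp_probes x"
    "lp_value q r x y \<le> lp_value q r x' y' + rmax * max 0 (lp_hires x y - bh)"
proof (cases "lp_hires x y \<le> bh")
  case True
  have "0 \<le> rmax * max 0 (lp_hires x y - bh)" using rmax_nonneg by (simp add: mult_nonneg_nonneg)
  then show thesis using True loc by (intro that[of x y]) auto
next
  case False
  define \<theta> where "\<theta> = bh / lp_hires x y"
  have pos: "lp_hires x y > 0" using False bh by linarith
  have \<theta>: "0 \<le> \<theta>" "\<theta> \<le> 1" "\<theta> * lp_hires x y = bh"
    using False bh pos by (auto simp: \<theta>_def field_simps)
  have x0: "0 \<le> x j a" and y0: "0 \<le> y j k v" for j a k v using loc by (auto simp: lp_local_def)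
  have z: "z j = x j Accept + x j Probe + x j Reject" for j using loc by (simp add: lp_local_def)
  define x0' where "x0' j a = (if a = Reject then z j else 0)" for j a
  have loc0: "lp_local z x0' (\<lambda>j k v. 0)"
    using x0 by (simp add: lp_local_def x0'_def z)
  have v0: "lp_value q r x0' (\<lambda>j k v. 0) = 0" "lp_hires x0' (\<lambda>j k v. 0) = 0" "lp_probes x0' = 0"
    by (simp_all add: lp_value_def lp_hires_def lp_probes_def x0'_def)
  let ?x = "\<lambda>j a. \<theta> * x j a + (1 - \<theta>) * x0' j a" and ?y = "\<lambda>j k a. \<theta> * y j k a + (1 - \<theta>) * 0"
  have val: "lp_value q r ?x ?y = \<theta> * lp_value q r x y"
    using lp_value_affine[of \<theta> x "1 - \<theta>" x0' y "\<lambda>j k v. 0"] v0 by simp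
  have hir: "lp_hires ?x ?y = bh"
    using lp_hires_affine[of \<theta> x "1 - \<theta>" x0' y "\<lambda>j k v. 0"] v0 \<theta> by simp
  have pro: "lp_probes ?x \<le> lp_probes x"
    using lp_probes_affine[of \<theta> x "1 - \<theta>" x0'] v0 \<theta> x0
    by (simp add: mult_left_le_one_le lp_probes_def sum_nonneg)
  have "(1 - \<theta>) * lp_value q r x y \<le> (1 - \<theta>) * (rmax * lp_hires x y)"
    using \<theta> lp_value_le[OF loc] by (intro mult_left_mono) auto
  also have "\<dots> = rmax * (lp_hires x y - bh)" using \<theta>(3) by (simp add: algebra_simps)
  finally have "lp_value q r x y \<le> lp_value q r ?x ?y + rmax * max 0 (lp_hires x y - bh)"
    using False unfolding val by (simp add: algebra_simps)
  then show thesis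
    using that[of ?x ?y] lp_local_convex[OF loc loc0 \<theta>(1), of "1 - \<theta>"] \<theta>(2) hir pro by simp
qed

text \<open>
  Budget violations never pay more than \<open>rmax\<close> per unit. This replaces a Slater
  condition in the separation argument below, so that budgets equal to zero need no separate
  treatment.
\<close>

lemma exact_penalty:
  assumes opt: "lp_optimal q r bh bp z x y" and loc: "lp_local z x' y'"
  shows "lp_value q r x' y' \<le> lp_value q r x y
    + rmax * max 0 (lp_hires x' y' - bh) + rmax * max 0 (lp_probes x' - bp)"
proof -
  obtain x1 y1 where 1: "lp_local z x1 y1" "lp_hires x1 y1 \<le> lp_hires x' y'" "lp_probes x1 \<le> bp"
    "lp_value q r x' y' \<le> lp_value q r x1 y1 + rmax * max 0 (lp_probes x' - bp)"
    using cut_probes[OF loc, of bp] by auto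
  obtain x2 y2 where 2: "lp_local z x2 y2" "lp_hires x2 y2 \<le> bh" "lp_probes x2 \<le> lp_probes x1"
    "lp_value q r x1 y1 \<le> lp_value q r x2 y2 + rmax * max 0 (lp_hires x1 y1 - bh)"
    using cut_hires[OF 1(1), of bh] by auto
  have "lp_feasible q bh bp z x2 y2" using 1 2 by (simp add: lp_feasible_iff)
  then have "lp_value q r x2 y2 \<le> lp_value q r x y" using opt by (simp add: lp_optimal_def)
  moreover have "rmax * max 0 (lp_hires x1 y1 - bh) \<le> rmax * max 0 (lp_hires x' y' - bh)"
    using 1 rmax_nonneg by (intro mult_left_mono) auto
  ultimately show ?thesis using 1 2 by linarith
qed

text \<open>
  The attainable triples (value, excess hires, excess probes) form a convex set, and by the exact
  penalty it misses the open convex set above the penalised optimum. The coefficient of the value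
  in a separating functional cannot vanish, because the latter set projects onto all excesses;
  normalising it yields the prices.
\<close>

lemma strong_duality:
  assumes opt: "lp_optimal q r bh bp z x y"
  obtains L where "0 \<le> fst L" "0 \<le> snd L" "dual_bound L bh bp z \<le> lp_value q r x y"
proof -
  define v where "v = lp_value q r x y"
  define S where "S = {(c, s, t) | c s t. \<exists>x' y'. lp_local z x' y' \<and> c \<le> lp_value q r x' y' \<and>
     lp_hires x' y' - bh \<le> s \<and> lp_probes x' - bp \<le> (t :: real)}"
  define U where "U = {(c, s, t) | c s t :: real. v + rmax * max 0 s + rmax * max 0 t < c}"
  have feas: "lp_local z x y" using opt by (simp add: lp_optimal_def lp_feasible_iff)
  have "convex S"
  proof (rule convexI)
    fix a b and u w :: real
    assume a: "a \<in> S" and b: "b \<in> S" and uw: "0 \<le> u" "0 \<le> w" "u + w = 1"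
    obtain c s t where A: "a = (c, s, t)" by (cases a)
    obtain c' s' t' where B: "b = (c', s', t')" by (cases b)
    obtain x1 y1 where 1: "lp_local z x1 y1" "c \<le> lp_value q r x1 y1" "lp_hires x1 y1 - bh \<le> s" "lp_probes x1 - bp \<le> t"
      using a unfolding S_def A by auto
    obtain x2 y2 where 2: "lp_local z x2 y2" "c' \<le> lp_value q r x2 y2" "lp_hires x2 y2 - bh \<le> s'" "lp_probes x2 - bp \<le> t'"
      using b unfolding S_def B by auto
    have w: "w = 1 - u" using uw by simp
    have "u * c + w * c' \<le> u * lp_value q r x1 y1 + w * lp_value q r x2 y2"
      using 1 2 uw by (intro add_mono mult_left_mono) auto
    moreover have "u * (lp_hires x1 y1 - bh) + w * (lp_hires x2 y2 - bh) \<le> u * s + w * s'"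
      using 1 2 uw by (intro add_mono mult_left_mono) auto
    then have "u * lp_hires x1 y1 + w * lp_hires x2 y2 - bh \<le> u * s + w * s'"
      unfolding w by (simp add: algebra_simps)
    moreover have "u * (lp_probes x1 - bp) + w * (lp_probes x2 - bp) \<le> u * t + w * t'"
      using 1 2 uw by (intro add_mono mult_left_mono) auto
    then have "u * lp_probes x1 + w * lp_probes x2 - bp \<le> u * t + w * t'"
      unfolding w by (simp add: algebra_simps)
    ultimately show "u *\<^sub>R a + w *\<^sub>R b \<in> S"
      unfolding S_def A B using lp_local_convex[OF 1(1) 2(1) uw]
        lp_value_affine[of u x1 w x2 y1 y2] lp_hires_affine[of u x1 w x2 y1 y2] lp_probes_affine[of u x1 w x2]
      by (auto intro!: exI)
  qed
  moreover have "convex U"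
  proof (rule convexI)
    fix a b and u w :: real
    assume a: "a \<in> U" and b: "b \<in> U" and uw: "0 \<le> u" "0 \<le> w" "u + w = 1"
    obtain c s t where A: "a = (c, s, t)" by (cases a)
    obtain c' s' t' where B: "b = (c', s', t')" by (cases b)
    have 1: "v + rmax * max 0 s + rmax * max 0 t < c" and 2: "v + rmax * max 0 s' + rmax * max 0 t' < c'"
      using a b unfolding U_def A B by auto
    have mx: "rmax * max 0 (u * s + w * s') \<le> u * (rmax * max 0 s) + w * (rmax * max 0 s')" for s s' :: real
    proof -
      have "u * s \<le> u * max 0 s" "w * s' \<le> w * max 0 s'" using uw by (auto intro: mult_left_mono)
      moreover have "0 \<le> u * max 0 s" "0 \<le> w * max 0 s'" using uw by auto
      ultimately have "max 0 (u * s + w * s') \<le> u * max 0 s + w * max 0 s'" by simp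
      then have "rmax * max 0 (u * s + w * s') \<le> rmax * (u * max 0 s + w * max 0 s')"
        using rmax_nonneg by (rule mult_left_mono)
      then show ?thesis by (simp add: algebra_simps)
    qed
    have "u * (v + rmax * max 0 s + rmax * max 0 t) + w * (v + rmax * max 0 s' + rmax * max 0 t') < u * c + w * c'"
    proof (cases "u = 0")
      case True
      then show ?thesis using 2 uw by simp
    next
      case False
      then have "u * (v + rmax * max 0 s + rmax * max 0 t) < u * c" using 1 uw by simp
      moreover have "w * (v + rmax * max 0 s' + rmax * max 0 t') \<le> w * c'"
        using 2 uw by (intro mult_left_mono) auto
      ultimately show ?thesis by linarith
    qed
    moreover have "u * v + w * v = v" using uw by (simp flip: distrib_right)
    ultimately have "v + rmax * max 0 (u * s + w * s') + rmax * max 0 (u * t + w * t') < u * c + w * c'"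
      using mx[of s s'] mx[of t t'] by (simp add: algebra_simps)
    then show "u *\<^sub>R a + w *\<^sub>R b \<in> U" unfolding U_def A B by simp
  qed
  moreover have "(v, lp_hires x y - bh, lp_probes x - bp) \<in> S"
    unfolding S_def v_def using feas by auto
  then have "S \<noteq> {}" by blast
  moreover have U: "(c, s, t) \<in> U" if "v + rmax * max 0 s + rmax * max 0 t < c" for c s t
    using that by (simp add: U_def)
  then have "U \<noteq> {}" using U[of 0 0 "v + 1"] by force
  moreover have "S \<inter> U = {}"
  proof (intro equalityI subsetI)
    fix e assume e: "e \<in> S \<inter> U"
    obtain c s t where est: "e = (c, s, t)" by (cases e)
    obtain x' y' where 1: "lp_local z x' y'" "c \<le> lp_value q r x' y'" "lp_hires x' y' - bh \<le> s" "lp_probes x' - bp \<le> t"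
      using e unfolding S_def est by auto
    have "c \<le> v + rmax * max 0 (lp_hires x' y' - bh) + rmax * max 0 (lp_probes x' - bp)"
      using exact_penalty[OF opt 1(1)] 1(2) by (simp add: v_def)
    also have "\<dots> \<le> v + rmax * max 0 s + rmax * max 0 t"
      using 1 rmax_nonneg by (intro add_mono mult_left_mono) auto
    finally show "e \<in> {}" using e by (auto simp: U_def est)
  qed auto
  ultimately obtain a b where ab: "a \<noteq> 0" "\<forall>e\<in>S. inner a e \<le> b" "\<forall>e\<in>U. b \<le> inner a e"
    using separating_hyperplane_sets by metis
  obtain \<kappa> \<alpha> \<beta> where a: "a = (\<kappa>, \<alpha>, \<beta>)" by (cases a)
  have S_le: "\<kappa> * c + \<alpha> * s + \<beta> * t \<le> b"
    if "lp_local z x' y'" "c \<le> lp_value q r x' y'" "lp_hires x' y' - bh \<le> s" "lp_probes x' - bp \<le> t" for c s t x' y'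
    using ab(2) that unfolding a S_def by (fastforce simp: inner_prod_def)
  have U_ge: "b \<le> \<kappa> * c + \<alpha> * s + \<beta> * t" if "v + rmax * max 0 s + rmax * max 0 t < c" for c s t
    using ab(3) U[OF that] unfolding a by (fastforce simp: inner_prod_def)
  \<comment> \<open>a linear function bounded on a ray has the right sign\<close>
  have ray: "e \<le> 0" if "\<And>c. 0 \<le> c \<Longrightarrow> e * c \<le> d" for e d :: real
  proof (rule ccontr)
    assume "\<not> e \<le> 0"
    then have "e * ((\<bar>d\<bar> + 1) / e) = \<bar>d\<bar> + 1" by simp
    moreover have "e * ((\<bar>d\<bar> + 1) / e) \<le> d" using \<open>\<not> e \<le> 0\<close> by (intro that) auto
    ultimately show False by linarith
  qed
  have "\<alpha> \<le> 0"
  proof (rule ray)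
    fix c :: real assume "0 \<le> c"
    then show "\<alpha> * c \<le> b - \<kappa> * v - \<alpha> * (lp_hires x y - bh) - \<beta> * (lp_probes x - bp)"
      using S_le[OF feas, of v "lp_hires x y - bh + c" "lp_probes x - bp"] by (simp add: v_def algebra_simps)
  qed
  moreover have "\<beta> \<le> 0"
  proof (rule ray)
    fix c :: real assume "0 \<le> c"
    then show "\<beta> * c \<le> b - \<kappa> * v - \<alpha> * (lp_hires x y - bh) - \<beta> * (lp_probes x - bp)"
      using S_le[OF feas, of v "lp_hires x y - bh" "lp_probes x - bp + c"] by (simp add: v_def algebra_simps)
  qed
  moreover have "0 \<le> \<kappa>"
  proof -
    have "- \<kappa> \<le> 0"
    proof (rule ray)
      fix c :: real assume "0 \<le> c"
      then show "- \<kappa> * c \<le> \<kappa> * (v + 1) - b"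
        using U_ge[of 0 0 "v + 1 + c"] by (simp add: algebra_simps)
    qed
    then show ?thesis by simp
  qed
  moreover have "\<kappa> \<noteq> 0"
  proof
    assume k0: "\<kappa> = 0"
    have lin: "b \<le> \<alpha> * s + \<beta> * t" for s t
      using U_ge[of s t "v + rmax * max 0 s + rmax * max 0 t + 1"] by (simp add: k0)
    have "- \<alpha> \<le> 0" by (rule ray[of _ "- b"]) (use lin[of _ 0] in \<open>simp add: algebra_simps\<close>)
    moreover have "- \<beta> \<le> 0" by (rule ray[of _ "- b"]) (use lin[of 0] in \<open>simp add: algebra_simps\<close>)
    ultimately show False using ab(1) \<open>\<alpha> \<le> 0\<close> \<open>\<beta> \<le> 0\<close> by (simp add: a k0 zero_prod_def)
  qed
  ultimately have signs: "\<alpha> \<le> 0" "\<beta> \<le> 0" "0 < \<kappa>" by auto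
  have bv: "b \<le> \<kappa> * v"
  proof (rule field_le_epsilon)
    fix e :: real assume "0 < e"
    then show "b \<le> \<kappa> * v + e"
      using U_ge[of 0 0 "v + e / \<kappa>"] signs by (simp add: algebra_simps)
  qed
  define L where "L = (- \<alpha> / \<kappa>, - \<beta> / \<kappa>)"
  have L0: "0 \<le> fst L" "0 \<le> snd L" using signs by (auto simp: L_def divide_nonpos_pos)
  have lagr: "lp_value q r x' y' + fst L * (bh - lp_hires x' y') + snd L * (bp - lp_probes x') \<le> v"
    if "lp_local z x' y'" for x' y'
  proof -
    have "\<kappa> * lp_value q r x' y' + \<alpha> * (lp_hires x' y' - bh) + \<beta> * (lp_probes x' - bp) \<le> \<kappa> * v"
      using S_le[OF that, of "lp_value q r x' y'"] bv by fastforce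
    then have "(\<kappa> * lp_value q r x' y' + \<alpha> * (lp_hires x' y' - bh) + \<beta> * (lp_probes x' - bp)) / \<kappa> \<le> v"
      using signs by (simp add: field_simps)
    moreover have "lp_value q r x' y' + fst L * (bh - lp_hires x' y') + snd L * (bp - lp_probes x') =
       (\<kappa> * lp_value q r x' y' + \<alpha> * (lp_hires x' y' - bh) + \<beta> * (lp_probes x' - bp)) / \<kappa>"
      using signs by (simp add: L_def field_simps)
    ultimately show ?thesis by simp
  qed
  \<comment> \<open>evaluate the Lagrangian at the solution that plays a best plan for every type\<close>
  have "\<forall>j. \<exists>a w. best j L = payoff j a w L" using best_attained by blast
  then obtain A W where AW: "\<And>j. best j L = payoff j (A j) (W j) L" by metis
  define x' where "x' j a = (if a = A j then z j else 0)" for j a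
  define y' where "y' j k u = (if A j = Probe \<and> u = W j k then pmf (q j) k * z j else 0)" for j k u
  have z0: "0 \<le> z j" for j
  proof -
    have "z j = x j Accept + x j Probe + x j Reject" using feas by (simp add: lp_local_def)
    moreover have "0 \<le> x j a" for a using feas by (simp add: lp_local_def)
    ultimately show ?thesis by simp
  qed
  have loc': "lp_local z x' y'"
  proof -
    have "x' j Accept + x' j Probe + x' j Reject = z j" for j
      by (cases "A j") (auto simp: x'_def)
    moreover have "y' j k Take + y' j k Leave = pmf (q j) k * x' j Probe" for j k
      by (cases "W j k") (auto simp: x'_def y'_def)
    ultimately show ?thesis using z0 by (auto simp: lp_local_def x'_def y'_def)
  qed
  have "x' j Accept * loss j Accept undefined L + x' j Reject * loss j Reject undefined L
       + probe_gap j (x' j Probe) (y' j) L = 0" for j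
  proof (cases "A j")
    case Probe
    have "(\<Sum>k\<in>UNIV. (r j k - fst L) * y' j k Take) = z j * (payoff j Probe (W j) L + snd L)"
      unfolding payoff_Probe y'_def using Probe
      by (simp add: sum_distrib_left) (intro sum.cong, auto)
    then show ?thesis using Probe AW[of j]
      by (simp add: x'_def probe_gap_def algebra_simps)
  qed (use AW[of j] in \<open>simp_all add: x'_def y'_def loss_def probe_gap_def payoff_def\<close>)
  then have "dual_bound L bh bp z = lp_value q r x' y' + fst L * (bh - lp_hires x' y') + snd L * (bp - lp_probes x')"
    using duality_gap[OF loc', of L bh bp] by simp
  then show thesis using that[OF L0] lagr[OF loc'] by (simp add: v_def)
qed

text \<open>
  Complementary slackness only depends on which variables vanish and which budgets are tight, and
  there are finitely many such patterns. One tight price per pattern therefore serves all budgets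
  and all type counts.
\<close>

definition lp_pattern ::
  "nat \<Rightarrow> nat \<Rightarrow> ('n \<Rightarrow> action \<Rightarrow> real) \<Rightarrow> ('n \<Rightarrow> 'm \<Rightarrow> verdict \<Rightarrow> real) \<Rightarrow>
   ('n \<times> action) set \<times> ('n \<times> 'm \<times> verdict) set \<times> bool \<times> bool" where
  "lp_pattern bh bp x y =
     ({(j, a). x j a \<noteq> 0}, {(j, k, u). y j k u \<noteq> 0}, lp_hires x y = bh, lp_probes x = bp)"

text \<open>
  The gap as a sum of nonnegative terms, each a variable times a function of the price; it vanishes
  exactly when complementary slackness holds.
\<close>

lemma probe_gap_eq:
  fixes L :: price
  assumes "lp_local z x y"
  defines "v \<equiv> \<lambda>j k. if r j k \<ge> fst L then Take else Leave"
  shows "probe_gap j (x j Probe) (y j) L = x j Probe * loss j Probe (v j) L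
     + (\<Sum>k\<in>UNIV. y j k Take * max 0 (fst L - r j k) + y j k Leave * max 0 (r j k - fst L))"
proof -
  have y: "y j k Take + y j k Leave = pmf (q j) k * x j Probe" for k
    using assms(1) by (simp add: lp_local_def)
  have "x j Probe * (pmf (q j) k * (of_bool (v j k = Take) * (r j k - fst L))) - (r j k - fst L) * y j k Take
    = y j k Take * max 0 (fst L - r j k) + y j k Leave * max 0 (r j k - fst L)" for k
  proof -
    have "x j Probe * (pmf (q j) k * (of_bool (v j k = Take) * (r j k - fst L))) =
      (y j k Take + y j k Leave) * (of_bool (v j k = Take) * (r j k - fst L))"
      unfolding y by simp
    then show ?thesis by (cases "r j k \<ge> fst L") (auto simp: v_def algebra_simps)
  qed
  then have "(\<Sum>k\<in>UNIV. y j k Take * max 0 (fst L - r j k) + y j k Leave * max 0 (r j k - fst L)) =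
     x j Probe * (payoff j Probe (v j) L + snd L) - (\<Sum>k\<in>UNIV. (r j k - fst L) * y j k Take)"
    unfolding payoff_Probe by (simp add: sum_distrib_left flip: sum_subtractf)
  then show ?thesis unfolding probe_gap_def loss_def by (simp add: algebra_simps)
qed

lemma tight_price_pattern:
  assumes loc: "lp_feasible q bh bp z x y" and loc': "lp_feasible q bh' bp' z' x' y'"
    and pat: "lp_pattern bh bp x y = lp_pattern bh' bp' x' y'"
    and L: "0 \<le> fst L" "0 \<le> snd L" and tight: "dual_bound L bh bp z \<le> lp_value q r x y"
  shows "dual_bound L bh' bp' z' \<le> lp_value q r x' y'"
proof -
  have l: "lp_local z x y" "lp_local z' x' y'" using loc loc' by (auto simp: lp_feasible_iff)
  define v where "v j k = (if r j k \<ge> fst L then Take else Leave)" for j k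
  define G where "G x y j = x j Accept * loss j Accept undefined L + x j Reject * loss j Reject undefined L
     + (x j Probe * loss j Probe (v j) L
     + (\<Sum>k\<in>UNIV. y j k Take * max 0 (fst L - r j k) + y j k Leave * max 0 (r j k - fst L)))"
    for x :: "'n \<Rightarrow> action \<Rightarrow> real" and y :: "'n \<Rightarrow> 'm \<Rightarrow> verdict \<Rightarrow> real" and j
  have gap: "dual_bound L bh bp z - lp_value q r x y = fst L * (bh - lp_hires x y) + snd L * (bp - lp_probes x) + (\<Sum>j\<in>UNIV. G x y j)"
    if "lp_local z x y" for bh bp z x y
    unfolding duality_gap[OF that] probe_gap_eq[OF that] G_def v_def by simp
  have x0: "0 \<le> x j a" and y0: "0 \<le> y j k u" for j k a u using l by (auto simp: lp_local_def)
  have G0: "0 \<le> G x y j" for j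
    unfolding G_def using x0 y0 loss_nonneg by (intro add_nonneg_nonneg sum_nonneg mult_nonneg_nonneg) auto
  have s0: "0 \<le> fst L * (bh - lp_hires x y)" "0 \<le> snd L * (bp - lp_probes x)"
    using loc L by (auto simp: lp_feasible_iff)
  have sG: "0 \<le> (\<Sum>j\<in>UNIV. G x y j)" using G0 by (simp add: sum_nonneg)
  have sG0: "(\<Sum>j\<in>UNIV. G x y j) = 0" and sh: "fst L * (bh - lp_hires x y) = 0" and sp: "snd L * (bp - lp_probes x) = 0"
    using gap[OF l(1), of bh bp] tight s0 sG by linarith+
  have xs: "x j a = 0 \<longleftrightarrow> x' j a = 0" and ys: "y j k u = 0 \<longleftrightarrow> y' j k u = 0" for j a k u
    using pat by (auto simp: lp_pattern_def set_eq_iff)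
  have "G x' y' j = 0" for j
  proof -
    have "G x y j = 0" using sG0 G0 by (simp add: sum_nonneg_eq_0_iff)
    moreover have nn: "0 \<le> (\<Sum>k\<in>UNIV. y j k Take * max 0 (fst L - r j k) + y j k Leave * max 0 (r j k - fst L))"
      using y0 by (intro sum_nonneg add_nonneg_nonneg mult_nonneg_nonneg) auto
    moreover have "0 \<le> x j a * loss j a w L" for a w using x0 loss_nonneg by simp
    note this[of Accept undefined] this[of Reject undefined] this[of Probe "v j"]
    ultimately have z: "x j Accept * loss j Accept undefined L = 0" "x j Reject * loss j Reject undefined L = 0"
      "x j Probe * loss j Probe (v j) L = 0"
      "(\<Sum>k\<in>UNIV. y j k Take * max 0 (fst L - r j k) + y j k Leave * max 0 (r j k - fst L)) = 0"
      unfolding G_def by linarith+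
    have "y j k Take * max 0 (fst L - r j k) + y j k Leave * max 0 (r j k - fst L) = 0" for k
      using z(4) y0 by (subst (asm) sum_nonneg_eq_0_iff) (auto intro!: add_nonneg_nonneg mult_nonneg_nonneg)
    moreover have "0 \<le> y j k Take * max 0 (fst L - r j k)" "0 \<le> y j k Leave * max 0 (r j k - fst L)" for k
      using y0 by auto
    ultimately have "y j k Take * max 0 (fst L - r j k) = 0 \<and> y j k Leave * max 0 (r j k - fst L) = 0" for k
      by (simp add: add_nonneg_eq_0_iff)
    then have "y' j k Take * max 0 (fst L - r j k) = 0 \<and> y' j k Leave * max 0 (r j k - fst L) = 0" for k
      using ys[of j _ Take] ys[of j _ Leave] unfolding mult_eq_0_iff by blast
    then have "y' j k Take * max 0 (fst L - r j k) = 0" "y' j k Leave * max 0 (r j k - fst L) = 0" for k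
      by blast+
    then have "(\<Sum>k\<in>UNIV. y' j k Take * max 0 (fst L - r j k) + y' j k Leave * max 0 (r j k - fst L)) = 0"
      by (simp only: add_0_right sum.neutral_const)
    moreover have "x' j a * loss j a w L = 0" if "x j a * loss j a w L = 0" for a w
      using that xs[of j a] by auto
    from this[OF z(1)] this[OF z(2)] this[OF z(3)] calculation show ?thesis unfolding G_def by linarith
  qed
  then have "(\<Sum>j\<in>UNIV. G x' y' j) = 0" by simp
  moreover have "fst L * (bh' - lp_hires x' y') = 0" using sh pat by (auto simp: lp_pattern_def)
  moreover have "snd L * (bp' - lp_probes x') = 0" using sp pat by (auto simp: lp_pattern_def)
  ultimately show ?thesis using gap[OF l(2), of bh' bp'] by linarith
qed

theorem finite_price_system:
  obtains V where "finite V" "(0, 0) \<in> V" "\<And>L. L \<in> V \<Longrightarrow> 0 \<le> fst L \<and> 0 \<le> snd L"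
    "\<And>bh bp z x y. lp_optimal q r bh bp z x y \<Longrightarrow> \<exists>L\<in>V. dual_bound L bh bp z \<le> lp_value q r x y"
proof -
  define C where "C P L \<longleftrightarrow> 0 \<le> fst L \<and> 0 \<le> snd L \<and> (\<forall>bh bp z x y. lp_optimal q r bh bp z x y \<and> lp_pattern bh bp x y = P \<longrightarrow>
      dual_bound L bh bp z \<le> lp_value q r x y)" for P L
  have ex: "\<exists>L. C P L" for P
  proof (cases "\<exists>bh bp z x y. lp_optimal q r bh bp z x y \<and> lp_pattern bh bp x y = P")
    case True
    then obtain bh bp z x y where o: "lp_optimal q r bh bp z x y" "lp_pattern bh bp x y = P" by blast
    obtain L where L: "0 \<le> fst L" "0 \<le> snd L" "dual_bound L bh bp z \<le> lp_value q r x y"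
      using strong_duality[OF o(1)] .
    have "C P L" unfolding C_def using L o tight_price_pattern[of bh bp z x y]
      by (auto simp: lp_optimal_def)
    then show ?thesis ..
  next
    case False
    then have "C P (0, 0)" unfolding C_def fst_conv snd_conv by blast
    then show ?thesis ..
  qed
  define V where "V = insert (0, 0) (range (\<lambda>P. SOME L. C P L))"
  have some: "C P (SOME L. C P L)" for P using ex by (rule someI_ex)
  show thesis
  proof (rule that[of V])
    show "finite V" by (simp add: V_def)
    show "0 \<le> fst L \<and> 0 \<le> snd L" if "L \<in> V" for L
      using that some unfolding V_def C_def by auto
    show "\<exists>L\<in>V. dual_bound L bh bp z \<le> lp_value q r x y" if "lp_optimal q r bh bp z x y" for bh bp z x y
    proof -
      have "(SOME L. C (lp_pattern bh bp x y) L) \<in> V" by (simp add: V_def)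
      then show ?thesis using some[of "lp_pattern bh bp x y"] that unfolding C_def by blast
    qed
  qed (simp add: V_def)
qed

end

section \<open>Runs and expectations\<close>

fun etype :: "('n, 'm) event \<Rightarrow> 'n" where
  "etype (Rejected j) = j"
| "etype (Accepted j k) = j"
| "etype (Probed_Taken j k) = j"
| "etype (Probed_Left j k) = j"

text \<open>
  Functionals of a run are accumulated along its history; the summand of a period sees the history
  before it.
\<close>

fun path_sum :: "(('n, 'm) history \<Rightarrow> ('n, 'm) event \<Rightarrow> real) \<Rightarrow> ('n, 'm) history \<Rightarrow> real" where
  "path_sum f [] = 0"
| "path_sum f (e # h) = f h e + path_sum f h"

lemma path_sum_diff: "path_sum (\<lambda>h e. f h e - g h e) h = path_sum f h - path_sum g h"
  by (induction h) auto

lemma path_sum_nonneg: "(\<And>h e. 0 \<le> f h e) \<Longrightarrow> 0 \<le> path_sum f h"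
  by (induction h) auto

context
  fixes \<rho> :: "('n, 'm) policy"
begin

lemma play_simps:
  "etype (play \<rho> h (j, k)) = j"
  "hires (play \<rho> h (j, k)) = of_bool (hired (act \<rho> h j) (after_probe \<rho> h j) k)"
  "probes (play \<rho> h (j, k)) = of_bool (act \<rho> h j = Probe)"
  "gain r (play \<rho> h (j, k)) = of_bool (hired (act \<rho> h j) (after_probe \<rho> h j) k) * r j k"
  by (auto simp: play_def hired_def split: action.splits verdict.splits)

end

lemma used_simps [simp]:
  "hires_used [] = 0" "hires_used (e # h) = hires e + hires_used h"
  "probes_used [] = 0" "probes_used (e # h) = probes e + probes_used h"
  "total_gain r [] = 0" "total_gain r (e # h) = gain r e + total_gain r h"
  by (simp_all add: hires_used_def probes_used_def total_gain_def)

text \<open>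
  The expectation over the runs of a policy on a given list of types, as a finite recursion. The
  reward indices follow the kernel \<open>K\<close>, which may look at the history: besides the
  true distribution this covers runs whose hires are replayed from another run.
\<close>

fun run_exp :: "('n, 'm::finite) policy \<Rightarrow> (('n, 'm) history \<Rightarrow> 'n \<Rightarrow> 'm \<Rightarrow> real) \<Rightarrow>
    (('n, 'm) history \<Rightarrow> real) \<Rightarrow> ('n, 'm) history \<Rightarrow> 'n list \<Rightarrow> real" where
  "run_exp \<rho> K f h [] = f h"
| "run_exp \<rho> K f h (j # js) = (\<Sum>k\<in>UNIV. K h j k * run_exp \<rho> K f (play \<rho> h (j, k) # h) js)"

context probing
begin

abbreviation nature :: "('n, 'm) history \<Rightarrow> 'n \<Rightarrow> 'm \<Rightarrow> real" where
  "nature \<equiv> \<lambda>h j k. pmf (q j) k"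

fun type_exp :: "nat \<Rightarrow> ('n list \<Rightarrow> real) \<Rightarrow> real" where
  "type_exp 0 f = f []"
| "type_exp (Suc n) f = (\<Sum>j\<in>UNIV. pmf p j * type_exp n (\<lambda>js. f (j # js)))"

lemma type_exp_add: "type_exp n (\<lambda>js. f js + g js) = type_exp n f + type_exp n g"
  by (induction n arbitrary: f g) (auto simp: distrib_left sum.distrib)

lemma type_exp_cmult: "type_exp n (\<lambda>js. c * f js) = c * type_exp n f"
  by (induction n arbitrary: f) (auto simp: sum_distrib_left mult_ac)

lemma type_exp_const: "type_exp n (\<lambda>js. c) = c"
  by (induction n) (auto simp: sum_pmf_UNIV simp flip: sum_distrib_right)

lemma type_exp_sum: "type_exp n (\<lambda>js. \<Sum>i\<in>A. f i js) = (\<Sum>i\<in>A. type_exp n (f i))"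
  using type_exp_const[of n 0]
  by (induction A rule: infinite_finite_induct) (auto simp: type_exp_add)

lemma type_exp_mono:
  assumes "\<And>js. length js = n \<Longrightarrow> (\<forall>j\<in>set js. 0 < pmf p j) \<Longrightarrow> f js \<le> g js"
  shows "type_exp n f \<le> type_exp n g"
  using assms
proof (induction n arbitrary: f g)
  case (Suc n)
  have "pmf p j * type_exp n (\<lambda>js. f (j # js)) \<le> pmf p j * type_exp n (\<lambda>js. g (j # js))" for j
  proof (cases "pmf p j = 0")
    case False
    then have "0 < pmf p j" by (simp add: pmf_pos)
    then show ?thesis using Suc.prems by (intro mult_left_mono Suc.IH) auto
  qed simp
  then show ?case by (auto intro: sum_mono)
qed auto

lemma expectation_arrivals:
  fixes f :: "('n \<times> 'm) list \<Rightarrow> real"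
  shows "measure_pmf.expectation (arrivals p q (Suc n)) f =
    (\<Sum>j\<in>UNIV. pmf p j * (\<Sum>k\<in>UNIV. pmf (q j) k * measure_pmf.expectation (arrivals p q n) (\<lambda>\<omega>. f ((j, k) # \<omega>))))"
proof -
  have fin: "finite (set_pmf (replicate_pmf n (item_pmf p q)))"
    by (rule finite_subset[OF _ finite_lists_length_eq[of "UNIV :: ('n \<times> 'm) set" n]])
      (auto simp: set_replicate_pmf)
  have "arrivals p q (Suc n) = bind_pmf p (\<lambda>j. bind_pmf (q j) (\<lambda>k. map_pmf ((#) (j, k)) (arrivals p q n)))"
    by (simp add: arrivals_def item_pmf_def bind_assoc_pmf bind_map_pmf map_pmf_def bind_return_pmf)
  then show ?thesis
    using fin by (simp add: arrivals_def pmf_expectation_bind[where A = UNIV])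
qed

text \<open>
  Types first, rewards later. The policy \<open>F\<close> may depend on all types, as the offline
  controller does; the initial history may too, which is what the induction needs.
\<close>

lemma expectation_arrivals_type_exp:
  fixes G :: "'n list \<Rightarrow> ('n, 'm) history \<Rightarrow> real"
  shows "measure_pmf.expectation (arrivals p q n)
      (\<lambda>\<omega>. G (map fst \<omega>) (foldl (\<lambda>h i. play (F (map fst \<omega>)) h i # h) (H (map fst \<omega>)) \<omega>)) =
    type_exp n (\<lambda>js. run_exp (F js) nature (G js) (H js) js)"
proof (induction n arbitrary: G F H)
  case 0
  then show ?case by (simp add: arrivals_def)
next
  case (Suc n)
  note IH = Suc[of "\<lambda>js. G (j # js)" "\<lambda>js. F (j # js)" "\<lambda>js. play (F (j # js)) (H (j # js)) (j, k) # H (j # js)" for j k]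
  show ?case by (simp add: expectation_arrivals IH type_exp_sum type_exp_cmult)
qed

end

context probing
begin

abbreviation cls :: "('n, 'm) policy \<Rightarrow> ('n, 'm) history \<Rightarrow> 'n \<Rightarrow> real" where
  "cls \<rho> h j \<equiv> rate j (act \<rho> h j) (after_probe \<rho> h j)"

abbreviation plan_loss :: "('n, 'm) policy \<Rightarrow> ('n, 'm) history \<Rightarrow> 'n \<Rightarrow> price \<Rightarrow> real" where
  "plan_loss \<rho> h j \<equiv> loss j (act \<rho> h j) (after_probe \<rho> h j)"

abbreviation hires_at :: "('n, 'm) policy \<Rightarrow> ('n, 'm) history \<Rightarrow> 'n \<Rightarrow> 'm \<Rightarrow> bool" where
  "hires_at \<rho> h j k \<equiv> hired (act \<rho> h j) (after_probe \<rho> h j) k"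

fun reachable :: "('n, 'm) policy \<Rightarrow> (('n, 'm) history \<Rightarrow> 'n \<Rightarrow> 'm \<Rightarrow> real) \<Rightarrow> ('n, 'm) history \<Rightarrow> bool" where
  "reachable \<rho> K [] = True"
| "reachable \<rho> K (e # h) = (reachable \<rho> K h \<and> 0 < pmf p (etype e) \<and>
     (\<exists>k. 0 < K h (etype e) k \<and> e = play \<rho> h (etype e, k)))"

lemma reachable_ConsE:
  assumes "reachable \<rho> K (e # h)"
  obtains j k where "e = play \<rho> h (j, k)" "0 < pmf p j" "0 < K h j k" "reachable \<rho> K h"
  using assms unfolding reachable.simps by blast

lemma reachable_Cons_play:
  "reachable \<rho> K h \<Longrightarrow> 0 < pmf p j \<Longrightarrow> 0 < K h j k \<Longrightarrow> reachable \<rho> K (play \<rho> h (j, k) # h)"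
  by (auto simp: play_simps)

lemma reachable_run:
  assumes "reachable \<rho> nature h"
  obtains \<omega> where "run \<rho> \<omega> = h" "map fst \<omega> = rev (map etype h)" "\<forall>i\<in>set \<omega>. i \<in> set_pmf (item_pmf p q)"
proof -
  have "\<exists>\<omega>. run \<rho> \<omega> = h \<and> map fst \<omega> = rev (map etype h) \<and> (\<forall>i\<in>set \<omega>. i \<in> set_pmf (item_pmf p q))"
    using assms
  proof (induction h)
    case (Cons e h)
    obtain j k where e: "e = play \<rho> h (j, k)" and jk: "0 < pmf p j" "0 < pmf (q j) k" and rh: "reachable \<rho> nature h"
      using Cons.prems by (rule reachable_ConsE)
    obtain \<omega> where w: "run \<rho> \<omega> = h" "map fst \<omega> = rev (map etype h)" "\<forall>i\<in>set \<omega>. i \<in> set_pmf (item_pmf p q)"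
      using Cons.IH[OF rh] by blast
    have "j \<in> set_pmf p" "k \<in> set_pmf (q j)" using jk by (auto simp: set_pmf_iff)
    then have "(j, k) \<in> set_pmf (item_pmf p q)" by (auto simp: item_pmf_def)
    moreover have "run \<rho> (\<omega> @ [(j, k)]) = e # h" using w(1) by (simp add: run_def e)
    ultimately show ?case using w by (intro exI[of _ "\<omega> @ [(j, k)]"]) (auto simp: e play_simps)
  qed (auto simp: run_def)
  then show thesis using that by blast
qed

lemma run_exp_add: "run_exp \<rho> K (\<lambda>h. f h + g h) h js = run_exp \<rho> K f h js + run_exp \<rho> K g h js"
  by (induction js arbitrary: h) (auto simp: distrib_left sum.distrib)

lemma run_exp_cmult: "run_exp \<rho> K (\<lambda>h. c * f h) h js = c * run_exp \<rho> K f h js"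
  by (induction js arbitrary: h) (auto simp: sum_distrib_left mult_ac)

lemma run_exp_diff: "run_exp \<rho> K (\<lambda>h. f h - g h) h js = run_exp \<rho> K f h js - run_exp \<rho> K g h js"
  by (induction js arbitrary: h) (auto simp: right_diff_distrib sum_subtractf)

lemma run_exp_zero: "run_exp \<rho> K (\<lambda>h. 0) h js = 0"
  by (induction js arbitrary: h) auto

lemma run_exp_sum: "run_exp \<rho> K (\<lambda>h. \<Sum>i\<in>A. f i h) h js = (\<Sum>i\<in>A. run_exp \<rho> K (f i) h js)"
  by (induction A rule: infinite_finite_induct) (auto simp: run_exp_add run_exp_zero)

lemma run_exp_const:
  assumes "\<And>h j. (\<Sum>k\<in>UNIV. K h j k) = 1"
  shows "run_exp \<rho> K (\<lambda>h. c) h js = c"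
  by (induction js arbitrary: h) (auto simp: assms simp flip: sum_distrib_right)

lemma run_exp_mono:
  assumes K: "\<And>h j k. 0 \<le> K h j k" and h: "reachable \<rho> K h" and js: "\<forall>j\<in>set js. 0 < pmf p j"
    and fg: "\<And>h'. reachable \<rho> K h' \<Longrightarrow> map etype h' = rev js @ map etype h \<Longrightarrow> f h' \<le> g h'"
  shows "run_exp \<rho> K f h js \<le> run_exp \<rho> K g h js"
  using h js fg
proof (induction js arbitrary: h)
  case (Cons j js)
  have "K h j k * run_exp \<rho> K f (play \<rho> h (j, k) # h) js \<le> K h j k * run_exp \<rho> K g (play \<rho> h (j, k) # h) js" for k
  proof (cases "K h j k = 0")
    case False
    then have "0 < K h j k" using K[of h j k] by simp
    then have "reachable \<rho> K (play \<rho> h (j, k) # h)" using Cons.prems by (intro reachable_Cons_play) auto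
    then show ?thesis using Cons.prems K by (intro mult_left_mono Cons.IH) (auto simp: play_simps)
  qed simp
  then show ?case by (auto intro: sum_mono)
qed auto

lemma run_exp_supermartingale:
  assumes K: "\<And>h j k. 0 \<le> K h j k" and h: "reachable \<rho> K h" and js: "\<forall>j\<in>set js. 0 < pmf p j"
    and X: "\<And>h j. reachable \<rho> K h \<Longrightarrow> 0 < pmf p j \<Longrightarrow> (\<Sum>k\<in>UNIV. K h j k * X (play \<rho> h (j, k) # h)) \<le> X h"
  shows "run_exp \<rho> K X h js \<le> X h"
  using h js
proof (induction js arbitrary: h)
  case (Cons j js)
  have "run_exp \<rho> K X h (j # js) \<le> (\<Sum>k\<in>UNIV. K h j k * X (play \<rho> h (j, k) # h))"
    unfolding run_exp.simps
  proof (rule sum_mono)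
    fix k
    show "K h j k * run_exp \<rho> K X (play \<rho> h (j, k) # h) js \<le> K h j k * X (play \<rho> h (j, k) # h)"
    proof (cases "K h j k = 0")
      case False
      then have "0 < K h j k" using K[of h j k] by simp
      then have "reachable \<rho> K (play \<rho> h (j, k) # h)" using Cons.prems by (intro reachable_Cons_play) auto
      then show ?thesis using Cons.prems K by (intro mult_left_mono Cons.IH) auto
    qed simp
  qed
  also have "\<dots> \<le> X h" using Cons.prems by (intro X) auto
  finally show ?case .
qed auto

lemma run_exp_martingale:
  assumes "\<And>h j. (\<Sum>k\<in>UNIV. K h j k) = 1"
    and "\<And>h j. (\<Sum>k\<in>UNIV. K h j k * D h (play \<rho> h (j, k))) = 0"
  shows "run_exp \<rho> K (path_sum D) h js = path_sum D h"
proof (induction js arbitrary: h)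
  case (Cons j js)
  then show ?case
    using assms by (simp add: distrib_left sum.distrib flip: sum_distrib_right)
qed simp

lemma rate_split: "(\<Sum>k\<in>UNIV. pmf (q j) k * f (hired a w k)) = rate j a w * f True + (1 - rate j a w) * f False"
proof -
  have "pmf (q j) k * f (hired a w k) = pmf (q j) k * of_bool (hired a w k) * (f True - f False) + pmf (q j) k * f False" for k
    by (cases "hired a w k") (auto simp: algebra_simps)
  then have "(\<Sum>k\<in>UNIV. pmf (q j) k * f (hired a w k)) = rate j a w * (f True - f False) + f False"
    by (simp add: rate_def sum.distrib sum_pmf_UNIV flip: sum_distrib_right)
  then show ?thesis by (simp add: algebra_simps)
qed

lemma rate_0_imp: "rate j a w = 0 \<Longrightarrow> 0 < pmf (q j) k \<Longrightarrow> \<not> hired a w k"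
proof
  assume 0: "rate j a w = 0" and k: "0 < pmf (q j) k" and "hired a w k"
  have "\<forall>k\<in>UNIV. pmf (q j) k * of_bool (hired a w k) = 0"
    using 0 unfolding rate_def by (subst (asm) sum_nonneg_eq_0_iff) auto
  then have "pmf (q j) k * of_bool (hired a w k) = 0" by blast
  then show False using k \<open>hired a w k\<close> by simp
qed

lemma rate_1_imp: "rate j a w = 1 \<Longrightarrow> 0 < pmf (q j) k \<Longrightarrow> hired a w k"
proof (rule ccontr)
  assume 1: "rate j a w = 1" and k: "0 < pmf (q j) k" and "\<not> hired a w k"
  have "(\<Sum>k\<in>UNIV. pmf (q j) k * of_bool (\<not> hired a w k)) = 0"
    using rate_split[of j "\<lambda>b. of_bool (\<not> b)" a w] 1 by simp
  then have "\<forall>k\<in>UNIV. pmf (q j) k * of_bool (\<not> hired a w k) = 0"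
    by (subst (asm) sum_nonneg_eq_0_iff) auto
  then have "pmf (q j) k * of_bool (\<not> hired a w k) = 0" by blast
  then show False using k \<open>\<not> hired a w k\<close> by simp
qed

end

section \<open>Coupling two policies through their hires\<close>

context probing
begin

text \<open>
  Chronological, unlike histories: the \<open>i\<close>-th bit belongs to the \<open>i\<close>-th
  plan that hires with probability \<open>c\<close>.
\<close>

fun bits :: "('n, 'm) policy \<Rightarrow> real \<Rightarrow> ('n, 'm) history \<Rightarrow> bool list" where
  "bits \<rho> c [] = []"
| "bits \<rho> c (e # h) = bits \<rho> c h @ (if cls \<rho> h (etype e) = c then [hires e = 1] else [])"

abbreviation cnt :: "('n, 'm) policy \<Rightarrow> real \<Rightarrow> ('n, 'm) history \<Rightarrow> nat" where
  "cnt \<rho> c h \<equiv> length (bits \<rho> c h)"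

text \<open>
  Plans that surely hire or surely do not hire carry no noise and are never replayed.
\<close>

definition replayed :: "('n, 'm) policy \<Rightarrow> (real \<Rightarrow> bool list) \<Rightarrow> ('n, 'm) history \<Rightarrow> 'n \<Rightarrow> bool" where
  "replayed \<rho> \<sigma> h j \<longleftrightarrow> 0 < cls \<rho> h j \<and> cls \<rho> h j < 1 \<and> cnt \<rho> (cls \<rho> h j) h < length (\<sigma> (cls \<rho> h j))"

text \<open>
  The next plan in the class \<open>c\<close> takes its hire outcome from the queue
  \<open>\<sigma> c\<close>, as long as that lasts; the reward index is then drawn from its
  conditional distribution given this outcome.
\<close>

definition replay :: "('n, 'm) policy \<Rightarrow> (real \<Rightarrow> bool list) \<Rightarrow> ('n, 'm) history \<Rightarrow> 'n \<Rightarrow> 'm \<Rightarrow> real" where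
  "replay \<rho> \<sigma> h j k =
    (if replayed \<rho> \<sigma> h j
     then (if hires_at \<rho> h j k = \<sigma> (cls \<rho> h j) ! cnt \<rho> (cls \<rho> h j) h
           then pmf (q j) k / (if hires_at \<rho> h j k then cls \<rho> h j else 1 - cls \<rho> h j) else 0)
     else pmf (q j) k)"

lemma replay_nonneg: "0 \<le> replay \<rho> \<sigma> h j k"
  using rate_range by (simp add: replay_def)

lemma replay_pos_imp: "0 < replay \<rho> \<sigma> h j k \<Longrightarrow> 0 < pmf (q j) k"
  by (cases "pmf (q j) k = 0") (simp_all add: replay_def pmf_pos split: if_splits)

lemma replay_sum: "(\<Sum>k\<in>UNIV. replay \<rho> \<sigma> h j k) = 1"
proof (cases "replayed \<rho> \<sigma> h j")
  case True
  let ?c = "cls \<rho> h j"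
  have c: "0 < ?c" "?c < 1" using True by (auto simp: replayed_def)
  define f where "f b = (if b = \<sigma> ?c ! cnt \<rho> ?c h then 1 / (if b then ?c else 1 - ?c) else 0)" for b
  have "replay \<rho> \<sigma> h j k = pmf (q j) k * f (hires_at \<rho> h j k)" for k
    using True by (simp add: replay_def f_def)
  then have "(\<Sum>k\<in>UNIV. replay \<rho> \<sigma> h j k) = ?c * f True + (1 - ?c) * f False"
    by (simp only: rate_split)
  then show ?thesis using c by (auto simp: f_def)
qed (simp add: replay_def sum_pmf_UNIV)

lemma reachable_replay_imp: "reachable \<rho> (replay \<rho> \<sigma>) h \<Longrightarrow> reachable \<rho> nature h"
proof (induction h)
  case (Cons e h)
  then obtain k where "0 < replay \<rho> \<sigma> h (etype e) k" "e = play \<rho> h (etype e, k)" by auto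
  then show ?case using Cons replay_pos_imp[of \<rho> \<sigma> h "etype e" k] by auto
qed simp

lemma replay_append_other:
  assumes "cls \<rho> h j \<noteq> c \<or> cnt \<rho> c h \<noteq> length (\<sigma> c) \<or> c \<le> 0 \<or> 1 \<le> c"
  shows "replay \<rho> (\<sigma>(c := \<sigma> c @ [b])) h j k = replay \<rho> \<sigma> h j k"
  using assms by (auto simp: replay_def replayed_def nth_append)

lemma run_exp_append_past:
  assumes "length (\<sigma> c) < cnt \<rho> c h \<or> c \<le> 0 \<or> 1 \<le> c"
    and "\<And>h. length (\<sigma> c) < cnt \<rho> c h \<or> c \<le> 0 \<or> 1 \<le> c \<Longrightarrow> F' h = F h"
  shows "run_exp \<rho> (replay \<rho> (\<sigma>(c := \<sigma> c @ [b]))) F' h js = run_exp \<rho> (replay \<rho> \<sigma>) F h js"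
  using assms(1)
proof (induction js arbitrary: h)
  case (Cons j js)
  have "run_exp \<rho> (replay \<rho> (\<sigma>(c := \<sigma> c @ [b]))) F' (play \<rho> h (j, k) # h) js = run_exp \<rho> (replay \<rho> \<sigma>) F (play \<rho> h (j, k) # h) js" for k
    using Cons.prems by (intro Cons.IH) auto
  moreover have "replay \<rho> (\<sigma>(c := \<sigma> c @ [b])) h j k = replay \<rho> \<sigma> h j k" for k
    using Cons.prems by (intro replay_append_other) auto
  ultimately show ?case by (simp del: fun_upd_apply)
qed (use assms in auto)

text \<open>
  A recorded outcome that is itself Bernoulli with parameter \<open>c\<close> may be appended to
  the queue without changing the law of the run: where it is read, reading it amounts to drawing a
  fresh outcome. The functional may depend on the new bit, provided that it averages out on runs
  that have not read it.
\<close>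

lemma run_exp_append_bit:
  assumes c: "0 < c" "c < 1" and h: "cnt \<rho> c h \<le> length (\<sigma> c)"
    and avg: "\<And>h. cnt \<rho> c h \<le> length (\<sigma> c) \<Longrightarrow> c * F True h + (1 - c) * F False h = G h"
    and past: "\<And>b h. length (\<sigma> c) < cnt \<rho> c h \<Longrightarrow> F b h = G h"
  shows "c * run_exp \<rho> (replay \<rho> (\<sigma>(c := \<sigma> c @ [True]))) (F True) h js
    + (1 - c) * run_exp \<rho> (replay \<rho> (\<sigma>(c := \<sigma> c @ [False]))) (F False) h js
    = run_exp \<rho> (replay \<rho> \<sigma>) G h js"
  using h
proof (induction js arbitrary: h)
  case Nil
  then show ?case using avg by simp
next
  case (Cons j js)
  let ?s = "\<lambda>b. \<sigma>(c := \<sigma> c @ [b])"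
  let ?R = "\<lambda>b k. run_exp \<rho> (replay \<rho> (?s b)) (F b) (play \<rho> h (j, k) # h) js"
  let ?Q = "\<lambda>k. run_exp \<rho> (replay \<rho> \<sigma>) G (play \<rho> h (j, k) # h) js"
  have "c * (replay \<rho> (?s True) h j k * ?R True k) + (1 - c) * (replay \<rho> (?s False) h j k * ?R False k)
      = replay \<rho> \<sigma> h j k * ?Q k" for k
  proof (cases "cls \<rho> h j = c \<and> cnt \<rho> c h = length (\<sigma> c)")
    case True
    then have R: "?R b k = ?Q k" for b
      using c by (intro run_exp_append_past) (auto simp: play_simps past)
    have "c * replay \<rho> (?s True) h j k + (1 - c) * replay \<rho> (?s False) h j k = replay \<rho> \<sigma> h j k"
      using True c by (auto simp: replay_def replayed_def nth_append)
    then show ?thesis unfolding R by (simp add: mult.assoc[symmetric] distrib_right[symmetric])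
  next
    case False
    then have same: "replay \<rho> (?s b) h j k = replay \<rho> \<sigma> h j k" for b
      by (intro replay_append_other) auto
    have "c * ?R True k + (1 - c) * ?R False k = ?Q k"
      using Cons.prems False by (intro Cons.IH) (auto simp: play_simps)
    then have "replay \<rho> \<sigma> h j k * (c * ?R True k + (1 - c) * ?R False k) = replay \<rho> \<sigma> h j k * ?Q k"
      by simp
    then show ?thesis unfolding same by (simp add: algebra_simps)
  qed
  then show ?case by (simp add: sum_distrib_left del: fun_upd_apply flip: sum.distrib)
qed

abbreviation queue :: "('n, 'm) policy \<Rightarrow> ('n, 'm) history \<Rightarrow> real \<Rightarrow> bool list" where
  "queue \<rho> h \<equiv> \<lambda>c. bits \<rho> c h"

lemma queue_play:
  "queue \<rho> (play \<rho> h (j, k) # h) = (queue \<rho> h)(cls \<rho> h j := queue \<rho> h (cls \<rho> h j) @ [hires_at \<rho> h j k])"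
  by (auto simp: play_simps fun_eq_iff)

text \<open>
  Let \<open>\<rho>\<close> run first and let \<open>\<pi>\<close> replay its outcomes. Each step
  of \<open>\<rho>\<close> appends one Bernoulli bit to one queue, so by induction the whole first
  run can be integrated out.
\<close>

lemma run_exp_coupled:
  assumes avg: "\<And>\<sigma> c h. 0 < c \<Longrightarrow> c < 1 \<Longrightarrow> cnt \<pi> c h \<le> length (\<sigma> c) \<Longrightarrow>
      c * F (\<sigma>(c := \<sigma> c @ [True])) h + (1 - c) * F (\<sigma>(c := \<sigma> c @ [False])) h = F \<sigma> h"
    and past: "\<And>\<sigma> c h b. length (\<sigma> c) < cnt \<pi> c h \<or> c \<le> 0 \<or> 1 \<le> c \<Longrightarrow> F (\<sigma>(c := \<sigma> c @ [b])) h = F \<sigma> h"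
  shows "run_exp \<rho> nature (\<lambda>g. run_exp \<pi> (replay \<pi> (queue \<rho> g)) (F (queue \<rho> g)) [] is) h js
    = run_exp \<pi> (replay \<pi> (queue \<rho> h)) (F (queue \<rho> h)) [] is"
proof (induction js arbitrary: h)
  case (Cons j js)
  let ?G = "\<lambda>\<sigma>. run_exp \<pi> (replay \<pi> \<sigma>) (F \<sigma>) [] is"
  let ?c = "cls \<rho> h j"
  let ?s = "\<lambda>b. (queue \<rho> h)(?c := queue \<rho> h ?c @ [b])"
  have "run_exp \<rho> nature (\<lambda>g. ?G (queue \<rho> g)) h (j # js)
     = (\<Sum>k\<in>UNIV. pmf (q j) k * ?G (?s (hires_at \<rho> h j k)))"
    by (simp only: run_exp.simps Cons.IH queue_play)
  also have "\<dots> = ?c * ?G (?s True) + (1 - ?c) * ?G (?s False)"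
    by (rule rate_split)
  also have "\<dots> = ?G (queue \<rho> h)"
  proof (cases "0 < ?c \<and> ?c < 1")
    case True
    then show ?thesis by (intro run_exp_append_bit avg past) auto
  next
    case False
    then have "?G (?s b) = ?G (queue \<rho> h)" for b
      by (intro run_exp_append_past past) auto
    then show ?thesis by (simp add: algebra_simps)
  qed
  finally show ?case .
qed simp

lemma replay_empty: "replay \<pi> (queue \<rho> []) = nature"
  by (intro ext) (simp add: replay_def replayed_def)

corollary run_exp_coupled_marginal:
  "run_exp \<rho> nature (\<lambda>g. run_exp \<pi> (replay \<pi> (queue \<rho> g)) f [] is) [] js = run_exp \<pi> nature f [] is"
proof -
  have "run_exp \<rho> nature (\<lambda>g. run_exp \<pi> (replay \<pi> (queue \<rho> g)) ((\<lambda>_. f) (queue \<rho> g)) [] is) [] js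
    = run_exp \<pi> (replay \<pi> (queue \<rho> [])) ((\<lambda>_. f) (queue \<rho> [])) [] is"
    by (rule run_exp_coupled) (auto simp: algebra_simps)
  then show ?thesis by (simp only: replay_empty)
qed

definition mixed_rates :: "real set" where
  "mixed_rates = {c \<in> range (\<lambda>(j, a, w). rate j a w). 0 < c \<and> c < 1}"

lemma finite_mixed_rates: "finite mixed_rates"
  by (simp add: mixed_rates_def)

lemma rate_in_mixed: "0 < rate j a w \<Longrightarrow> rate j a w < 1 \<Longrightarrow> rate j a w \<in> mixed_rates"
  unfolding mixed_rates_def by (auto intro!: range_eqI[where x = "(j, a, w)"])

definition excess :: "real \<Rightarrow> bool list \<Rightarrow> real" where
  "excess c bs = (\<Sum>b\<leftarrow>bs. of_bool b - c)"

lemma excess_simps [simp]: "excess c [] = 0" "excess c (xs @ ys) = excess c xs + excess c ys"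
  "excess c [b] = of_bool b - c"
  by (simp_all add: excess_def)

definition unread :: "('n, 'm) policy \<Rightarrow> (real \<Rightarrow> bool list) \<Rightarrow> ('n, 'm) history \<Rightarrow> real" where
  "unread \<pi> \<sigma> h = (\<Sum>c\<in>mixed_rates. excess c (drop (cnt \<pi> c h) (\<sigma> c)))"

lemma unread_append:
  "unread \<pi> (\<sigma>(c := \<sigma> c @ [b])) h =
    unread \<pi> \<sigma> h + (if c \<in> mixed_rates \<and> cnt \<pi> c h \<le> length (\<sigma> c) then of_bool b - c else 0)"
proof -
  have "unread \<pi> (\<sigma>(c := \<sigma> c @ [b])) h =
    (\<Sum>d\<in>mixed_rates. excess d (drop (cnt \<pi> d h) (\<sigma> d)) + (if d = c then (if cnt \<pi> c h \<le> length (\<sigma> c) then of_bool b - c else 0) else 0))"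
    unfolding unread_def by (intro sum.cong) auto
  then show ?thesis
    using finite_mixed_rates by (simp add: unread_def sum.distrib)
qed

text \<open>
  Outcomes that the second run leaves unread are centred and independent of it.
\<close>

corollary run_exp_unread:
  "run_exp \<rho> nature (\<lambda>g. run_exp \<pi> (replay \<pi> (queue \<rho> g)) (\<lambda>h. f h * unread \<pi> (queue \<rho> g) h) [] is) [] js = 0"
proof -
  have "run_exp \<rho> nature (\<lambda>g. run_exp \<pi> (replay \<pi> (queue \<rho> g)) ((\<lambda>\<sigma> h. f h * unread \<pi> \<sigma> h) (queue \<rho> g)) [] is) [] js
    = run_exp \<pi> (replay \<pi> (queue \<rho> [])) ((\<lambda>\<sigma> h. f h * unread \<pi> \<sigma> h) (queue \<rho> [])) [] is"
  proof (rule run_exp_coupled)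
    fix \<sigma> :: "real \<Rightarrow> bool list" and c h b
    assume "length (\<sigma> c) < cnt \<pi> c h \<or> c \<le> 0 \<or> 1 \<le> c"
    then show "f h * unread \<pi> (\<sigma>(c := \<sigma> c @ [b])) h = f h * unread \<pi> \<sigma> h"
      by (auto simp: unread_append mixed_rates_def)
  qed (auto simp: unread_append algebra_simps simp del: fun_upd_apply)
  moreover have "unread \<pi> (queue \<rho> []) h = 0" for h
    by (simp add: unread_def)
  ultimately show ?thesis by (simp add: run_exp_zero)
qed

text \<open>
  Given the types, this is the only noise in the budget consumption of a run, since probes are
  decided before the reward is seen.
\<close>

definition hire_noise :: "('n, 'm) policy \<Rightarrow> ('n, 'm) history \<Rightarrow> ('n, 'm) event \<Rightarrow> real" where
  "hire_noise \<rho> h e = real (hires e) - cls \<rho> h (etype e)"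

definition fresh :: "('n, 'm) policy \<Rightarrow> (real \<Rightarrow> bool list) \<Rightarrow> ('n, 'm) history \<Rightarrow> 'n \<Rightarrow> bool" where
  "fresh \<rho> \<sigma> h j \<longleftrightarrow> 0 < cls \<rho> h j \<and> cls \<rho> h j < 1 \<and> length (\<sigma> (cls \<rho> h j)) \<le> cnt \<rho> (cls \<rho> h j) h"

lemma hire_noise_trivial:
  assumes "reachable \<rho> nature (e # h)" "\<not> (0 < cls \<rho> h (etype e) \<and> cls \<rho> h (etype e) < 1)"
  shows "hire_noise \<rho> h e = 0"
proof -
  obtain k where k: "0 < pmf (q (etype e)) k" "e = play \<rho> h (etype e, k)" using assms(1) by auto
  have h: "hires e = of_bool (hires_at \<rho> h (etype e) k)" using k(2) by (metis play_simps(2))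
  have "cls \<rho> h (etype e) = 0 \<or> cls \<rho> h (etype e) = 1"
    using assms(2) rate_range[of "etype e" "act \<rho> h (etype e)" "after_probe \<rho> h (etype e)"] by linarith
  then show ?thesis
    using rate_0_imp[OF _ k(1)] rate_1_imp[OF _ k(1)] h unfolding hire_noise_def by auto
qed

lemma hire_noise_bit:
  assumes "reachable \<rho> nature (e # h)"
  shows "hire_noise \<rho> h e = of_bool (hires e = 1) - cls \<rho> h (etype e)"
proof -
  obtain k where "e = play \<rho> h (etype e, k)" using assms by auto
  then have "hires e = of_bool (hires_at \<rho> h (etype e) k)" by (metis play_simps(2))
  then show ?thesis by (simp add: hire_noise_def)
qed

lemma path_sum_hire_noise:
  assumes "reachable \<rho> nature h"
  shows "path_sum (hire_noise \<rho>) h = (\<Sum>c\<in>mixed_rates. excess c (bits \<rho> c h))"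
  using assms
proof (induction h)
  case (Cons e h)
  let ?c = "cls \<rho> h (etype e)"
  have "(\<Sum>c\<in>mixed_rates. excess c (bits \<rho> c (e # h))) =
    (\<Sum>c\<in>mixed_rates. excess c (bits \<rho> c h) + (if c = ?c then of_bool (hires e = 1) - ?c else 0))"
    by (intro sum.cong) auto
  also have "\<dots> = (\<Sum>c\<in>mixed_rates. excess c (bits \<rho> c h)) + (if ?c \<in> mixed_rates then of_bool (hires e = 1) - ?c else 0)"
    using finite_mixed_rates by (simp add: sum.distrib)
  also have "(if ?c \<in> mixed_rates then of_bool (hires e = 1) - ?c else 0) = hire_noise \<rho> h e"
  proof (cases "0 < ?c \<and> ?c < 1")
    case True
    then show ?thesis using hire_noise_bit[OF Cons.prems] rate_in_mixed by simp
  next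
    case False
    then have "?c \<notin> mixed_rates" by (simp add: mixed_rates_def)
    then show ?thesis using hire_noise_trivial[OF Cons.prems False] by simp
  qed
  finally show ?case using Cons by simp
qed simp

lemma path_sum_hire_noise_replay:
  assumes "reachable \<rho> (replay \<rho> \<sigma>) h"
  shows "path_sum (hire_noise \<rho>) h =
    path_sum (\<lambda>h e. of_bool (fresh \<rho> \<sigma> h (etype e)) * hire_noise \<rho> h e) h
    + (\<Sum>c\<in>mixed_rates. excess c (take (cnt \<rho> c h) (\<sigma> c)))"
  using assms
proof (induction h)
  case (Cons e h)
  let ?c = "cls \<rho> h (etype e)"
  have reach: "reachable \<rho> nature (e # h)" by (rule reachable_replay_imp[OF Cons.prems])
  obtain k where k: "0 < replay \<rho> \<sigma> h (etype e) k" "e = play \<rho> h (etype e, k)" using Cons.prems by auto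
  let ?d = "if ?c \<in> mixed_rates \<and> cnt \<rho> ?c h < length (\<sigma> ?c) then hire_noise \<rho> h e else 0"
  have "excess c (take (cnt \<rho> c (e # h)) (\<sigma> c)) = excess c (take (cnt \<rho> c h) (\<sigma> c)) + (if c = ?c then ?d else 0)"
    if "c \<in> mixed_rates" for c
  proof (cases "c = ?c \<and> cnt \<rho> ?c h < length (\<sigma> ?c)")
    case True
    have c01: "0 < ?c" "?c < 1" using that True by (auto simp: mixed_rates_def)
    then have "replayed \<rho> \<sigma> h (etype e)" using True by (simp add: replayed_def)
    then have "hires_at \<rho> h (etype e) k = \<sigma> ?c ! cnt \<rho> ?c h"
      using k(1) by (auto simp: replay_def split: if_splits)
    moreover have "hires e = of_bool (hires_at \<rho> h (etype e) k)" using k(2) by (metis play_simps(2))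
    ultimately have "hire_noise \<rho> h e = of_bool (\<sigma> ?c ! cnt \<rho> ?c h) - ?c" by (simp add: hire_noise_def)
    then show ?thesis using True that by (simp add: take_Suc_conv_app_nth)
  qed auto
  then have "(\<Sum>c\<in>mixed_rates. excess c (take (cnt \<rho> c (e # h)) (\<sigma> c))) =
     (\<Sum>c\<in>mixed_rates. excess c (take (cnt \<rho> c h) (\<sigma> c))) + ?d"
    using finite_mixed_rates by (simp add: sum.distrib del: bits.simps) 
  moreover have "hire_noise \<rho> h e = of_bool (fresh \<rho> \<sigma> h (etype e)) * hire_noise \<rho> h e + ?d"
  proof (cases "0 < ?c \<and> ?c < 1")
    case True
    then show ?thesis using rate_in_mixed by (simp add: fresh_def not_less)
  next
    case False
    then show ?thesis using hire_noise_trivial[OF reach False] by simp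
  qed
  ultimately show ?case using Cons by simp
qed simp

text \<open>
  The outcomes that both runs share cancel.
\<close>

lemma hire_noise_difference:
  assumes "reachable \<rho> nature g" "reachable \<pi> (replay \<pi> (queue \<rho> g)) h"
  shows "path_sum (hire_noise \<pi>) h - path_sum (hire_noise \<rho>) g =
    path_sum (\<lambda>h e. of_bool (fresh \<pi> (queue \<rho> g) h (etype e)) * hire_noise \<pi> h e) h - unread \<pi> (queue \<rho> g) h"
proof -
  have "excess c (bits \<rho> c g) = excess c (take (cnt \<pi> c h) (bits \<rho> c g)) + excess c (drop (cnt \<pi> c h) (bits \<rho> c g))" for c
    by (metis append_take_drop_id excess_simps(2))
  then show ?thesis
    unfolding path_sum_hire_noise[OF assms(1)] path_sum_hire_noise_replay[OF assms(2)] unread_def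
    by (simp add: sum.distrib)
qed

end

section \<open>Prices that stay nearly optimal along an online run\<close>

lemma exists_minimizer:
  assumes "finite S" "S \<noteq> {}"
  shows "\<exists>x\<in>S. \<forall>y\<in>S. f x \<le> (f y :: real)"
proof -
  have "Min (f ` S) \<in> f ` S" using assms by (intro Min_in) auto
  then obtain x where "x \<in> S" "f x = Min (f ` S)" by auto
  then show ?thesis using assms by (intro bexI[of _ x]) auto
qed

lemma exp_le_quadratic:
  assumes "\<bar>y\<bar> \<le> (1 :: real)"
  shows "exp y \<le> 1 + y + y\<^sup>2"
proof (cases "0 \<le> y")
  case True
  then show ?thesis using assms exp_bound[of y] by simp
next
  case False
  have "0 < 1 - y" using False by simp
  have "exp y = 1 / exp (- y)" by (simp add: exp_minus field_simps)
  also have "\<dots> \<le> 1 / (1 - y)" using exp_ge_add_one_self[of "- y"] \<open>0 < 1 - y\<close> by (intro divide_left_mono) auto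
  also have "\<dots> \<le> 1 + y + y\<^sup>2"
  proof -
    have "y * (y * y) \<le> 0" using False by (intro mult_nonpos_nonneg) auto
    then have "1 \<le> (1 + y + y\<^sup>2) * (1 - y)" by (simp add: algebra_simps power2_eq_square)
    then show ?thesis using \<open>0 < 1 - y\<close> by (simp add: pos_divide_le_eq)
  qed
  finally show ?thesis .
qed

context probing
begin

lemma best_le_rmax:
  assumes "0 \<le> fst L" "0 \<le> snd L"
  shows "best j L \<le> rmax"
proof -
  obtain a w where b: "best j L = payoff j a w L" using best_attained .
  have "plan_gain j a w \<le> rmax * rate j a w" using plan_gain_abs_le[of j a w] by simp
  also have "\<dots> \<le> rmax * 1" using rate_range rmax_nonneg by (intro mult_left_mono) auto
  finally have "plan_gain j a w \<le> rmax" by simp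
  moreover have "0 \<le> fst L * rate j a w" "0 \<le> snd L * of_bool (a = Probe)"
    using assms rate_range by auto
  ultimately show ?thesis unfolding b payoff_def by linarith
qed

definition mean_best :: "price \<Rightarrow> real" where
  "mean_best L = (\<Sum>j\<in>UNIV. pmf p j * best j L)"

lemma mean_best_range:
  assumes "0 \<le> fst L" "0 \<le> snd L"
  shows "0 \<le> mean_best L" "mean_best L \<le> rmax"
proof -
  show "0 \<le> mean_best L" unfolding mean_best_def using best_nonneg by (intro sum_nonneg) auto
  have "mean_best L \<le> (\<Sum>j\<in>UNIV. pmf p j * rmax)"
    unfolding mean_best_def using best_le_rmax[OF assms] by (intro sum_mono mult_left_mono) auto
  then show "mean_best L \<le> rmax" by (simp add: sum_pmf_UNIV flip: sum_distrib_right)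
qed

end

text \<open>
  A finite set of prices that contains an optimal dual solution of every instance, an upper bound
  \<open>A\<close> on them, and lower bounds \<open>c0\<close> and \<open>pm\<close> on the
  positive quantities that occur: losses, probe prices and type probabilities. The constants below
  are built from these and from the data of the problem, hence do not depend on horizon and
  budgets.
\<close>

locale price_system = probing p q r
  for p :: "'n::finite pmf" and q :: "'n \<Rightarrow> 'm::finite pmf" and r :: "'n \<Rightarrow> 'm \<Rightarrow> real" +
  fixes V :: "price set" and A c0 pm :: real
  assumes finite_V: "finite V" and zero_V: "(0, 0) \<in> V"
    and V_nonneg: "L \<in> V \<Longrightarrow> 0 \<le> fst L" "L \<in> V \<Longrightarrow> 0 \<le> snd L"
    and V_tight: "lp_optimal q r bh bp z x y \<Longrightarrow> \<exists>L\<in>V. dual_bound L (real bh) (real bp) z \<le> lp_value q r x y"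
    and V_le: "L \<in> V \<Longrightarrow> fst L \<le> A" "L \<in> V \<Longrightarrow> snd L \<le> A"
    and c0: "0 < c0" "c0 \<le> 1"
    and loss_c0: "L \<in> V \<Longrightarrow> loss j a w L \<noteq> 0 \<Longrightarrow> c0 \<le> loss j a w L"
    and snd_c0: "L \<in> V \<Longrightarrow> snd L \<noteq> 0 \<Longrightarrow> c0 \<le> snd L"
    and pm: "0 < pm" "pm \<le> 1"
    and pmf_pm: "0 < pmf p j \<Longrightarrow> pm \<le> pmf p j"
begin

definition tol :: real where "tol = c0 * pm / 12"

lemma tol: "0 < tol" "tol \<le> 1"
proof -
  show "0 < tol" using c0 pm by (simp add: tol_def)
  have "c0 * pm \<le> 1 * 1" using c0 pm by (intro mult_mono) auto
  then show "tol \<le> 1" by (simp add: tol_def)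
qed

lemma A_nonneg: "0 \<le> A"
  using V_le[OF zero_V] by simp

text \<open>
  A bound on the change of the difference of two dual bounds within one period.
\<close>

definition jump :: real where "jump = 2 * A + rmax + 1"

lemma jump: "1 \<le> jump"
  using A_nonneg rmax_nonneg by (simp add: jump_def)

text \<open>
  The exponent at which the gap of a price is tracked. It is small enough for the second-order term
  of one step, at most the square of \<open>gap_tilt * jump\<close>, to be outweighed by the
  shrinking of the threshold \<open>tol\<close> times the time-to-go.
\<close>

definition gap_tilt :: real where "gap_tilt = tol / (4 * jump\<^sup>2)"

definition growth :: real where "growth = exp (gap_tilt * tol / 4)"

lemma gap_tilt: "0 < gap_tilt" "gap_tilt * jump \<le> 1" "1 + (gap_tilt * jump)\<^sup>2 \<le> growth"
proof -
  have j: "0 < jump" using jump by simp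
  show pos: "0 < gap_tilt" using tol j by (simp add: gap_tilt_def)
  have eq: "gap_tilt * jump\<^sup>2 = tol / 4" using j by (simp add: gap_tilt_def)
  have "gap_tilt * jump * 1 \<le> gap_tilt * jump * jump" using pos jump by (intro mult_left_mono) auto
  then show "gap_tilt * jump \<le> 1" using eq tol by (simp add: power2_eq_square)
  have "(gap_tilt * jump)\<^sup>2 = gap_tilt * (gap_tilt * jump\<^sup>2)" by (simp add: power2_eq_square)
  also have "\<dots> = gap_tilt * tol / 4" unfolding eq by simp
  finally show "1 + (gap_tilt * jump)\<^sup>2 \<le> growth"
    using exp_ge_add_one_self[of "gap_tilt * tol / 4"] unfolding growth_def by linarith
qed

lemma growth: "1 < growth"
  using gap_tilt(1) tol by (simp add: growth_def)

definition idle_rate :: real where "idle_rate = 1 / (growth - 1)"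

definition idle_const :: real where "idle_const = (1 + idle_rate) * (real (card V) * exp (gap_tilt * jump))"

definition idle_bound :: real where
  "idle_bound = idle_rate * real (card V) + idle_const / (1 - (1 / growth)\<^sup>2)"

lemma exp_growth: "exp (- gap_tilt * (tol * real n)) = (1 / growth) ^ (4 * n)"
proof -
  have "(1 / growth) ^ (4 * n) = exp (- (gap_tilt * tol / 4)) ^ (4 * n)"
    by (simp add: growth_def exp_minus field_simps)
  also have "\<dots> = exp (real (4 * n) * - (gap_tilt * tol / 4))" by (rule exp_of_nat_mult[symmetric])
  finally show ?thesis by simp
qed

end

locale rabbi = price_system p q r V A c0 pm
  for p :: "'n::finite pmf" and q :: "'n \<Rightarrow> 'm::finite pmf" and r :: "'n \<Rightarrow> 'm \<Rightarrow> real"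
    and V A c0 pm +
  fixes T Bh Bp :: nat and \<pi> :: "('n, 'm) policy"
  assumes rabbi: "probing_rabbi p q r T Bh Bp \<pi>"
begin

abbreviation togo :: "('n, 'm) history \<Rightarrow> real" where
  "togo h \<equiv> real (T - length h)"

abbreviation solves :: "('n, 'm) history \<Rightarrow> ('n \<Rightarrow> action \<Rightarrow> real) \<Rightarrow> ('n \<Rightarrow> 'm \<Rightarrow> verdict \<Rightarrow> real) \<Rightarrow> bool" where
  "solves h x y \<equiv> lp_optimal q r (Bh - hires_used h) (Bp - probes_used h) (\<lambda>j. togo h * pmf p j) x y"

text \<open>
  The dual bound of the linear program that RABBI solves after the history \<open>h\<close>.
\<close>

definition togo_bound :: "('n, 'm) history \<Rightarrow> price \<Rightarrow> real" where
  "togo_bound h L = dual_bound L (real (Bh - hires_used h)) (real (Bp - probes_used h))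
     (\<lambda>j. togo h * pmf p j)"

lemma togo_bound_eq: "togo_bound h L = fst L * real (Bh - hires_used h) + snd L * real (Bp - probes_used h)
    + togo h * mean_best L"
  by (simp add: togo_bound_def dual_bound_def mean_best_def sum_distrib_left mult.assoc)

lemma rabbi_solution:
  assumes "length h < T"
  obtains x y where "solves h x y"
    "lp_local (\<lambda>j. togo h * pmf p j) x y"
    "lp_hires x y \<le> real (Bh - hires_used h)" "lp_probes x \<le> real (Bp - probes_used h)"
    "\<forall>j. togo h * pmf p j \<le> 3 * x j (act \<pi> h j)"
    "\<forall>j k u. act \<pi> h j = Probe \<longrightarrow> y j k u \<le> y j k (after_probe \<pi> h j k)"
proof -
  have "\<exists>x y. solves h x y \<and>
      (\<forall>j. (\<forall>u. x j u \<le> x j (act \<pi> h j)) \<and>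
           (act \<pi> h j = Probe \<longrightarrow> (\<forall>k u. y j k u \<le> y j k (after_probe \<pi> h j k))))"
    by (rule rabbi[unfolded probing_rabbi_def, rule_format, OF assms])
  then obtain x y where o: "solves h x y"
    and m: "\<And>j u. x j u \<le> x j (act \<pi> h j)"
    and w: "\<forall>j k u. act \<pi> h j = Probe \<longrightarrow> y j k u \<le> y j k (after_probe \<pi> h j k)"
    by auto
  have loc: "lp_local (\<lambda>j. togo h * pmf p j) x y"
    and b: "lp_hires x y \<le> real (Bh - hires_used h)" "lp_probes x \<le> real (Bp - probes_used h)"
    using o by (auto simp: lp_optimal_def lp_feasible_iff)
  have "togo h * pmf p j \<le> 3 * x j (act \<pi> h j)" for j
  proof -
    have "x j Accept + x j Probe + x j Reject = togo h * pmf p j"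
      using loc by (simp add: lp_local_def)
    then show ?thesis using m[of j Accept] m[of j Probe] m[of j Reject] by linarith
  qed
  with that o loc b w show thesis by blast
qed

lemma lp_hires_ge:
  assumes "lp_local z x y"
  shows "x j Accept \<le> lp_hires x y" "y j k Take \<le> lp_hires x y" "x j Probe \<le> lp_probes x"
proof -
  have x0: "0 \<le> x j a" and y0: "0 \<le> y j k u" for j a k u using assms by (auto simp: lp_local_def)
  have "x j Accept \<le> (\<Sum>j\<in>UNIV. x j Accept)"
    by (rule member_le_sum[of j UNIV "\<lambda>j. x j Accept"]) (use x0 in simp_all)
  moreover have "x j Probe \<le> (\<Sum>j\<in>UNIV. x j Probe)"
    by (rule member_le_sum[of j UNIV "\<lambda>j. x j Probe"]) (use x0 in simp_all)
  moreover have "y j k Take \<le> (\<Sum>k\<in>UNIV. y j k Take)"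
    by (rule member_le_sum[of k UNIV "\<lambda>k. y j k Take"]) (use y0 in simp_all)
  moreover have "(\<Sum>k\<in>UNIV. y j k Take) \<le> (\<Sum>j\<in>UNIV. \<Sum>k\<in>UNIV. y j k Take)"
    by (rule member_le_sum[of j UNIV "\<lambda>j. \<Sum>k\<in>UNIV. y j k Take"]) (use y0 in \<open>simp_all add: sum_nonneg\<close>)
  moreover have "0 \<le> (\<Sum>j\<in>UNIV. x j Accept)" "0 \<le> (\<Sum>j\<in>UNIV. \<Sum>k\<in>UNIV. y j k Take)"
    using x0 y0 by (simp_all add: sum_nonneg)
  ultimately show "x j Accept \<le> lp_hires x y" "y j k Take \<le> lp_hires x y" "x j Probe \<le> lp_probes x"
    unfolding lp_hires_def lp_probes_def by linarith+
qed

text \<open>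
  The chosen action and verdict have positive mass in a feasible solution, so the budgets that they
  consume are positive.
\<close>

lemma budgets_respected:
  assumes "reachable \<pi> nature h" "length h \<le> T"
  shows "hires_used h \<le> Bh \<and> probes_used h \<le> Bp"
  using assms
proof (induction h)
  case (Cons e h)
  obtain j k where e: "e = play \<pi> h (j, k)" and pj: "0 < pmf p j" and k: "0 < pmf (q j) k"
    and rh: "reachable \<pi> nature h"
    using Cons.prems(1) by (rule reachable_ConsE)
  have IH: "hires_used h \<le> Bh" "probes_used h \<le> Bp" using Cons.IH rh Cons.prems(2) by auto
  have len: "length h < T" using Cons.prems by simp
  obtain x y where "solves h x y"
    and s0: "lp_local (\<lambda>j. togo h * pmf p j) x y"
    "lp_hires x y \<le> real (Bh - hires_used h)" "lp_probes x \<le> real (Bp - probes_used h)"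
    "\<forall>j. togo h * pmf p j \<le> 3 * x j (act \<pi> h j)"
    "\<forall>j k u. act \<pi> h j = Probe \<longrightarrow> y j k u \<le> y j k (after_probe \<pi> h j k)"
    using rabbi_solution[OF len] .
  note s = s0(1-3) s0(4)[rule_format] s0(5)[rule_format]
  have pos: "0 < x j (act \<pi> h j)"
  proof -
    have "0 < togo h * pmf p j" using len pj by simp
    then show ?thesis using s(4)[of j] by linarith
  qed
  have "hires_used h + hires e \<le> Bh"
  proof (cases "hires_at \<pi> h j k")
    case True
    have "0 < lp_hires x y"
    proof (cases "act \<pi> h j")
      case Accept
      then show ?thesis using pos lp_hires_ge(1)[OF s(1), of j] by simp
    next
      case Probe
      then have w: "after_probe \<pi> h j k = Take" using True by (simp add: hired_def)
      have "y j k Take + y j k Leave = pmf (q j) k * x j Probe" using s(1) by (simp add: lp_local_def)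
      moreover have "0 < pmf (q j) k * x j Probe" using k pos Probe by simp
      ultimately have "0 < y j k Take" using s(5)[OF Probe, of k Leave] w by simp
      then show ?thesis using lp_hires_ge(2)[OF s(1), of j k] by linarith
    qed (use True in \<open>simp add: hired_def\<close>)
    then have "hires_used h < Bh" using s(2) by simp
    moreover have "hires e \<le> 1" unfolding e play_simps by simp
    ultimately show ?thesis by simp
  next
    case False
    then show ?thesis using IH unfolding e play_simps by simp
  qed
  moreover have "probes_used h + probes e \<le> Bp"
  proof (cases "act \<pi> h j = Probe")
    case True
    then have "0 < lp_probes x" using pos lp_hires_ge(3)[OF s(1), of j] by simp
    then have "probes_used h < Bp" using s(3) by simp
    moreover have "probes e \<le> 1" unfolding e play_simps by simp
    ultimately show ?thesis by simp
  next
    case False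
    then show ?thesis using IH unfolding e play_simps by simp
  qed
  ultimately show ?case by simp
qed simp

definition near :: "('n, 'm) history \<Rightarrow> price set" where
  "near h = {L \<in> V. \<forall>L'\<in>V. togo_bound h L - togo_bound h L' \<le> tol * togo h}"

lemma near_gap:
  assumes "L \<in> near h" "solves h x y"
  shows "togo_bound h L - lp_value q r x y \<le> tol * togo h"
proof -
  obtain L' where "L' \<in> V" "togo_bound h L' \<le> lp_value q r x y"
    using V_tight[OF assms(2)] unfolding togo_bound_def by blast
  moreover from this have "togo_bound h L - togo_bound h L' \<le> tol * togo h"
    using assms(1) unfolding near_def by blast
  ultimately show ?thesis by linarith
qed

lemma near_type_gap:
  assumes "L \<in> near h" and o: "solves h x y"
  shows "(\<Sum>j\<in>J. x j Accept * loss j Accept undefined L + x j Reject * loss j Reject undefined L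
       + probe_gap j (x j Probe) (y j) L) \<le> tol * togo h"
proof -
  have l: "lp_local (\<lambda>j. togo h * pmf p j) x y"
    "lp_hires x y \<le> real (Bh - hires_used h)" "lp_probes x \<le> real (Bp - probes_used h)"
    using o by (auto simp: lp_optimal_def lp_feasible_iff)
  have "L \<in> V" using assms(1) by (simp add: near_def)
  from duality_gap_ge_type[OF l(1) V_nonneg(1)[OF this] V_nonneg(2)[OF this] l(2,3), of J] near_gap[OF assms]
  show ?thesis unfolding togo_bound_def by linarith
qed

text \<open>
  The chosen action has at least a third of the mass of its type, hence a loss of at least
  \<open>c0\<close> would open a duality gap of more than \<open>tol\<close> times the time-to-go.
\<close>

lemma near_lossless:
  assumes near: "L \<in> near h" and len: "length h < T" and pj: "0 < pmf p j"
  shows "plan_loss \<pi> h j L = 0"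
proof (rule ccontr)
  let ?L = "plan_loss \<pi> h j L"
  assume "?L \<noteq> 0"
  then have big: "c0 \<le> ?L" using near by (intro loss_c0) (auto simp: near_def)
  obtain x y where o: "solves h x y"
    and s1: "lp_local (\<lambda>j. togo h * pmf p j) x y"
    and "lp_hires x y \<le> real (Bh - hires_used h)" "lp_probes x \<le> real (Bp - probes_used h)"
    and s2: "\<forall>j. togo h * pmf p j \<le> 3 * x j (act \<pi> h j)"
    and s3: "\<forall>j k u. act \<pi> h j = Probe \<longrightarrow> y j k u \<le> y j k (after_probe \<pi> h j k)"
    using rabbi_solution[OF len] .
  note s = s1 s2[rule_format] s3[rule_format]
  have x0: "0 \<le> x j a" for j a using s(1) by (simp add: lp_local_def)
  let ?G = "x j Accept * loss j Accept undefined L + x j Reject * loss j Reject undefined L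
       + probe_gap j (x j Probe) (y j) L"
  have G: "?G \<le> tol * togo h"
    using near_type_gap[OF near o, of "{j}"] by simp
  have parts: "0 \<le> x j Accept * loss j Accept undefined L" "0 \<le> x j Reject * loss j Reject undefined L"
    "0 \<le> probe_gap j (x j Probe) (y j) L"
    using x0 loss_nonneg probe_gap_nonneg[OF s(1)] by auto
  have "x j (act \<pi> h j) * ?L \<le> 2 * ?G"
  proof (cases "act \<pi> h j")
    case Accept
    then have "?L = loss j Accept undefined L" by (simp add: loss_def payoff_def)
    then show ?thesis using Accept parts by simp
  next
    case Reject
    then have "?L = loss j Reject undefined L" by (simp add: loss_def payoff_def)
    then show ?thesis using Reject parts by simp
  next
    case Probe
    have "x j Probe * loss j Probe (after_probe \<pi> h j) L \<le> 2 * probe_gap j (x j Probe) (y j) L"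
      using s(1) s(3)[OF Probe] by (intro probe_gap_ge_half_loss) (auto simp: lp_local_def)
    then show ?thesis using Probe parts by simp
  qed
  then have "x j (act \<pi> h j) * ?L \<le> 2 * (tol * togo h)"
    using G by (rule order_trans[OF _ mult_left_mono]) simp
  then have "x j (act \<pi> h j) * c0 \<le> 2 * (tol * togo h)"
    using mult_left_mono[OF big x0[of j "act \<pi> h j"]] by (rule order_trans[rotated])
  then have "3 * (x j (act \<pi> h j) * c0) \<le> 6 * (tol * togo h)"
    by (rule order_trans[OF mult_left_mono]) simp_all
  moreover have "togo h * pm * c0 \<le> 3 * (x j (act \<pi> h j) * c0)"
  proof -
    have "togo h * pm \<le> togo h * pmf p j"
      using pmf_pm[OF pj] by (intro mult_left_mono) auto
    then have "togo h * pm * c0 \<le> 3 * x j (act \<pi> h j) * c0"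
      using s(2)[of j] c0 by (intro mult_right_mono) auto
    then show ?thesis by (simp only: mult.assoc)
  qed
  moreover have "6 * (tol * togo h) = togo h * pm * c0 / 2"
    by (simp add: tol_def)
  moreover have "0 < togo h * pm * c0" using len pm c0 by simp
  ultimately show False by linarith
qed

text \<open>
  A price that has fallen behind once is discarded for good. The sets decrease along a run, which
  makes a price in a late set lossless throughout the earlier periods.
\<close>

fun relevant :: "('n, 'm) history \<Rightarrow> price set" where
  "relevant [] = near []"
| "relevant (e # h) = relevant h \<inter> near (e # h)"

lemma relevant_near: "relevant h \<subseteq> near h"
  by (cases h) auto

lemma relevant_V: "relevant h \<subseteq> V"
  using relevant_near[of h] unfolding near_def by blast

definition gap :: "('n, 'm) history \<Rightarrow> price \<Rightarrow> real" where
  "gap h L = Max ((\<lambda>L'. togo_bound h L - togo_bound h L') ` V)"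

lemma gap_ge: "L' \<in> V \<Longrightarrow> togo_bound h L - togo_bound h L' \<le> gap h L"
  unfolding gap_def using finite_V by (intro Max_ge) auto

lemma gap_attained: obtains L' where "L' \<in> V" "gap h L = togo_bound h L - togo_bound h L'"
proof -
  have "gap h L \<in> (\<lambda>L'. togo_bound h L - togo_bound h L') ` V"
    unfolding gap_def using finite_V zero_V by (intro Max_in) auto
  then show thesis using that by auto
qed

lemma near_iff_gap: "L \<in> near h \<longleftrightarrow> L \<in> V \<and> gap h L \<le> tol * togo h"
proof -
  obtain L' where "L' \<in> V" "gap h L = togo_bound h L - togo_bound h L'" using gap_attained .
  note gap = this
  have "togo_bound h L - togo_bound h L'' \<le> tol * togo h"
    if "gap h L \<le> tol * togo h" "L'' \<in> V" for L''
    using gap_ge[OF that(2), of h L] that(1) by linarith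
  then show ?thesis using gap unfolding near_def by auto
qed

text \<open>
  An exponential potential that is large if a discarded price has become nearly optimal again.
\<close>

definition lapsed :: "('n, 'm) history \<Rightarrow> price \<Rightarrow> real" where
  "lapsed h L = of_bool (L \<notin> relevant h) * exp (- gap_tilt * gap h L)"

lemma lapsed_nonneg: "0 \<le> lapsed h L"
  by (simp add: lapsed_def)

lemma relevant_empty_le: "of_bool (relevant h = {}) \<le> (\<Sum>L\<in>V. lapsed h L)"
proof (cases "relevant h = {}")
  case True
  obtain L where L: "L \<in> V" "\<forall>L'\<in>V. togo_bound h L \<le> togo_bound h L'"
    using exists_minimizer[OF finite_V, of "togo_bound h"] zero_V by blast
  obtain L' where "L' \<in> V" "gap h L = togo_bound h L - togo_bound h L'" using gap_attained .
  then have "gap h L \<le> 0" using L by simp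
  then have "0 \<le> - gap_tilt * gap h L" using gap_tilt(1) by (simp add: mult_nonneg_nonpos)
  then have "1 \<le> lapsed h L" using True by (simp add: lapsed_def)
  also have "\<dots> \<le> (\<Sum>L\<in>V. lapsed h L)"
    by (rule member_le_sum[of L V "lapsed h"]) (use L finite_V lapsed_nonneg in auto)
  finally show ?thesis by simp
qed (simp add: sum_nonneg lapsed_nonneg)

definition drift :: "price \<Rightarrow> price \<Rightarrow> ('n, 'm) history \<Rightarrow> 'n \<Rightarrow> 'm \<Rightarrow> real" where
  "drift L L' h j k = (fst L' - fst L) * of_bool (hires_at \<pi> h j k)
     + (snd L' - snd L) * of_bool (act \<pi> h j = Probe) + (mean_best L' - mean_best L)"

lemma togo_bound_step:
  assumes h: "reachable \<pi> nature h" "length h < T" and jk: "0 < pmf p j" "0 < pmf (q j) k"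
  shows "togo_bound (play \<pi> h (j, k) # h) L - togo_bound (play \<pi> h (j, k) # h) L'
    = togo_bound h L - togo_bound h L' + drift L L' h j k"
proof -
  have r: "reachable \<pi> nature (play \<pi> h (j, k) # h)" using h jk by (intro reachable_Cons_play) auto
  have b: "of_bool (hires_at \<pi> h j k) + hires_used h \<le> Bh" "of_bool (act \<pi> h j = Probe) + probes_used h \<le> Bp"
    using budgets_respected[OF r] h by (auto simp: play_simps)
  have t: "togo h = real (T - Suc (length h)) + 1" using h(2) by simp
  have bh: "real (Bh - hires_used h) = real (Bh - (of_bool (hires_at \<pi> h j k) + hires_used h)) + of_bool (hires_at \<pi> h j k)"
    using b(1) by (cases "hires_at \<pi> h j k") auto
  have bp: "real (Bp - probes_used h) = real (Bp - (of_bool (act \<pi> h j = Probe) + probes_used h)) + of_bool (act \<pi> h j = Probe)"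
    using b(2) by (cases "act \<pi> h j = Probe") auto
  show ?thesis
    unfolding togo_bound_eq drift_def used_simps play_simps list.size t bh bp
    by (simp add: algebra_simps)
qed

lemma drift_abs: "L \<in> V \<Longrightarrow> L' \<in> V \<Longrightarrow> \<bar>drift L L' h j k\<bar> \<le> jump"
proof -
  assume L: "L \<in> V" "L' \<in> V"
  have "\<bar>(fst L' - fst L) * of_bool (hires_at \<pi> h j k)\<bar> \<le> A"
    using V_nonneg(1)[OF L(1)] V_nonneg(1)[OF L(2)] V_le(1)[OF L(1)] V_le(1)[OF L(2)] by auto
  moreover have "\<bar>(snd L' - snd L) * of_bool (act \<pi> h j = Probe)\<bar> \<le> A"
    using V_nonneg(2)[OF L(1)] V_nonneg(2)[OF L(2)] V_le(2)[OF L(1)] V_le(2)[OF L(2)] by auto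
  moreover have "\<bar>mean_best L' - mean_best L\<bar> \<le> rmax"
    using mean_best_range[of L] mean_best_range[of L'] V_nonneg L by (simp add: abs_le_iff)
  ultimately show ?thesis unfolding drift_def jump_def by linarith
qed

text \<open>
  The gap of a lossless price does not shrink in expectation: the losses of the reference price can
  only enlarge it.
\<close>

lemma drift_mean:
  "(\<Sum>j\<in>UNIV. pmf p j * (\<Sum>k\<in>UNIV. pmf (q j) k * drift L L' h j k)) =
    (\<Sum>j\<in>UNIV. pmf p j * (plan_loss \<pi> h j L' - plan_loss \<pi> h j L))"
proof -
  have "(\<Sum>k\<in>UNIV. pmf (q j) k * drift L L' h j k) =
      (fst L' - fst L) * cls \<pi> h j + (snd L' - snd L) * of_bool (act \<pi> h j = Probe) + (mean_best L' - mean_best L)" for j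
  proof -
    have "pmf (q j) k * drift L L' h j k = (fst L' - fst L) * (pmf (q j) k * of_bool (hires_at \<pi> h j k))
      + pmf (q j) k * ((snd L' - snd L) * of_bool (act \<pi> h j = Probe) + (mean_best L' - mean_best L))" for k
      by (simp add: drift_def algebra_simps)
    then have "(\<Sum>k\<in>UNIV. pmf (q j) k * drift L L' h j k) =
      (fst L' - fst L) * (\<Sum>k\<in>UNIV. pmf (q j) k * of_bool (hires_at \<pi> h j k))
      + (\<Sum>k\<in>UNIV. pmf (q j) k) * ((snd L' - snd L) * of_bool (act \<pi> h j = Probe) + (mean_best L' - mean_best L))"
      by (simp only: sum.distrib sum_distrib_left sum_distrib_right)
    then show ?thesis by (simp add: sum_pmf_UNIV rate_def)
  qed
  also have "(fst L' - fst L) * cls \<pi> h j + (snd L' - snd L) * of_bool (act \<pi> h j = Probe) + (mean_best L' - mean_best L) =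
     (plan_loss \<pi> h j L' - plan_loss \<pi> h j L)
     + ((mean_best L' - mean_best L) - (best j L' - best j L))" for j
    unfolding loss_def payoff_def by (simp add: algebra_simps)
  finally have "(\<Sum>j\<in>UNIV. pmf p j * (\<Sum>k\<in>UNIV. pmf (q j) k * drift L L' h j k)) =
    (\<Sum>j\<in>UNIV. pmf p j * (plan_loss \<pi> h j L' - plan_loss \<pi> h j L))
    + ((\<Sum>j\<in>UNIV. pmf p j) * (mean_best L' - mean_best L) - (mean_best L' - mean_best L))"
    unfolding mean_best_def[of L] mean_best_def[of L']
    by (simp add: distrib_left right_diff_distrib sum.distrib sum_subtractf flip: sum_distrib_right)
  then show ?thesis by (simp add: sum_pmf_UNIV)
qed

lemma mean_le_const:
  assumes "\<And>j k. 0 < pmf p j \<Longrightarrow> 0 < pmf (q j) k \<Longrightarrow> f j k \<le> (c :: real)"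
  shows "(\<Sum>j\<in>UNIV. pmf p j * (\<Sum>k\<in>UNIV. pmf (q j) k * f j k)) \<le> c"
proof -
  have "(\<Sum>j\<in>UNIV. pmf p j * (\<Sum>k\<in>UNIV. pmf (q j) k * f j k)) \<le> (\<Sum>j\<in>UNIV. pmf p j * (\<Sum>k\<in>UNIV. pmf (q j) k * c))"
  proof (rule sum_mono)
    fix j
    show "pmf p j * (\<Sum>k\<in>UNIV. pmf (q j) k * f j k) \<le> pmf p j * (\<Sum>k\<in>UNIV. pmf (q j) k * c)"
    proof (cases "pmf p j = 0")
      case False
      have "pmf (q j) k * f j k \<le> pmf (q j) k * c" for k
        using assms[of j k] False by (cases "pmf (q j) k = 0") (auto simp: pmf_pos intro: mult_left_mono)
      then have "(\<Sum>k\<in>UNIV. pmf (q j) k * f j k) \<le> (\<Sum>k\<in>UNIV. pmf (q j) k * c)" by (rule sum_mono)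
      then show ?thesis by (rule mult_left_mono) simp
    qed simp
  qed
  then show ?thesis by (simp add: sum_pmf_UNIV flip: sum_distrib_right)
qed

text \<open>
  If the gap exceeds the threshold, or the price is discarded in this very step, the potential is
  tiny after the step. Otherwise the price is lossless by \<open>near_lossless\<close>, so its gap
  has nonnegative drift and the potential grows by at most the factor \<open>growth\<close>.
\<close>

lemma lapsed_step:
  assumes h: "reachable \<pi> nature h" "length h < T" and L: "L \<in> V"
  shows "(\<Sum>j\<in>UNIV. pmf p j * (\<Sum>k\<in>UNIV. pmf (q j) k * lapsed (play \<pi> h (j, k) # h) L))
    \<le> growth * lapsed h L + exp (gap_tilt * jump) * exp (- gap_tilt * (tol * togo h))"
    (is "?lhs \<le> _ + ?K")
proof (cases "L \<in> relevant h \<or> gap h L > tol * togo h")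
  case True
  have "?lhs \<le> ?K"
  proof (rule mean_le_const)
    fix j k assume jk: "0 < pmf p j" "0 < pmf (q j) k"
    let ?h = "play \<pi> h (j, k) # h"
    show "lapsed ?h L \<le> ?K"
    proof (cases "L \<in> relevant ?h")
      case False
      have "tol * togo h - jump \<le> gap ?h L"
      proof (cases "L \<in> relevant h")
        case True
        then have "L \<notin> near ?h" using False by simp
        then have "tol * togo ?h < gap ?h L" using L by (simp add: near_iff_gap)
        moreover have "togo h = togo ?h + 1" using h(2) by simp
        then have "tol * togo h = tol * togo ?h + tol" by (simp only: distrib_left mult_1_right)
        ultimately show ?thesis using tol jump by linarith
      next
        case False
        then have big: "gap h L > tol * togo h" using True by simp
        obtain L' where L': "L' \<in> V" "gap h L = togo_bound h L - togo_bound h L'" using gap_attained .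
        show ?thesis
          using gap_ge[OF L'(1), of ?h L] togo_bound_step[OF h jk, of L L'] drift_abs[OF L L'(1), of h j k] big L'(2)
          by linarith
      qed
      then have "gap_tilt * (tol * togo h - jump) \<le> gap_tilt * gap ?h L"
        using gap_tilt(1) by (intro mult_left_mono) auto
      then have "lapsed ?h L \<le> exp (gap_tilt * jump + - gap_tilt * (tol * togo h))"
        by (simp add: lapsed_def algebra_simps)
      then show ?thesis by (simp only: exp_add)
    qed (simp add: lapsed_def)
  qed
  moreover have "0 \<le> growth * lapsed h L" using growth lapsed_nonneg[of h L] by simp
  ultimately show ?thesis by linarith
next
  case False
  then have near: "L \<in> near h" and nr: "L \<notin> relevant h" using L by (auto simp: near_iff_gap)
  obtain L' where L': "L' \<in> V" "gap h L = togo_bound h L - togo_bound h L'" using gap_attained .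
  let ?d = "\<lambda>j k. drift L L' h j k"
  let ?E = "\<lambda>f. (\<Sum>j\<in>UNIV. pmf p j * (\<Sum>k\<in>UNIV. pmf (q j) k * f j k)) :: real"
  have pt: "lapsed (play \<pi> h (j, k) # h) L \<le> exp (- gap_tilt * gap h L) * (1 - gap_tilt * ?d j k + (gap_tilt * jump)\<^sup>2)"
    if jk: "0 < pmf p j" "0 < pmf (q j) k" for j k
  proof -
    let ?h = "play \<pi> h (j, k) # h"
    have "gap h L + ?d j k \<le> gap ?h L"
      using gap_ge[OF L'(1), of ?h L] togo_bound_step[OF h jk, of L L'] L'(2) by simp
    then have "gap_tilt * (gap h L + ?d j k) \<le> gap_tilt * gap ?h L" using gap_tilt(1) by (intro mult_left_mono) auto
    then have "lapsed ?h L \<le> exp (- gap_tilt * gap h L + - (gap_tilt * ?d j k))"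
      by (simp add: lapsed_def algebra_simps)
    also have "\<dots> = exp (- gap_tilt * gap h L) * exp (- (gap_tilt * ?d j k))" by (rule exp_add)
    also have "\<dots> \<le> exp (- gap_tilt * gap h L) * (1 - gap_tilt * ?d j k + (gap_tilt * jump)\<^sup>2)"
    proof (intro mult_left_mono)
      have "\<bar>gap_tilt * ?d j k\<bar> \<le> gap_tilt * jump"
        using drift_abs[OF L L'(1)] gap_tilt(1) by (simp add: abs_mult)
      moreover from this have "(gap_tilt * ?d j k)\<^sup>2 \<le> (gap_tilt * jump)\<^sup>2"
        using power_mono[of "\<bar>gap_tilt * ?d j k\<bar>" "gap_tilt * jump" 2] by simp
      ultimately show "exp (- (gap_tilt * ?d j k)) \<le> 1 - gap_tilt * ?d j k + (gap_tilt * jump)\<^sup>2"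
        using exp_le_quadratic[of "- (gap_tilt * ?d j k)"] gap_tilt(2) by simp
    qed simp
    finally show ?thesis .
  qed
  have "0 \<le> ?E ?d"
  proof -
    have "0 \<le> pmf p j * (plan_loss \<pi> h j L' - plan_loss \<pi> h j L)" for j
      using near_lossless[OF near h(2), of j] loss_nonneg
      by (cases "pmf p j = 0") (auto simp: pmf_pos)
    then show ?thesis unfolding drift_mean by (intro sum_nonneg) auto
  qed
  define W where "W = exp (- gap_tilt * gap h L)"
  have "?lhs - ?E (\<lambda>j k. W * (1 - gap_tilt * ?d j k + (gap_tilt * jump)\<^sup>2))
     = ?E (\<lambda>j k. lapsed (play \<pi> h (j, k) # h) L - W * (1 - gap_tilt * ?d j k + (gap_tilt * jump)\<^sup>2))"
    by (simp add: right_diff_distrib sum_subtractf)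
  also have "\<dots> \<le> 0" using pt by (intro mean_le_const) (auto simp: W_def)
  finally have "?lhs \<le> ?E (\<lambda>j k. W * (1 - gap_tilt * ?d j k + (gap_tilt * jump)\<^sup>2))" by simp
  also have "\<dots> = ?E (\<lambda>j k. W * (1 + (gap_tilt * jump)\<^sup>2)) - W * gap_tilt * ?E ?d"
    by (simp add: right_diff_distrib distrib_left sum_subtractf sum.distrib sum_distrib_left mult_ac)
  also have "?E (\<lambda>j k. W * (1 + (gap_tilt * jump)\<^sup>2)) = W * (1 + (gap_tilt * jump)\<^sup>2)"
    by (simp add: sum_pmf_UNIV flip: sum_distrib_right)
  finally have "?lhs \<le> W * (1 + (gap_tilt * jump)\<^sup>2)"
    using \<open>0 \<le> ?E ?d\<close> gap_tilt(1) by (smt (verit) W_def exp_gt_zero mult_nonneg_nonneg)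
  also have "\<dots> \<le> W * growth" using gap_tilt(3) by (intro mult_left_mono) (auto simp: W_def)
  finally have "?lhs \<le> growth * lapsed h L" using nr by (simp add: lapsed_def W_def mult.commute)
  moreover have "0 \<le> ?K" by simp
  ultimately show ?thesis by linarith
qed

fun idle :: "('n, 'm) history \<Rightarrow> real" where
  "idle [] = of_bool (relevant [] = {})"
| "idle (e # h) = of_bool (relevant (e # h) = {}) + idle h"

text \<open>
  In a state without relevant prices an optimal price has lapsed, so the potential is at least one
  there. The potential grows by a factor \<open>growth\<close> per period, but with
  \<open>n\<close> periods to go it is only fed by terms of order
  \<open>(1 / growth) ^ (4 * n)\<close>; weighting it by \<open>growth ^ (2 * n)\<close> leaves a
  convergent series.
\<close>

lemma expected_idle_from:
  assumes "reachable \<pi> nature h" "length h + n = T"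
  shows "type_exp n (\<lambda>js. run_exp \<pi> nature idle h js) \<le>
    idle h + idle_rate * growth ^ (2 * n) * (\<Sum>L\<in>V. lapsed h L)
    + idle_const * (\<Sum>i<n. ((1 / growth)\<^sup>2) ^ Suc i)"
  using assms
proof (induction n arbitrary: h)
  case 0
  have "0 \<le> idle_rate * (\<Sum>L\<in>V. lapsed h L)"
    using growth lapsed_nonneg by (simp add: idle_rate_def sum_nonneg)
  then show ?case by simp
next
  case (Suc n)
  let ?h = "\<lambda>j k. play \<pi> h (j, k) # h"
  let ?E = "\<lambda>f. (\<Sum>j\<in>UNIV. pmf p j * (\<Sum>k\<in>UNIV. pmf (q j) k * f j k)) :: real"
  let ?S = "\<lambda>h. \<Sum>L\<in>V. lapsed h L"
  let ?a = "idle_rate" and ?u = "growth"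
  define c where "c = idle_const * (\<Sum>i<n. ((1 / growth)\<^sup>2) ^ Suc i)"
  have len: "length h < T" and tn: "T - length h = Suc n" using Suc.prems by auto
  have a0: "0 < ?a" "?a * (?u - 1) = 1" using growth by (auto simp: idle_rate_def)
  have lhs: "type_exp (Suc n) (\<lambda>js. run_exp \<pi> nature idle h js) =
      ?E (\<lambda>j k. type_exp n (\<lambda>js. run_exp \<pi> nature idle (?h j k) js))"
    by (simp add: type_exp_sum type_exp_cmult)
  have "?E (\<lambda>j k. type_exp n (\<lambda>js. run_exp \<pi> nature idle (?h j k) js)) -
     ?E (\<lambda>j k. idle h + (1 + ?a * ?u ^ (2 * n)) * ?S (?h j k) + c) =
     ?E (\<lambda>j k. type_exp n (\<lambda>js. run_exp \<pi> nature idle (?h j k) js) - (idle h + (1 + ?a * ?u ^ (2 * n)) * ?S (?h j k) + c))"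
    by (simp add: right_diff_distrib sum_subtractf)
  also have "\<dots> \<le> 0"
  proof (rule mean_le_const)
    fix j k assume jk: "0 < pmf p j" "0 < pmf (q j) k"
    have "type_exp n (\<lambda>js. run_exp \<pi> nature idle (?h j k) js) \<le> idle (?h j k) + ?a * ?u ^ (2 * n) * ?S (?h j k) + c"
      unfolding c_def using Suc.prems jk by (intro Suc.IH reachable_Cons_play) auto
    also have "idle (?h j k) \<le> ?S (?h j k) + idle h"
      using relevant_empty_le[of "?h j k"] by simp
    finally show "type_exp n (\<lambda>js. run_exp \<pi> nature idle (?h j k) js) - (idle h + (1 + ?a * ?u ^ (2 * n)) * ?S (?h j k) + c) \<le> 0"
      by (simp add: algebra_simps)
  qed
  finally have 1: "type_exp (Suc n) (\<lambda>js. run_exp \<pi> nature idle h js) \<le>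
      ?E (\<lambda>j k. idle h + (1 + ?a * ?u ^ (2 * n)) * ?S (?h j k) + c)"
    unfolding lhs by simp
  have 2: "?E (\<lambda>j k. idle h + (1 + ?a * ?u ^ (2 * n)) * ?S (?h j k) + c) =
      idle h + (1 + ?a * ?u ^ (2 * n)) * ?E (\<lambda>j k. ?S (?h j k)) + c"
  proof -
    define f where "f j k = ?S (?h j k)" for j k
    define b where "b = 1 + ?a * ?u ^ (2 * n)"
    have "?E (\<lambda>j k. idle h + b * f j k + c) = ?E (\<lambda>j k. idle h) + ?E (\<lambda>j k. b * f j k) + ?E (\<lambda>j k. c)"
      by (simp add: distrib_left sum.distrib)
    also have "?E (\<lambda>j k. b * f j k) = b * ?E f" by (simp add: sum_distrib_left mult_ac)
    finally show ?thesis unfolding f_def b_def by (simp add: sum_pmf_UNIV flip: sum_distrib_right)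
  qed
  have 3: "?E (\<lambda>j k. ?S (?h j k)) \<le> ?u * ?S h + real (card V) * exp (gap_tilt * jump) * (1 / ?u) ^ (4 * Suc n)"
  proof -
    have "?E (\<lambda>j k. ?S (?h j k)) = (\<Sum>L\<in>V. ?E (\<lambda>j k. lapsed (?h j k) L))"
    proof -
      have "?E (\<lambda>j k. ?S (?h j k)) = (\<Sum>j\<in>UNIV. \<Sum>L\<in>V. pmf p j * (\<Sum>k\<in>UNIV. pmf (q j) k * lapsed (?h j k) L))"
        by (intro sum.cong refl) (simp add: sum_distrib_left sum.swap[of _ V UNIV])
      then show ?thesis by (simp add: sum.swap[of _ V UNIV])
    qed
    also have "\<dots> \<le> (\<Sum>L\<in>V. ?u * lapsed h L + exp (gap_tilt * jump) * (1 / ?u) ^ (4 * Suc n))"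
      using lapsed_step[OF Suc.prems(1) len] unfolding tn exp_growth by (intro sum_mono) auto
    finally show ?thesis by (simp add: sum.distrib sum_distrib_left)
  qed
  have b0: "0 \<le> 1 + ?a * ?u ^ (2 * n)" using a0 growth by simp
  have S0: "0 \<le> ?S h" using lapsed_nonneg by (simp add: sum_nonneg)
  have 4: "(1 + ?a * ?u ^ (2 * n)) * (?u * ?S h) \<le> ?a * ?u ^ (2 * Suc n) * ?S h"
  proof -
    have "1 \<le> ?u ^ (2 * n)" using growth by (intro one_le_power) auto
    then have "?u * 1 \<le> ?u * ?u ^ (2 * n)" using growth by (intro mult_left_mono) auto
    then have "?u \<le> (?a * (?u - 1)) * (?u * ?u ^ (2 * n))" using a0 by simp
    then have "(1 + ?a * ?u ^ (2 * n)) * ?u \<le> ?a * ?u ^ (2 * Suc n)" by (simp add: algebra_simps)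
    from mult_right_mono[OF this S0] show ?thesis by (simp only: mult.assoc)
  qed
  have 5: "(1 + ?a * ?u ^ (2 * n)) * (real (card V) * exp (gap_tilt * jump) * (1 / ?u) ^ (4 * Suc n))
      \<le> idle_const * ((1 / ?u)\<^sup>2) ^ Suc n"
  proof -
    have u1: "1 \<le> ?u ^ (2 * Suc n)" "?u ^ (2 * n) \<le> ?u ^ (2 * Suc n)"
      using growth by (intro one_le_power power_increasing; simp)+
    have "?a * ?u ^ (2 * n) \<le> ?a * ?u ^ (2 * Suc n)"
      using u1(2) a0 by (intro mult_left_mono) auto
    then have "1 + ?a * ?u ^ (2 * n) \<le> ?u ^ (2 * Suc n) + ?a * ?u ^ (2 * Suc n)"
      using u1(1) by linarith
    then have "(1 + ?a * ?u ^ (2 * n)) * (1 / ?u) ^ (4 * Suc n) \<le> (1 + ?a) * ?u ^ (2 * Suc n) * (1 / ?u) ^ (4 * Suc n)"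
      using growth by (intro mult_right_mono) (auto simp: distrib_right)
    also have "\<dots> = (1 + ?a) * ((1 / ?u)\<^sup>2) ^ Suc n"
    proof -
      have "(1 / ?u) ^ (4 * Suc n) = (1 / ?u) ^ (2 * Suc n) * (1 / ?u) ^ (2 * Suc n)"
        unfolding power_add[symmetric] by (intro arg_cong[where f = "\<lambda>m. (1 / ?u) ^ m"]) simp
      moreover have "?u ^ (2 * Suc n) * (1 / ?u) ^ (2 * Suc n) = 1"
        using growth unfolding power_mult_distrib[symmetric] by simp
      ultimately have "(1 + ?a) * ?u ^ (2 * Suc n) * (1 / ?u) ^ (4 * Suc n) = (1 + ?a) * (1 / ?u) ^ (2 * Suc n)"
        by (metis mult.assoc mult.right_neutral mult.left_neutral)
      then show ?thesis by (simp only: power_mult)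
    qed
    finally have "(1 + ?a * ?u ^ (2 * n)) * (1 / ?u) ^ (4 * Suc n) \<le> (1 + ?a) * ((1 / ?u)\<^sup>2) ^ Suc n" .
    from mult_left_mono[OF this, of "real (card V) * exp (gap_tilt * jump)"] show ?thesis
      unfolding idle_const_def by (simp add: mult_ac)
  qed
  have "(1 + ?a * ?u ^ (2 * n)) * ?E (\<lambda>j k. ?S (?h j k)) \<le>
     (1 + ?a * ?u ^ (2 * n)) * (?u * ?S h + real (card V) * exp (gap_tilt * jump) * (1 / ?u) ^ (4 * Suc n))"
    using 3 b0 by (rule mult_left_mono)
  also have "\<dots> \<le> ?a * ?u ^ (2 * Suc n) * ?S h + idle_const * ((1 / ?u)\<^sup>2) ^ Suc n"
    using add_mono[OF 4 5] by (simp only: distrib_left)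
  finally have "type_exp (Suc n) (\<lambda>js. run_exp \<pi> nature idle h js) \<le>
      idle h + (?a * ?u ^ (2 * Suc n) * ?S h + idle_const * ((1 / ?u)\<^sup>2) ^ Suc n) + c"
    using 1 unfolding 2 by linarith
  then show ?case unfolding c_def by (simp only: sum.lessThan_Suc distrib_left)
qed

lemma near_Nil_nonempty: "near [] \<noteq> {}"
proof -
  obtain L where L: "L \<in> V" "\<forall>L'\<in>V. togo_bound [] L \<le> togo_bound [] L'"
    using exists_minimizer[OF finite_V, of "togo_bound []"] zero_V by blast
  have "togo_bound [] L - togo_bound [] L' \<le> tol * real (T - length ([] :: ('n, 'm) history))" if "L' \<in> V" for L'
  proof -
    have "0 \<le> tol * real (T - length ([] :: ('n, 'm) history))" using tol by simp
    then show ?thesis using bspec[OF L(2) that] by linarith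
  qed
  then show ?thesis using L(1) unfolding near_def by blast
qed

lemma expected_idle: "type_exp T (\<lambda>js. run_exp \<pi> nature idle [] js) \<le> idle_bound"
proof -
  have a0: "0 < idle_rate" using growth by (simp add: idle_rate_def)
  have k0: "0 \<le> idle_const" using a0 by (simp add: idle_const_def)
  have "lapsed [] L \<le> (1 / growth) ^ (4 * T)" if "L \<in> V" for L
  proof (cases "L \<in> near []")
    case False
    then have "tol * real T \<le> gap [] L" using that by (simp add: near_iff_gap)
    then have "gap_tilt * (tol * real T) \<le> gap_tilt * gap [] L" using gap_tilt(1) by (intro mult_left_mono) auto
    then show ?thesis unfolding exp_growth[symmetric] by (simp add: lapsed_def)
  qed (use growth in \<open>simp add: lapsed_def\<close>)
  then have "(\<Sum>L\<in>V. lapsed [] L) \<le> real (card V) * (1 / growth) ^ (4 * T)"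
    using sum_mono[of V "lapsed []" "\<lambda>_. (1 / growth) ^ (4 * T)"] by simp
  then have "idle_rate * growth ^ (2 * T) * (\<Sum>L\<in>V. lapsed [] L) \<le>
      idle_rate * growth ^ (2 * T) * (real (card V) * (1 / growth) ^ (4 * T))"
    using a0 growth by (intro mult_left_mono) auto
  also have "\<dots> = idle_rate * real (card V) * (1 / growth) ^ (2 * T)"
  proof -
    have "(1 / growth) ^ (4 * T) = (1 / growth) ^ (2 * T) * (1 / growth) ^ (2 * T)"
      unfolding power_add[symmetric] by (intro arg_cong[where f = "\<lambda>m. (1 / growth) ^ m"]) simp
    moreover have "growth ^ (2 * T) * (1 / growth) ^ (2 * T) = 1"
      using growth unfolding power_mult_distrib[symmetric] by simp
    ultimately show ?thesis by (simp add: algebra_simps)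
  qed
  also have "\<dots> \<le> idle_rate * real (card V) * 1"
    using a0 growth by (intro mult_left_mono power_le_one) auto
  finally have 1: "idle_rate * growth ^ (2 * T) * (\<Sum>L\<in>V. lapsed [] L) \<le> idle_rate * real (card V)" by simp
  define w where "w = (1 / growth)\<^sup>2"
  have w: "0 \<le> w" "w < 1" using growth by (auto simp: w_def power_divide field_simps)
  have "(\<Sum>i<T. w ^ Suc i) \<le> (\<Sum>i<T. w ^ i)"
    using w by (intro sum_mono) (auto simp: mult_left_le_one_le)
  also have "\<dots> = (1 - w ^ T) / (1 - w)" using w by (simp add: sum_gp_strict)
  also have "\<dots> \<le> 1 / (1 - w)" using w by (intro divide_right_mono) auto
  finally have "idle_const * (\<Sum>i<T. w ^ Suc i) \<le> idle_const * (1 / (1 - w))"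
    using k0 by (intro mult_left_mono) auto
  moreover have "idle [] = 0" using near_Nil_nonempty by simp
  ultimately show ?thesis
    using expected_idle_from[of "[]" T] 1 unfolding idle_bound_def w_def[symmetric] by simp
qed

end

section \<open>Deviations of the arriving types\<close>

context probing
begin

definition num :: "'n set \<Rightarrow> 'n list \<Rightarrow> nat" where
  "num J js = length (filter (\<lambda>j. j \<in> J) js)"

lemma num_simps [simp]: "num J [] = 0" "num J (j # js) = of_bool (j \<in> J) + num J js"
  "num J (xs @ ys) = num J xs + num J ys" "num J (rev xs) = num J xs"
  by (simp_all add: num_def rev_filter[symmetric])

lemma num_mono: "J \<subseteq> J' \<Longrightarrow> num J js \<le> num J' js"
  by (induction js) auto

end

context price_system
begin

definition mass :: "'n set \<Rightarrow> real" where
  "mass J = (\<Sum>j\<in>J. pmf p j)"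

definition slack :: real where "slack = pm / 12"

text \<open>
  RABBI plans for the mean number of arrivals of each type, whereas the items that arrive have to
  fit into the budgets; this is the event that for some set of types far more items arrive than
  planned for.
\<close>

definition overfull :: "'n list \<Rightarrow> bool" where
  "overfull js \<longleftrightarrow> (\<exists>J. real (length js) * (mass J + slack) < real (num J js))"

text \<open>
  A sum that dominates the largest time-to-go from which the arrivals are overfull. Summing instead
  of maximising keeps the expectation elementary.
\<close>

fun overfull_time :: "'n list \<Rightarrow> real" where
  "overfull_time [] = 0"
| "overfull_time (j # js) = real (length (j # js)) * of_bool (overfull (j # js)) + overfull_time js"

lemma overfull_time_nonneg: "0 \<le> overfull_time js"
  by (induction js) auto

lemma overfull_time_ge:
  assumes "overfull (drop m js)"
  shows "real (length (drop m js)) \<le> overfull_time js"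
  using assms
proof (induction js arbitrary: m)
  case (Cons j js)
  show ?case
  proof (cases m)
    case 0
    then show ?thesis using Cons.prems overfull_time_nonneg[of js] by simp
  next
    case (Suc m')
    then show ?thesis using Cons by (fastforce intro: order_trans)
  qed
qed simp

definition overfull_decay :: real where "overfull_decay = exp (- (slack\<^sup>2 / 4))"

text \<open>
  A Chernoff bound for the arrivals in \<open>J\<close>.
\<close>

lemma overfull_mgf:
  "type_exp n (\<lambda>js. exp (slack / 2 * (real (num J js) - real (length js) * (mass J + slack)))) \<le> overfull_decay ^ n"
proof (induction n)
  case (Suc n)
  let ?t = "slack / 2"
  let ?y = "\<lambda>j. of_bool (j \<in> J) - mass J"
  have t: "0 < ?t" "?t \<le> 1" using pm by (auto simp: slack_def)
  have m: "0 \<le> mass J" "mass J \<le> 1"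
  proof -
    show "0 \<le> mass J" by (simp add: mass_def sum_nonneg)
    have "mass J \<le> (\<Sum>j\<in>UNIV. pmf p j)" unfolding mass_def by (rule sum_mono2) auto
    then show "mass J \<le> 1" by (simp add: sum_pmf_UNIV)
  qed
  have split: "exp (?t * (real (num J (j # js)) - real (length (j # js)) * (mass J + slack)))
     = exp (- (?t * slack)) * exp (?t * ?y j) * exp (?t * (real (num J js) - real (length js) * (mass J + slack)))" for j js
    unfolding exp_add[symmetric] by (intro arg_cong[where f = exp]) (simp add: algebra_simps)
  have "(\<Sum>j\<in>UNIV. pmf p j * exp (?t * ?y j)) \<le> (\<Sum>j\<in>UNIV. pmf p j * (1 + ?t * ?y j + ?t\<^sup>2))"
  proof (intro sum_mono mult_left_mono)
    fix j
    have y: "\<bar>?y j\<bar> \<le> 1" using m by auto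
    then have a: "\<bar>?t * ?y j\<bar> \<le> ?t * 1" using t unfolding abs_mult by (intro mult_mono) auto
    from power_mono[OF a, of 2] have "(?t * ?y j)\<^sup>2 \<le> ?t\<^sup>2" by (simp only: power2_abs mult_1_right abs_ge_zero)
    moreover have "\<bar>?t * ?y j\<bar> \<le> 1" using a t by linarith
    ultimately show "exp (?t * ?y j) \<le> 1 + ?t * ?y j + ?t\<^sup>2" using exp_le_quadratic[of "?t * ?y j"] by linarith
  qed simp
  also have "\<dots> = 1 + ?t\<^sup>2"
  proof -
    have "(\<Sum>j\<in>UNIV. pmf p j * of_bool (j \<in> J)) = mass J"
      unfolding mass_def by (simp add: sum.If_cases Collect_mem_eq of_bool_def if_distrib cong: if_cong)
    then have z: "(\<Sum>j\<in>UNIV. pmf p j * ?y j) = 0"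
      by (simp add: right_diff_distrib sum_subtractf sum_pmf_UNIV flip: sum_distrib_right)
    have "(\<Sum>j\<in>UNIV. pmf p j * (1 + ?t * ?y j + ?t\<^sup>2)) = (\<Sum>j\<in>UNIV. pmf p j * (1 + ?t\<^sup>2) + ?t * (pmf p j * ?y j))"
      by (intro sum.cong) (auto simp: algebra_simps)
    also have "\<dots> = (\<Sum>j\<in>UNIV. pmf p j) * (1 + ?t\<^sup>2) + ?t * (\<Sum>j\<in>UNIV. pmf p j * ?y j)"
      by (simp only: sum.distrib sum_distrib_left sum_distrib_right)
    finally show ?thesis unfolding z by (simp add: sum_pmf_UNIV)
  qed
  also have "\<dots> \<le> exp (?t\<^sup>2)" using exp_ge_add_one_self by simp
  finally have "exp (- (?t * slack)) * (\<Sum>j\<in>UNIV. pmf p j * exp (?t * ?y j)) \<le> exp (- (?t * slack)) * exp (?t\<^sup>2)"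
    by (intro mult_left_mono) auto
  also have "\<dots> = overfull_decay"
    unfolding overfull_decay_def exp_add[symmetric] by (intro arg_cong[where f = exp]) (simp add: power2_eq_square)
  finally have one: "exp (- (?t * slack)) * (\<Sum>j\<in>UNIV. pmf p j * exp (?t * ?y j)) \<le> overfull_decay" .
  define R where "R = type_exp n (\<lambda>js. exp (?t * (real (num J js) - real (length js) * (mass J + slack))))"
  have R0: "0 \<le> R"
    using type_exp_mono[of n "\<lambda>_. 0" "\<lambda>js. exp (?t * (real (num J js) - real (length js) * (mass J + slack)))"]
    by (simp add: R_def type_exp_const)
  have "type_exp (Suc n) (\<lambda>js. exp (?t * (real (num J js) - real (length js) * (mass J + slack)))) =
      (\<Sum>j\<in>UNIV. pmf p j * (exp (- (?t * slack)) * exp (?t * ?y j) * R))"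
    unfolding type_exp.simps split R_def type_exp_cmult ..
  also have "\<dots> = exp (- (?t * slack)) * (\<Sum>j\<in>UNIV. pmf p j * exp (?t * ?y j)) * R"
    by (simp add: sum_distrib_left sum_distrib_right mult_ac)
  also have "\<dots> \<le> overfull_decay * R" using one R0 by (rule mult_right_mono)
  also have "\<dots> \<le> overfull_decay * overfull_decay ^ n" using Suc.IH by (intro mult_left_mono) (auto simp: R_def overfull_decay_def)
  finally show ?case by simp
qed simp

lemma overfull_prob: "type_exp n (\<lambda>js. of_bool (overfull js)) \<le> real (card (UNIV :: 'n set set)) * overfull_decay ^ n"
proof -
  have "type_exp n (\<lambda>js. of_bool (overfull js)) \<le>
    type_exp n (\<lambda>js. \<Sum>J\<in>UNIV. exp (slack / 2 * (real (num J js) - real (length js) * (mass J + slack))))"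
  proof (rule type_exp_mono)
    fix js :: "'n list"
    let ?f = "\<lambda>J. exp (slack / 2 * (real (num J js) - real (length js) * (mass J + slack)))"
    show "of_bool (overfull js) \<le> (\<Sum>J\<in>UNIV. ?f J)"
    proof (cases "overfull js")
      case True
      then obtain J where "real (length js) * (mass J + slack) < real (num J js)" by (auto simp: overfull_def)
      then have "1 \<le> ?f J" using pm by (simp add: slack_def)
      also have "?f J \<le> (\<Sum>J\<in>UNIV. ?f J)" by (rule member_le_sum[of J UNIV ?f]) simp_all
      finally show ?thesis by simp
    qed (simp add: sum_nonneg)
  qed
  also have "\<dots> \<le> (\<Sum>J\<in>(UNIV :: 'n set set). overfull_decay ^ n)"
    unfolding type_exp_sum by (intro sum_mono overfull_mgf)
  finally show ?thesis by simp
qed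

definition overfull_bound :: real where
  "overfull_bound = real (card (UNIV :: 'n set set)) * (1 / (1 - overfull_decay)\<^sup>2)"

lemma expected_overfull_time: "type_exp n overfull_time \<le> overfull_bound"
proof -
  have d: "0 < overfull_decay" "overfull_decay < 1" using pm by (auto simp: overfull_decay_def slack_def)
  have "type_exp n overfull_time \<le> (\<Sum>i<n. real (Suc i) * (real (card (UNIV :: 'n set set)) * overfull_decay ^ Suc i))"
  proof (induction n)
    case (Suc n)
    have len: "type_exp n (\<lambda>js. real (length (j # js)) * of_bool (overfull (j # js)) + overfull_time js)
      = real (Suc n) * type_exp n (\<lambda>js. of_bool (overfull (j # js))) + type_exp n overfull_time" for j
    proof -
      have "type_exp n (\<lambda>js. real (length (j # js)) * of_bool (overfull (j # js))) = type_exp n (\<lambda>js. real (Suc n) * of_bool (overfull (j # js)))"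
        by (intro antisym type_exp_mono) auto
      then show ?thesis by (simp only: type_exp_add type_exp_cmult)
    qed
    have "type_exp (Suc n) overfull_time = (\<Sum>j\<in>UNIV. pmf p j * (real (Suc n) * type_exp n (\<lambda>js. of_bool (overfull (j # js))) + type_exp n overfull_time))"
      unfolding type_exp.simps(2) overfull_time.simps(2) len ..
    also have "\<dots> = real (Suc n) * type_exp (Suc n) (\<lambda>js. of_bool (overfull js)) + (\<Sum>j\<in>UNIV. pmf p j) * type_exp n overfull_time"
      by (simp only: type_exp.simps(2) distrib_left sum.distrib sum_distrib_left sum_distrib_right mult_ac)
    also have "\<dots> = real (Suc n) * type_exp (Suc n) (\<lambda>js. of_bool (overfull js)) + type_exp n overfull_time"
      by (simp only: sum_pmf_UNIV mult_1)
    also have "\<dots> \<le> real (Suc n) * (real (card (UNIV :: 'n set set)) * overfull_decay ^ Suc n) + (\<Sum>i<n. real (Suc i) * (real (card (UNIV :: 'n set set)) * overfull_decay ^ Suc i))"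
      by (intro add_mono mult_left_mono overfull_prob Suc.IH) simp
    finally show ?case by simp
  qed simp
  also have "\<dots> = real (card (UNIV :: 'n set set)) * (\<Sum>i<n. real (Suc i) * overfull_decay ^ Suc i)"
    by (simp add: sum_distrib_left mult_ac)
  also have "(\<Sum>i<n. real (Suc i) * overfull_decay ^ Suc i) \<le> (\<Sum>i<n. real (Suc i) * overfull_decay ^ i)"
    using d by (intro sum_mono mult_left_mono) (auto simp: mult_left_le_one_le)
  also have "\<dots> \<le> (\<Sum>i. real (Suc i) * overfull_decay ^ i)"
    using geometric_deriv_sums[of overfull_decay] d by (intro sum_le_suminf) (auto simp: sums_iff)
  also have "\<dots> = 1 / (1 - overfull_decay)\<^sup>2"
    using geometric_deriv_sums[of overfull_decay] d by (simp add: sums_iff)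
  finally show ?thesis unfolding overfull_bound_def by (simp add: mult_left_mono)
qed

end

section \<open>Hire classes at two competing prices\<close>

context probing
begin

text \<open>
  Losslessness at two prices at once. Payoffs are affine in the price, so two plans for a type that
  are both lossless at two prices agree on the line through them; this relates their hiring
  probabilities to the slope of the line.
\<close>

definition lossless2 :: "price \<Rightarrow> price \<Rightarrow> 'n \<Rightarrow> action \<Rightarrow> ('m \<Rightarrow> verdict) \<Rightarrow> bool" where
  "lossless2 L1 L2 j a w \<longleftrightarrow> loss j a w L1 = 0 \<and> loss j a w L2 = 0"

lemma lossless2_payoffs:
  assumes "lossless2 L1 L2 j a w" "lossless2 L1 L2 j a' w'"
  shows "(fst L1 - fst L2) * (rate j a w - rate j a' w')
    + (snd L1 - snd L2) * (of_bool (a = Probe) - of_bool (a' = Probe)) = 0"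
proof -
  have "payoff j a w L1 = payoff j a' w' L1" "payoff j a w L2 = payoff j a' w' L2"
    using assms by (auto simp: lossless2_def loss_def)
  then show ?thesis unfolding payoff_def by (simp add: algebra_simps)
qed

lemma lossless2_probe_rate:
  assumes "fst L1 \<noteq> fst L2" "lossless2 L1 L2 j Probe w" "lossless2 L1 L2 j Probe w'"
  shows "rate j Probe w = rate j Probe w'"
  using lossless2_payoffs[OF assms(2,3)] assms(1) by simp

definition flexible :: "price \<Rightarrow> price \<Rightarrow> real \<Rightarrow> bool" where
  "flexible L1 L2 c \<longleftrightarrow> 0 < c \<and> c < 1 \<and>
     (\<exists>j w a w'. lossless2 L1 L2 j Probe w \<and> rate j Probe w = c \<and> lossless2 L1 L2 j a w' \<and> a \<noteq> Probe)"

lemma flexible_slope: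
  assumes "flexible L1 L2 c"
  obtains d where "d = 0 \<or> d = 1" "(fst L1 - fst L2) * (c - d) + (snd L1 - snd L2) = 0"
proof -
  obtain j w a w' where f: "lossless2 L1 L2 j Probe w" "rate j Probe w = c" "lossless2 L1 L2 j a w'" "a \<noteq> Probe"
    using assms by (auto simp: flexible_def)
  have "rate j a w' = 0 \<or> rate j a w' = 1" using f(4) by (cases a) auto
  then show thesis using that lossless2_payoffs[OF f(1,3)] f(2,4) by auto
qed

text \<open>
  By \<open>lossless2_payoffs\<close> the slope of the line through the two prices is
  \<open>d - c\<close>, where \<open>d\<close> is \<open>0\<close> if the alternative is to reject
  and \<open>1\<close> if it is to accept. As \<open>c\<close> lies strictly between
  \<open>0\<close> and \<open>1\<close>, the sign of the slope determines \<open>d\<close>.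
\<close>

lemma flexible_unique:
  assumes "fst L1 \<noteq> fst L2" "flexible L1 L2 c" "flexible L1 L2 c'"
  shows "c = c'"
proof -
  obtain d where d: "d = 0 \<or> d = 1" "(fst L1 - fst L2) * (c - d) + (snd L1 - snd L2) = 0"
    using flexible_slope[OF assms(2)] .
  obtain d' where d': "d' = 0 \<or> d' = 1" "(fst L1 - fst L2) * (c' - d') + (snd L1 - snd L2) = 0"
    using flexible_slope[OF assms(3)] .
  have "(fst L1 - fst L2) * ((c - d) - (c' - d')) = 0" using d(2) d'(2) by (simp add: algebra_simps)
  then have "c - d = c' - d'" using assms(1) by simp
  moreover have "0 < c" "c < 1" "0 < c'" "c' < 1" using assms by (auto simp: flexible_def)
  ultimately show ?thesis using d(1) d'(1) by auto
qed

lemma flexible_snd: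
  assumes "fst L1 \<noteq> fst L2" "flexible L1 L2 c"
  shows "snd L1 \<noteq> snd L2"
proof
  assume s: "snd L1 = snd L2"
  obtain d where d: "d = 0 \<or> d = 1" "(fst L1 - fst L2) * (c - d) + (snd L1 - snd L2) = 0"
    using flexible_slope[OF assms(2)] .
  then have "c = d" using s assms(1) by simp
  then show False using d(1) assms(2) by (auto simp: flexible_def)
qed

lemma plan_gain_rate_0: "rate j a w = 0 \<Longrightarrow> plan_gain j a w = 0"
  using plan_gain_abs_le[of j a w] by simp

lemma plan_gain_rate_1:
  assumes "rate j a w = 1"
  shows "plan_gain j a w = mean_reward q r j"
  unfolding plan_gain_def mean_reward_def
proof (rule sum.cong)
  fix k
  show "pmf (q j) k * (of_bool (hired a w k) * r j k) = pmf (q j) k * r j k"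
    using rate_1_imp[OF assms, of k] by (cases "pmf (q j) k = 0") (auto simp: pmf_pos)
qed simp

text \<open>
  If the verdict is a foregone conclusion, probing earns as much as accepting or rejecting
  outright, less the price of the probe.
\<close>

lemma lossless_probe_trivial:
  assumes "loss j Probe w L = 0" "rate j Probe w = 0 \<or> rate j Probe w = 1" "0 \<le> snd L"
  shows "snd L = 0"
proof -
  have b: "best j L = payoff j Probe w L" using assms(1) by (simp add: loss_def)
  show ?thesis
  proof (cases "rate j Probe w = 0")
    case True
    then have "payoff j Probe w L = - snd L" by (simp add: payoff_def plan_gain_rate_0)
    then show ?thesis using best_nonneg[of j L] b assms(3) by simp
  next
    case False
    then have "rate j Probe w = 1" using assms(2) by simp
    then have "payoff j Probe w L = payoff j Accept w L - snd L"
      by (simp add: payoff_def plan_gain_rate_1)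
    then show ?thesis using payoff_le_best[of j Accept w L] b assms(3) by simp
  qed
qed

lemma lossless2_probe_mixed:
  assumes "snd L1 \<noteq> snd L2" "0 \<le> snd L1" "0 \<le> snd L2" "lossless2 L1 L2 j Probe w"
  shows "0 < rate j Probe w" "rate j Probe w < 1"
proof -
  have "\<not> (rate j Probe w = 0 \<or> rate j Probe w = 1)"
    using lossless_probe_trivial[of j w L1] lossless_probe_trivial[of j w L2] assms
    unfolding lossless2_def by metis
  then show "0 < rate j Probe w" "rate j Probe w < 1" using rate_range[of j Probe w] by linarith+
qed

text \<open>
  The types for which probing is forced. A type without any plan that is lossless at both prices
  belongs here too; every plan for it is lossy at one of them.
\<close>

definition only_probed :: "price \<Rightarrow> price \<Rightarrow> 'n set" where
  "only_probed L1 L2 = {j. \<forall>a w. lossless2 L1 L2 j a w \<longrightarrow> a = Probe}"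

definition probed_otherwise :: "price \<Rightarrow> price \<Rightarrow> real \<Rightarrow> 'n set" where
  "probed_otherwise L1 L2 c = {j \<in> only_probed L1 L2. \<forall>w. lossless2 L1 L2 j Probe w \<longrightarrow> rate j Probe w \<noteq> c}"

lemma real_cnt: "real (cnt \<rho> c h) = path_sum (\<lambda>h e. of_bool (cls \<rho> h (etype e) = c)) h"
  by (induction h) auto

lemma real_cnt_Cons: "real (cnt \<rho> c (e # h)) = of_bool (cls \<rho> h (etype e) = c) + real (cnt \<rho> c h)"
  by simp

abbreviation plan_lossless :: "price \<Rightarrow> price \<Rightarrow> ('n, 'm) policy \<Rightarrow> ('n, 'm) history \<Rightarrow> 'n \<Rightarrow> bool" where
  "plan_lossless L1 L2 \<rho> h j \<equiv> lossless2 L1 L2 j (act \<rho> h j) (after_probe \<rho> h j)"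

fun path_lossless :: "price \<Rightarrow> price \<Rightarrow> ('n, 'm) policy \<Rightarrow> ('n, 'm) history \<Rightarrow> bool" where
  "path_lossless L1 L2 \<rho> [] = True"
| "path_lossless L1 L2 \<rho> (e # h) = (path_lossless L1 L2 \<rho> h \<and> plan_lossless L1 L2 \<rho> h (etype e))"

definition lossy_steps :: "price \<Rightarrow> price \<Rightarrow> ('n, 'm) policy \<Rightarrow> ('n, 'm) history \<Rightarrow> real" where
  "lossy_steps L1 L2 \<rho> = path_sum (\<lambda>h e. of_bool (\<not> plan_lossless L1 L2 \<rho> h (etype e)))"

lemma lossy_steps_Cons:
  "lossy_steps L1 L2 \<rho> (e # h) = of_bool (\<not> plan_lossless L1 L2 \<rho> h (etype e)) + lossy_steps L1 L2 \<rho> h"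
  by (simp add: lossy_steps_def)

lemma mixed_rate_probe: "0 < rate j a w \<Longrightarrow> rate j a w < 1 \<Longrightarrow> a = Probe"
  by (cases a) auto

lemma probes_play: "reachable \<rho> K (e # h) \<Longrightarrow> probes e = of_bool (act \<rho> h (etype e) = Probe)"
  by (erule reachable_ConsE) (simp add: play_simps)

text \<open>
  As long as online uses the class \<open>c\<close> only for types whose probing is forced, offline
  has to probe in the same periods or pay; and by \<open>lossless2_probe_rate\<close> all lossless
  probes of a type hire with the same probability.
\<close>

lemma matched_strict:
  assumes L: "fst L1 \<noteq> fst L2" and c: "0 < c" "c < 1"
    and "path_lossless L1 L2 \<pi> h" "map etype h = map etype g"
    and "path_sum (\<lambda>h e. of_bool (cls \<pi> h (etype e) = c \<and> etype e \<notin> only_probed L1 L2)) h = 0"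
  shows "real (cnt \<pi> c h) \<le> real (cnt \<rho> c g) + lossy_steps L1 L2 \<rho> g"
  using assms(4-)
proof (induction h arbitrary: g)
  case Nil
  then show ?case by (simp add: lossy_steps_def)
next
  case (Cons e h)
  obtain e' g' where g: "g = e' # g'" "etype e' = etype e" "map etype h = map etype g'"
    using Cons.prems(2) by (cases g) auto
  let ?f = "\<lambda>h e. of_bool (cls \<pi> h (etype e) = c \<and> etype e \<notin> only_probed L1 L2) :: real"
  have nn: "0 \<le> path_sum ?f h" by (rule path_sum_nonneg) simp
  have s0: "path_sum ?f h = 0" "\<not> (cls \<pi> h (etype e) = c \<and> etype e \<notin> only_probed L1 L2)"
    using Cons.prems(3) nn by (auto split: if_splits simp: of_bool_def)
  have IH: "real (cnt \<pi> c h) \<le> real (cnt \<rho> c g') + lossy_steps L1 L2 \<rho> g'"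
    using Cons.prems g s0 by (intro Cons.IH) auto
  have "of_bool (cls \<pi> h (etype e) = c) \<le> of_bool (cls \<rho> g' (etype e) = c) + (of_bool (\<not> plan_lossless L1 L2 \<rho> g' (etype e)) :: real)"
  proof (cases "cls \<pi> h (etype e) = c \<and> plan_lossless L1 L2 \<rho> g' (etype e)")
    case True
    then have P: "etype e \<in> only_probed L1 L2" using s0 by auto
    have "plan_lossless L1 L2 \<pi> h (etype e)" using Cons.prems by simp
    moreover have "act \<pi> h (etype e) = Probe" using True c by (intro mixed_rate_probe) auto
    moreover have "act \<rho> g' (etype e) = Probe" using True P by (auto simp: only_probed_def)
    ultimately have "cls \<pi> h (etype e) = cls \<rho> g' (etype e)"
      using lossless2_probe_rate[OF L] True by metis
    then show ?thesis using True by simp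
  qed auto
  then show ?case using IH unfolding g(1) real_cnt_Cons lossy_steps_Cons g(2) by linarith
qed

text \<open>
  If \<open>c\<close> is the flexible class, then each lossless probe of offline is in this class
  or is forced by the type, because the flexible class is unique.
\<close>

lemma offline_probes_le:
  assumes L: "fst L1 \<noteq> fst L2" "0 \<le> snd L1" "0 \<le> snd L2" and fl: "flexible L1 L2 c"
    and "reachable \<rho> K g"
  shows "real (probes_used g) \<le> real (cnt \<rho> c g) + lossy_steps L1 L2 \<rho> g
     + real (num (probed_otherwise L1 L2 c) (map etype g))"
  using assms(5)
proof (induction g)
  case Nil
  then show ?case by (simp add: lossy_steps_def)
next
  case (Cons e g)
  let ?j = "etype e"
  have pr: "probes e = of_bool (act \<rho> g ?j = Probe)" by (rule probes_play[OF Cons.prems])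
  have "(of_bool (act \<rho> g ?j = Probe) :: real) \<le> of_bool (cls \<rho> g ?j = c) + of_bool (\<not> plan_lossless L1 L2 \<rho> g ?j)
     + of_bool (?j \<in> probed_otherwise L1 L2 c)"
  proof (cases "act \<rho> g ?j = Probe \<and> plan_lossless L1 L2 \<rho> g ?j \<and> cls \<rho> g ?j \<noteq> c")
    case True
    then have ll: "lossless2 L1 L2 ?j Probe (after_probe \<rho> g ?j)" and nc: "rate ?j Probe (after_probe \<rho> g ?j) \<noteq> c" by auto
    have mixed: "0 < rate ?j Probe (after_probe \<rho> g ?j)" "rate ?j Probe (after_probe \<rho> g ?j) < 1"
      using lossless2_probe_mixed[OF flexible_snd[OF L(1) fl] L(2,3) ll] by auto
    have "?j \<in> only_probed L1 L2"
    proof (rule ccontr)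
      assume "?j \<notin> only_probed L1 L2"
      then obtain a w where "lossless2 L1 L2 ?j a w" "a \<noteq> Probe" by (auto simp: only_probed_def)
      then have "flexible L1 L2 (rate ?j Probe (after_probe \<rho> g ?j))"
        using ll mixed unfolding flexible_def by blast
      then show False using flexible_unique[OF L(1) fl] nc by auto
    qed
    moreover have "rate ?j Probe w \<noteq> c" if "lossless2 L1 L2 ?j Probe w" for w
      using lossless2_probe_rate[OF L(1) ll that] nc by simp
    ultimately have "?j \<in> probed_otherwise L1 L2 c" by (simp add: probed_otherwise_def)
    then show ?thesis by simp
  qed auto
  moreover have "real (probes_used g) \<le> real (cnt \<rho> c g) + lossy_steps L1 L2 \<rho> g
     + real (num (probed_otherwise L1 L2 c) (map etype g))"
    using Cons.prems by (intro Cons.IH) simp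
  moreover have "real (probes_used (e # g)) = of_bool (act \<rho> g ?j = Probe) + real (probes_used g)"
    using pr by simp
  moreover have "real (num (probed_otherwise L1 L2 c) (map etype (e # g))) =
      of_bool (?j \<in> probed_otherwise L1 L2 c) + real (num (probed_otherwise L1 L2 c) (map etype g))"
    by simp
  ultimately show ?case unfolding real_cnt_Cons lossy_steps_Cons by linarith
qed

text \<open>
  Conversely, a lossless run spends probes on its plans in the class \<open>c\<close> and on all
  types whose probing is forced.
\<close>

lemma online_probes_ge:
  assumes L: "fst L1 \<noteq> fst L2" and c: "0 < c" "c < 1"
    and "path_lossless L1 L2 \<pi> h" "reachable \<pi> K h"
  shows "cnt \<pi> c h + num (probed_otherwise L1 L2 c) (map etype h) \<le> probes_used h"
  using assms(4,5)
proof (induction h)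
  case (Cons e h)
  let ?j = "etype e"
  have pr: "probes e = of_bool (act \<pi> h ?j = Probe)" by (rule probes_play[OF Cons.prems(2)])
  have ll: "plan_lossless L1 L2 \<pi> h ?j" using Cons.prems by simp
  have probe: "act \<pi> h ?j = Probe" if "cls \<pi> h ?j = c \<or> ?j \<in> probed_otherwise L1 L2 c"
    using that ll c mixed_rate_probe[of ?j "act \<pi> h ?j"] unfolding probed_otherwise_def only_probed_def by blast
  have "\<not> (cls \<pi> h ?j = c \<and> ?j \<in> probed_otherwise L1 L2 c)"
  proof
    assume b: "cls \<pi> h ?j = c \<and> ?j \<in> probed_otherwise L1 L2 c"
    then have "act \<pi> h ?j = Probe" using probe by blast
    then show False using b ll by (auto simp: probed_otherwise_def)
  qed
  then have "of_bool (cls \<pi> h ?j = c) + of_bool (?j \<in> probed_otherwise L1 L2 c) \<le> (of_bool (act \<pi> h ?j = Probe) :: nat)"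
    using probe by auto
  moreover have "reachable \<pi> K h" "path_lossless L1 L2 \<pi> h" using Cons.prems by auto
  ultimately show ?case using Cons.IH pr by auto
qed simp

lemma path_sum_suffix:
  assumes "\<And>h e. 0 \<le> f h e"
  shows "path_sum f h \<le> path_sum f (xs @ h)"
  using assms by (induction xs) (auto intro: order_trans add_increasing)

end

context probing
begin

definition loss_sum :: "('n, 'm) policy \<Rightarrow> price \<Rightarrow> ('n, 'm) history \<Rightarrow> real" where
  "loss_sum \<rho> L = path_sum (\<lambda>h e. plan_loss \<rho> h (etype e) L)"

definition gain_sum :: "('n, 'm) policy \<Rightarrow> ('n, 'm) history \<Rightarrow> real" where
  "gain_sum \<rho> = path_sum (\<lambda>h e. plan_gain (etype e) (act \<rho> h (etype e)) (after_probe \<rho> h (etype e)))"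

lemma run_exp_total_gain: "run_exp \<rho> nature (total_gain r) [] js = run_exp \<rho> nature (gain_sum \<rho>) [] js"
proof -
  let ?D = "\<lambda>h e. gain r e - plan_gain (etype e) (act \<rho> h (etype e)) (after_probe \<rho> h (etype e))"
  have tg: "total_gain r h = path_sum (\<lambda>h e. gain r e) h" for h by (induction h) auto
  have "run_exp \<rho> nature (path_sum ?D) [] js = 0"
  proof (subst run_exp_martingale)
    fix h j
    show "(\<Sum>k\<in>UNIV. nature h j k * ?D h (play \<rho> h (j, k))) = 0"
      by (simp add: play_simps right_diff_distrib sum_subtractf sum_pmf_UNIV plan_gain_def flip: sum_distrib_right)
  qed (simp_all add: sum_pmf_UNIV)
  then show ?thesis unfolding path_sum_diff run_exp_diff gain_sum_def tg by simp
qed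

lemma gain_sum_eq:
  assumes "reachable \<rho> K h"
  shows "gain_sum \<rho> h = sum_list (map (\<lambda>j. best j L) (map etype h)) - loss_sum \<rho> L h
    + fst L * (real (hires_used h) - path_sum (hire_noise \<rho>) h) + snd L * real (probes_used h)"
  using assms
proof (induction h)
  case Nil
  then show ?case by (simp add: gain_sum_def loss_sum_def)
next
  case (Cons e h)
  let ?j = "etype e"
  have "plan_gain ?j (act \<rho> h ?j) (after_probe \<rho> h ?j) = best ?j L - plan_loss \<rho> h ?j L
     + fst L * (real (hires e) - hire_noise \<rho> h e) + snd L * real (probes e)"
    using probes_play[OF Cons.prems] by (simp add: loss_def payoff_def hire_noise_def)
  moreover have "gain_sum \<rho> h = sum_list (map (\<lambda>j. best j L) (map etype h)) - loss_sum \<rho> L h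
    + fst L * (real (hires_used h) - path_sum (hire_noise \<rho>) h) + snd L * real (probes_used h)"
    using Cons by simp
  ultimately show ?case by (simp add: gain_sum_def loss_sum_def algebra_simps)
qed

end

context rabbi
begin

text \<open>
  RABBI probes a flexible type only if the optimal solution probes a third of its mass. Up to a
  small gap the solution also probes all types that must be probed. Both fit into the budget, so
  unless the arrivals are overfull, the budget suffices for one flexible probe now and for all
  forced probes to come.
\<close>

lemma room_for_flexible_probe:
  assumes near: "L1 \<in> near h" "L2 \<in> near h" and len: "length h < T" and pj: "0 < pmf p j"
    and act: "act \<pi> h j = Probe" and j: "j \<notin> only_probed L1 L2"
    and js: "length (j # js) = T - length h" "\<not> overfull (j # js)"
  shows "probes_used h + 1 + num (only_probed L1 L2) js \<le> Bp"
proof -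
  let ?P = "only_probed L1 L2" and ?t = "togo h"
  obtain x y where o: "lp_optimal q r (Bh - hires_used h) (Bp - probes_used h) (\<lambda>j. ?t * pmf p j) x y"
    and s1: "lp_local (\<lambda>j. ?t * pmf p j) x y"
    and "lp_hires x y \<le> real (Bh - hires_used h)" and s2: "lp_probes x \<le> real (Bp - probes_used h)"
    and s3: "\<forall>j. ?t * pmf p j \<le> 3 * x j (act \<pi> h j)"
    and "\<forall>j k u. act \<pi> h j = Probe \<longrightarrow> y j k u \<le> y j k (after_probe \<pi> h j k)"
    using rabbi_solution[OF len] .
  have x0: "0 \<le> x i a" for i a using s1 by (simp add: lp_local_def)
  have z: "x i Accept + x i Probe + x i Reject = ?t * pmf p i" for i using s1 by (simp add: lp_local_def)
  have V12: "L1 \<in> V" "L2 \<in> V" using near by (auto simp: near_def)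
  let ?G = "\<lambda>L i. x i Accept * loss i Accept undefined L + x i Reject * loss i Reject undefined L + probe_gap i (x i Probe) (y i) L"
  have "c0 * (x i Accept + x i Reject) \<le> ?G L1 i + ?G L2 i" if "i \<in> ?P" for i
  proof -
    have two: "c0 \<le> loss i a undefined L1 + loss i a undefined L2" if "a \<noteq> Probe" for a
    proof -
      have "\<not> lossless2 L1 L2 i a undefined" using \<open>i \<in> ?P\<close> that by (auto simp: only_probed_def)
      then show ?thesis
        using loss_c0[OF V12(1), of i a undefined] loss_c0[OF V12(2), of i a undefined]
          loss_nonneg[of i a undefined L1] loss_nonneg[of i a undefined L2]
        unfolding lossless2_def by linarith
    qed
    have "x i a * c0 \<le> x i a * (loss i a undefined L1 + loss i a undefined L2)" if "a \<noteq> Probe" for a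
      using two[OF that] x0 by (intro mult_left_mono) auto
    from this[of Accept] this[of Reject] show ?thesis
      using probe_gap_nonneg[OF s1, of i L1] probe_gap_nonneg[OF s1, of i L2] by (simp add: algebra_simps)
  qed
  then have "(\<Sum>i\<in>?P. c0 * (x i Accept + x i Reject)) \<le> (\<Sum>i\<in>?P. ?G L1 i + ?G L2 i)"
    by (rule sum_mono)
  also have "\<dots> = (\<Sum>i\<in>?P. ?G L1 i) + (\<Sum>i\<in>?P. ?G L2 i)" by (rule sum.distrib)
  also have "\<dots> \<le> tol * ?t + tol * ?t"
    by (intro add_mono near_type_gap near o)
  finally have "c0 * (\<Sum>i\<in>?P. x i Accept + x i Reject) \<le> c0 * (?t * pm / 6)"
    by (simp add: sum_distrib_left tol_def mult_ac)
  then have skipped: "(\<Sum>i\<in>?P. x i Accept + x i Reject) \<le> ?t * pm / 6"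
    using c0 by (simp only: mult_le_cancel_left_pos)
  have "?t * mass ?P = (\<Sum>i\<in>?P. (x i Accept + x i Reject) + x i Probe)"
    unfolding mass_def sum_distrib_left using z by (intro sum.cong) (auto simp: algebra_simps)
  then have "?t * mass ?P - ?t * pm / 6 \<le> (\<Sum>i\<in>?P. x i Probe)"
    using skipped by (simp add: sum.distrib)
  moreover have "?t * pm / 3 \<le> x j Probe"
  proof -
    have "?t * pm \<le> ?t * pmf p j" using pmf_pm[OF pj] by (intro mult_left_mono) auto
    moreover have "?t * pmf p j \<le> 3 * x j Probe" using s3 act by metis
    ultimately show ?thesis by linarith
  qed
  moreover have "(\<Sum>i\<in>?P. x i Probe) + x j Probe \<le> lp_probes x"
  proof -
    have "(\<Sum>i\<in>insert j ?P. x i Probe) \<le> lp_probes x"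
      unfolding lp_probes_def using x0 by (intro sum_mono2) auto
    then show ?thesis using j by simp
  qed
  ultimately have "?t * mass ?P + ?t * pm / 6 \<le> real (Bp - probes_used h)" using s2 by linarith
  moreover have "real (num ?P js) \<le> ?t * (mass ?P + slack)"
    using js j by (auto simp: overfull_def not_less dest: spec[of _ ?P])
  moreover have "?t * (mass ?P + slack) = ?t * mass ?P + ?t * pm / 12"
    by (simp add: slack_def algebra_simps)
  moreover have "0 < ?t * pm / 12" using len pm by simp
  ultimately have "real (num ?P js) < real (Bp - probes_used h)" by linarith
  then show ?thesis by simp
qed

lemma near_left_budget:
  assumes "L \<in> near h"
  shows "fst L * real (Bh - hires_used h) + snd L * real (Bp - probes_used h) \<le> (rmax + 1) * togo h"
proof -
  have V: "L \<in> V" using assms by (simp add: near_def)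
  have "togo_bound h L - togo_bound h (0, 0) \<le> tol * togo h"
    using assms zero_V by (auto simp: near_def)
  moreover have "tol * togo h \<le> 1 * togo h"
    using tol by (intro mult_right_mono) auto
  moreover have "togo h * mean_best (0, 0) \<le> togo h * rmax"
    using mean_best_range(2)[of "(0, 0)"] by (intro mult_left_mono) auto
  moreover have "0 \<le> togo h * mean_best L"
    using mean_best_range(1)[of L] V_nonneg[OF V] by simp
  ultimately show ?thesis unfolding togo_bound_eq by (simp add: algebra_simps)
qed

text \<open>
  It is relevant whenever some price is, so online is lossless at it as long as any price is
  relevant.
\<close>

fun final_price :: "('n, 'm) history \<Rightarrow> price" where
  "final_price [] = (SOME L. L \<in> relevant [])"
| "final_price (e # h) = (if relevant (e # h) = {} then final_price h else SOME L. L \<in> relevant (e # h))"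

fun persists :: "price \<Rightarrow> ('n, 'm) history \<Rightarrow> bool" where
  "persists L [] = (L \<in> relevant [])"
| "persists L (e # h) = ((relevant (e # h) \<noteq> {} \<longrightarrow> L \<in> relevant (e # h)) \<and> persists L h)"

lemma persists_relevant: "L \<in> relevant h \<Longrightarrow> persists L h"
  by (induction h) auto

lemma relevant_Nil: "relevant [] \<noteq> {}"
  using near_Nil_nonempty by simp

lemma some_relevant: "relevant h \<noteq> {} \<Longrightarrow> (SOME L. L \<in> relevant h) \<in> relevant h"
  by (rule someI_ex) auto

lemma final_price_persists: "persists (final_price h) h"
proof (induction h)
  case Nil
  then show ?case using some_relevant[OF relevant_Nil] by simp
next
  case (Cons e h)
  show ?case
  proof (cases "relevant (e # h) = {}")
    case False
    then have "final_price (e # h) \<in> relevant (e # h)"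
      using some_relevant[OF False] by (simp del: relevant.simps)
    then show ?thesis by (rule persists_relevant)
  qed (use Cons in simp)
qed

lemma persists_V: "persists L h \<Longrightarrow> L \<in> V"
  using relevant_V[of "[]"] by (induction h) auto

lemma persists_imp: "persists L h \<Longrightarrow> relevant h \<noteq> {} \<Longrightarrow> L \<in> relevant h"
  by (cases h) auto

lemma idle_nonneg: "0 \<le> idle h"
  by (induction h) auto

lemma loss_le: "L \<in> V \<Longrightarrow> loss j a w L \<le> 2 * rmax + 2 * A"
proof -
  assume V: "L \<in> V"
  have "- rmax \<le> plan_gain j a w"
  proof -
    have "rmax * rate j a w \<le> rmax * 1" using rate_range rmax_nonneg by (intro mult_left_mono) auto
    then show ?thesis using plan_gain_abs_le[of j a w] by linarith
  qed
  moreover have "fst L * rate j a w \<le> A * 1"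
    using V_le[OF V] V_nonneg[OF V] rate_range A_nonneg by (intro mult_mono) auto
  moreover have "snd L * of_bool (a = Probe) \<le> A" using V_le[OF V] A_nonneg by auto
  ultimately show ?thesis
    using best_le_rmax[of L j] V_nonneg[OF V] unfolding loss_def payoff_def by linarith
qed

text \<open>
  The price is relevant, hence lossless, in every period that starts with a relevant price; each
  other period is counted by \<open>idle\<close>.
\<close>

lemma online_loss_le:
  assumes "persists L h" "reachable \<pi> nature h" "length h \<le> T"
  shows "loss_sum \<pi> L h \<le> (2 * rmax + 2 * A) * (idle h - of_bool (relevant h = {}))"
  using assms
proof (induction h)
  case Nil
  then show ?case using relevant_Nil by (simp add: loss_sum_def)
next
  case (Cons e h)
  let ?l = "plan_loss \<pi> h (etype e) L"
  have V: "L \<in> V" by (rule persists_V[OF Cons.prems(1)])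
  have c: "0 \<le> 2 * rmax + 2 * A" using rmax_nonneg A_nonneg by simp
  have IH: "loss_sum \<pi> L h \<le> (2 * rmax + 2 * A) * (idle h - of_bool (relevant h = {}))"
    using Cons by simp
  have "?l \<le> (2 * rmax + 2 * A) * of_bool (relevant h = {})"
  proof (cases "relevant h = {}")
    case False
    then have "L \<in> near h" using persists_imp[of L h] Cons.prems relevant_near by auto
    then have "?l = 0" using Cons.prems by (intro near_lossless) auto
    then show ?thesis using c by simp
  qed (use loss_le[OF V] in simp)
  then have "?l + loss_sum \<pi> L h \<le> (2 * rmax + 2 * A) * idle h"
    using IH by (simp add: right_diff_distrib)
  moreover have "idle (e # h) - of_bool (relevant (e # h) = {}) = idle h" by simp
  ultimately show ?case by (simp add: loss_sum_def)
qed

text \<open>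
  When the price was last relevant, its nearly optimal dual bound exceeded the value of the budgets
  left, and that bound is at most linear in the time-to-go.
\<close>

lemma online_left_le:
  assumes "persists L h" "reachable \<pi> nature h" "length h \<le> T"
  shows "fst L * real (Bh - hires_used h) + snd L * real (Bp - probes_used h)
    \<le> (rmax + 1) * (idle h + togo h)"
  using assms
proof (induction h)
  case Nil
  then have "L \<in> near []" by simp
  from near_left_budget[OF this] show ?case using relevant_Nil by simp
next
  case (Cons e h)
  have V: "L \<in> V" by (rule persists_V[OF Cons.prems(1)])
  show ?case
  proof (cases "relevant (e # h) = {}")
    case False
    then have "L \<in> near (e # h)" using persists_imp[OF Cons.prems(1)] relevant_near by auto
    note near_left_budget[OF this]
    also have "(rmax + 1) * togo (e # h) \<le> (rmax + 1) * (idle (e # h) + togo (e # h))"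
      using rmax_nonneg idle_nonneg[of "e # h"] by (intro mult_left_mono) auto
    finally show ?thesis .
  next
    case True
    have "fst L * real (Bh - hires_used (e # h)) + snd L * real (Bp - probes_used (e # h))
      \<le> fst L * real (Bh - hires_used h) + snd L * real (Bp - probes_used h)"
      using V_nonneg[OF V] by (intro add_mono mult_left_mono) auto
    also have "\<dots> \<le> (rmax + 1) * (idle h + togo h)"
      using Cons by simp
    also have "idle h + togo h = idle (e # h) + togo (e # h)"
      using True Cons.prems(3) by simp
    finally show ?thesis .
  qed
qed

end

text \<open>
  An offline run \<open>g\<close> that stays within the budgets, on the types \<open>\<xi>\<close>,
  which the online run shares.
\<close>

locale pairing = rabbi p q r V A c0 pm T Bh Bp \<pi>
  for p :: "'n::finite pmf" and q :: "'n \<Rightarrow> 'm::finite pmf" and r :: "'n \<Rightarrow> 'm \<Rightarrow> real"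
    and V A c0 pm T Bh Bp \<pi> +
  fixes \<rho> :: "('n, 'm) policy" and g :: "('n, 'm) history" and \<xi> :: "'n list"
  assumes g_reachable: "reachable \<rho> nature g" and g_types: "map etype g = rev \<xi>"
    and len_\<xi>: "length \<xi> = T" and pos_\<xi>: "\<forall>j\<in>set \<xi>. 0 < pmf p j"
    and g_hires: "hires_used g \<le> Bh" and g_probes: "probes_used g \<le> Bp"
begin

abbreviation coupled :: "('n, 'm) history \<Rightarrow> 'n \<Rightarrow> 'm \<Rightarrow> real" where
  "coupled \<equiv> replay \<pi> (queue \<rho> g)"

text \<open>
  What the offline run falls short of the dual bound, apart from noise and unused hires.
\<close>

definition off_cost :: "price \<Rightarrow> real" where
  "off_cost L = loss_sum \<rho> L g + snd L * (real Bp - real (probes_used g))"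

lemma loss_sum_nonneg: "0 \<le> loss_sum \<rho> L h"
  unfolding loss_sum_def by (rule path_sum_nonneg) (rule loss_nonneg)

lemma off_cost_nonneg: "L \<in> V \<Longrightarrow> 0 \<le> off_cost L"
  using loss_sum_nonneg V_nonneg g_probes by (simp add: off_cost_def)

lemma lossy_steps_le:
  assumes "L1 \<in> V" "L2 \<in> V"
  shows "c0 * lossy_steps L1 L2 \<rho> h \<le> loss_sum \<rho> L1 h + loss_sum \<rho> L2 h"
proof (induction h)
  case Nil
  then show ?case by (simp add: lossy_steps_def loss_sum_def)
next
  case (Cons e h)
  let ?l = "plan_loss \<rho> h (etype e)"
  have "c0 * of_bool (\<not> plan_lossless L1 L2 \<rho> h (etype e)) \<le> ?l L1 + ?l L2"
    using loss_c0[OF assms(1), of "etype e" "act \<rho> h (etype e)" "after_probe \<rho> h (etype e)"]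
      loss_c0[OF assms(2), of "etype e" "act \<rho> h (etype e)" "after_probe \<rho> h (etype e)"]
      loss_nonneg[of "etype e" "act \<rho> h (etype e)" "after_probe \<rho> h (etype e)" L1]
      loss_nonneg[of "etype e" "act \<rho> h (etype e)" "after_probe \<rho> h (etype e)" L2]
    unfolding lossless2_def by (auto simp: of_bool_def)
  moreover have "loss_sum \<rho> L (e # h) = ?l L + loss_sum \<rho> L h" for L by (simp add: loss_sum_def)
  ultimately show ?case using Cons unfolding lossy_steps_Cons by (simp only: distrib_left)
qed

text \<open>
  Either online has used the class \<open>c\<close> for forced types only, or its plans in this
  class, the forced probes so far and the forced probes to come fit into the budget together. The
  second alternative is established by \<open>room_for_flexible_probe\<close> at each flexible
  probe and is preserved by all other steps.
\<close>

lemma online_class_count: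
  assumes L: "fst L1 \<noteq> fst L2" and c: "0 < c" "c < 1"
    and "h = [] \<or> L1 \<in> relevant (tl h) \<and> L2 \<in> relevant (tl h)"
    and "reachable \<pi> nature h" "length h \<le> T" "map etype h = rev (take (length h) \<xi>)"
    and "\<And>m. m < length h \<Longrightarrow> \<not> overfull (drop m \<xi>)"
  shows "path_lossless L1 L2 \<pi> h \<and>
    (path_sum (\<lambda>h e. of_bool (cls \<pi> h (etype e) = c \<and> etype e \<notin> only_probed L1 L2)) h = 0 \<or>
     flexible L1 L2 c \<and> cnt \<pi> c h + num (probed_otherwise L1 L2 c) (map etype h)
       + num (only_probed L1 L2) (drop (length h) \<xi>) \<le> Bp)"
  using assms(4-)
proof (induction h)
  case (Cons e h)
  let ?j = "etype e" and ?P = "only_probed L1 L2" and ?O = "probed_otherwise L1 L2 c"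
  have rel: "L1 \<in> relevant h" "L2 \<in> relevant h" and rh: "reachable \<pi> nature h" and pj: "0 < pmf p ?j"
    and len: "length h < T" using Cons.prems by auto
  have near: "L1 \<in> near h" "L2 \<in> near h" using rel relevant_near by auto
  have tk: "take (Suc (length h)) \<xi> = take (length h) \<xi> @ [\<xi> ! length h]"
    using len len_\<xi> by (intro take_Suc_conv_app_nth) simp
  have types: "map etype h = rev (take (length h) \<xi>)" "?j = \<xi> ! length h"
    using Cons.prems(4) unfolding length_Cons tk by auto
  have dr: "drop (length h) \<xi> = ?j # drop (Suc (length h)) \<xi>"
    using types(2) len len_\<xi> by (simp add: Cons_nth_drop_Suc)
  have "h = [] \<or> L1 \<in> relevant (tl h) \<and> L2 \<in> relevant (tl h)"
    using rel by (cases h) auto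
  then have IH: "path_lossless L1 L2 \<pi> h \<and>
    (path_sum (\<lambda>h e. of_bool (cls \<pi> h (etype e) = c \<and> etype e \<notin> ?P)) h = 0 \<or>
     flexible L1 L2 c \<and> cnt \<pi> c h + num ?O (map etype h) + num ?P (drop (length h) \<xi>) \<le> Bp)"
    using rh len types(1) Cons.prems(5) by (intro Cons.IH) auto
  have ll: "plan_lossless L1 L2 \<pi> h ?j"
    using near_lossless[OF near(1) len pj] near_lossless[OF near(2) len pj] by (simp add: lossless2_def)
  then have pl: "path_lossless L1 L2 \<pi> (e # h)" using IH by simp
  show ?case
  proof (cases "cls \<pi> h ?j = c \<and> ?j \<notin> ?P")
    case True
    then have probe: "act \<pi> h ?j = Probe" using c by (intro mixed_rate_probe) auto
    obtain a w where aw: "lossless2 L1 L2 ?j a w" "a \<noteq> Probe" using True by (auto simp: only_probed_def)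
    have "lossless2 L1 L2 ?j Probe (after_probe \<pi> h ?j)" "rate ?j Probe (after_probe \<pi> h ?j) = c"
      using ll True unfolding probe by auto
    then have "flexible L1 L2 c" unfolding flexible_def using c aw by blast
    moreover have "probes_used h + 1 + num ?P (drop (Suc (length h)) \<xi>) \<le> Bp"
    proof (rule room_for_flexible_probe[OF near len pj probe])
      show "?j \<notin> ?P" using True by simp
      show "length (?j # drop (Suc (length h)) \<xi>) = T - length h"
        unfolding dr[symmetric] by (simp add: len_\<xi>)
      show "\<not> overfull (?j # drop (Suc (length h)) \<xi>)"
        unfolding dr[symmetric] using Cons.prems(5)[of "length h"] by simp
    qed
    moreover have "cnt \<pi> c (e # h) + num ?O (map etype (e # h)) \<le> probes_used (e # h)"
      using online_probes_ge[OF L c pl Cons.prems(2)] .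
    moreover have "probes e = 1" using probes_play[OF Cons.prems(2)] probe by simp
    ultimately show ?thesis using pl by auto
  next
    case False
    have "\<not> (cls \<pi> h ?j = c \<and> ?j \<in> ?O)"
    proof
      assume b: "cls \<pi> h ?j = c \<and> ?j \<in> ?O"
      then have "act \<pi> h ?j = Probe" using c by (intro mixed_rate_probe) auto
      then show False using b ll by (auto simp: probed_otherwise_def)
    qed
    moreover have "?j \<in> ?P" if "?j \<in> ?O" using that by (auto simp: probed_otherwise_def)
    ultimately have step: "(of_bool (cls \<pi> h ?j = c) :: nat) + of_bool (?j \<in> ?O) \<le> of_bool (?j \<in> ?P)"
      using False by auto
    have "cnt \<pi> c (e # h) = of_bool (cls \<pi> h ?j = c) + cnt \<pi> c h"
      "num ?O (map etype (e # h)) = of_bool (?j \<in> ?O) + num ?O (map etype h)"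
      "num ?P (drop (length h) \<xi>) = of_bool (?j \<in> ?P) + num ?P (drop (length (e # h)) \<xi>)"
      unfolding dr by simp_all
    then have mono: "cnt \<pi> c (e # h) + num ?O (map etype (e # h)) + num ?P (drop (length (e # h)) \<xi>)
       \<le> cnt \<pi> c h + num ?O (map etype h) + num ?P (drop (length h) \<xi>)"
      using step by linarith
    have eq: "path_sum (\<lambda>h e. of_bool (cls \<pi> h (etype e) = c \<and> etype e \<notin> ?P)) (e # h)
      = path_sum (\<lambda>h e. of_bool (cls \<pi> h (etype e) = c \<and> etype e \<notin> ?P)) h"
      using False by simp
    show ?thesis unfolding eq using IH pl order_trans[OF mono, of Bp] by blast
  qed
qed simp

text \<open>
  If \<open>c\<close> is flexible, online has probed in this class at most as often as the probing
  budget allows next to the forced probes. Offline spends all of its budget on the same two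
  purposes, except for lossy steps and unused probes. The latter have a price, since by
  \<open>flexible_snd\<close> one of the two probe prices is positive.
\<close>

lemma class_excess_le:
  assumes L: "fst L1 \<noteq> fst L2" "L1 \<in> V" "L2 \<in> V" and c: "0 < c" "c < 1"
    and rel: "h = [] \<or> L1 \<in> relevant (tl h) \<and> L2 \<in> relevant (tl h)"
    and h: "reachable \<pi> nature h" "length h \<le> T" "map etype h = rev (take (length h) \<xi>)"
    and good: "\<And>m. m < length h \<Longrightarrow> \<not> overfull (drop m \<xi>)"
  shows "c0 * (real (cnt \<pi> c h) - real (cnt \<rho> c g)) \<le> off_cost L1 + off_cost L2"
proof -
  have V0: "0 \<le> snd L1" "0 \<le> snd L2" using V_nonneg L by auto
  have left0: "0 \<le> snd L * (real Bp - real (probes_used g))" if "L \<in> V" for L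
    using V_nonneg[OF that] g_probes by simp
  have lossy: "c0 * lossy_steps L1 L2 \<rho> g \<le> loss_sum \<rho> L1 g + loss_sum \<rho> L2 g"
    using lossy_steps_le L by simp
  have cc: "path_lossless L1 L2 \<pi> h \<and>
    (path_sum (\<lambda>h e. of_bool (cls \<pi> h (etype e) = c \<and> etype e \<notin> only_probed L1 L2)) h = 0 \<or>
     flexible L1 L2 c \<and> cnt \<pi> c h + num (probed_otherwise L1 L2 c) (map etype h)
       + num (only_probed L1 L2) (drop (length h) \<xi>) \<le> Bp)"
    by (rule online_class_count[OF L(1) c rel h good])
  then consider (strict) "path_sum (\<lambda>h e. of_bool (cls \<pi> h (etype e) = c \<and> etype e \<notin> only_probed L1 L2)) h = 0"
    | (flex) "flexible L1 L2 c" "cnt \<pi> c h + num (probed_otherwise L1 L2 c) (map etype h)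
       + num (only_probed L1 L2) (drop (length h) \<xi>) \<le> Bp" by blast
  then show ?thesis
  proof cases
    case strict
    let ?g = "drop (T - length h) g"
    have "map etype h = map etype ?g"
      using h(2,3) g_types len_\<xi> by (simp add: drop_rev flip: drop_map)
    then have "real (cnt \<pi> c h) \<le> real (cnt \<rho> c ?g) + lossy_steps L1 L2 \<rho> ?g"
      using matched_strict[OF L(1) c _ _ strict] cc by blast
    also have "\<dots> \<le> real (cnt \<rho> c g) + lossy_steps L1 L2 \<rho> g"
    proof (rule add_mono)
      have split: "g = take (T - length h) g @ ?g" by simp
      show "real (cnt \<rho> c ?g) \<le> real (cnt \<rho> c g)"
        unfolding real_cnt by (subst (2) split) (rule path_sum_suffix, simp)
      show "lossy_steps L1 L2 \<rho> ?g \<le> lossy_steps L1 L2 \<rho> g"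
        unfolding lossy_steps_def by (subst (2) split) (rule path_sum_suffix, simp)
    qed
    finally have "c0 * (real (cnt \<pi> c h) - real (cnt \<rho> c g)) \<le> c0 * lossy_steps L1 L2 \<rho> g"
      using c0 by (intro mult_left_mono) auto
    then show ?thesis using lossy left0[OF L(2)] left0[OF L(3)] unfolding off_cost_def by linarith
  next
    case flex
    let ?O = "probed_otherwise L1 L2 c" and ?left = "real Bp - real (probes_used g)"
    have "num ?O (map etype g) = num ?O (take (length h) \<xi> @ drop (length h) \<xi>)"
      unfolding g_types append_take_drop_id by simp
    also have "\<dots> = num ?O (map etype h) + num ?O (drop (length h) \<xi>)"
      unfolding h(3) num_simps ..
    also have "num ?O (drop (length h) \<xi>) \<le> num (only_probed L1 L2) (drop (length h) \<xi>)"
      by (rule num_mono) (auto simp: probed_otherwise_def)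
    finally have on: "real (cnt \<pi> c h) \<le> real Bp - real (num ?O (map etype g))" using flex(2) by linarith
    have "real (cnt \<pi> c h) - real (cnt \<rho> c g) \<le> ?left + lossy_steps L1 L2 \<rho> g"
      using offline_probes_le[OF L(1) V0 flex(1) g_reachable] on by linarith
    then have "c0 * (real (cnt \<pi> c h) - real (cnt \<rho> c g)) \<le> c0 * (?left + lossy_steps L1 L2 \<rho> g)"
      using c0 by (intro mult_left_mono) auto
    moreover have "c0 * ?left \<le> snd L1 * ?left + snd L2 * ?left"
    proof -
      have "c0 \<le> snd L1 + snd L2"
        using flexible_snd[OF L(1) flex(1)] snd_c0[OF L(2)] snd_c0[OF L(3)] V0 by linarith
      then have "c0 * ?left \<le> (snd L1 + snd L2) * ?left" using g_probes by (intro mult_right_mono) auto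
      then show ?thesis by (simp only: distrib_right)
    qed
    ultimately show ?thesis using lossy unfolding off_cost_def by (simp only: distrib_left)
  qed
qed

end

section \<open>Regret along coupled runs\<close>

context price_system
begin

text \<open>
  The share of offline's cost that pays for one step of noise.
\<close>

definition charge :: real where "charge = c0 / (2 * (real (card mixed_rates) + 1))"

text \<open>
  The exponent at which one step of noise, of size at most \<open>A + 1\<close>, is dominated by
  its charge.
\<close>

definition noise_tilt :: real where "noise_tilt = charge / (A + 1)\<^sup>2"

definition waste :: real where "waste = A + (2 * rmax + 2 * A) + (rmax + 1)"

definition regret_bound :: real where
  "regret_bound = real (card V) / noise_tilt + waste * idle_bound + A * overfull_bound"

lemma charge: "0 < charge" "charge \<le> 1" "charge * (real (card mixed_rates) * (2 * x)) \<le> c0 * x" if "0 \<le> x" for x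
proof -
  let ?n = "real (card mixed_rates)"
  show "0 < charge" using c0 by (simp add: charge_def)
  have "1 * c0 \<le> (2 * (?n + 1)) * 1" using c0 by (intro mult_mono) auto
  then show "charge \<le> 1" by (simp add: charge_def)
  have "charge * (?n * (2 * x)) = c0 * (?n / (?n + 1)) * x" by (simp add: charge_def field_simps)
  also have "\<dots> \<le> c0 * 1 * x" using c0 that by (intro mult_right_mono mult_left_mono) auto
  finally show "charge * (?n * (2 * x)) \<le> c0 * x" by simp
qed

lemma noise_tilt: "0 < noise_tilt" "noise_tilt * (A + 1) \<le> 1" "(noise_tilt * (A + 1))\<^sup>2 = noise_tilt * charge"
proof -
  have A1: "1 \<le> A + 1" using A_nonneg by simp
  have c: "0 < charge" "charge \<le> 1" using charge(1,2)[of 0] by auto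
  show "0 < noise_tilt" using c A1 by (simp add: noise_tilt_def)
  have eq: "noise_tilt * (A + 1) = charge / (A + 1)" using A1 by (simp add: noise_tilt_def power2_eq_square)
  also have "\<dots> \<le> 1" using c A1 by simp
  finally show "noise_tilt * (A + 1) \<le> 1" .
  show "(noise_tilt * (A + 1))\<^sup>2 = noise_tilt * charge"
    unfolding eq using A1 by (simp add: noise_tilt_def power2_eq_square)
qed

end

context probing
begin

lemma hire_noise_play: "hire_noise \<rho> h (play \<rho> h (j, k)) = of_bool (hires_at \<rho> h j k) - cls \<rho> h j"
  by (simp add: hire_noise_def play_simps)

lemma hire_noise_abs: "\<bar>hire_noise \<rho> h (play \<rho> h (j, k))\<bar> \<le> 1"
  unfolding hire_noise_play using rate_range[of j "act \<rho> h j" "after_probe \<rho> h j"] by (auto simp: of_bool_def)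

lemma fresh_replay: "fresh \<rho> \<sigma> h j \<Longrightarrow> replay \<rho> \<sigma> h j k = pmf (q j) k"
  by (simp add: fresh_def replay_def replayed_def)

lemma fresh_noise_mean:
  assumes "fresh \<rho> \<sigma> h j"
  shows "(\<Sum>k\<in>UNIV. replay \<rho> \<sigma> h j k * (b * hire_noise \<rho> h (play \<rho> h (j, k)))) = 0"
proof -
  have "(\<Sum>k\<in>UNIV. replay \<rho> \<sigma> h j k * (b * hire_noise \<rho> h (play \<rho> h (j, k)))) =
    (\<Sum>k\<in>UNIV. pmf (q j) k * (b * (of_bool (hires_at \<rho> h j k) - cls \<rho> h j)))"
    unfolding fresh_replay[OF assms] hire_noise_play ..
  also have "\<dots> = 0"
    by (rule trans[OF rate_split[of j "\<lambda>x. b * (of_bool x - cls \<rho> h j)" "act \<rho> h j" "after_probe \<rho> h j"]])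
      (simp add: algebra_simps)
  finally show ?thesis .
qed

lemma fresh_count_le:
  "path_sum (\<lambda>h e. of_bool (fresh \<rho> \<sigma> h (etype e))) h \<le>
    (\<Sum>c\<in>mixed_rates. max 0 (real (cnt \<rho> c h) - real (length (\<sigma> c))))"
proof (induction h)
  case (Cons e h)
  let ?c = "cls \<rho> h (etype e)" and ?f = "fresh \<rho> \<sigma> h (etype e)"
  have "(\<Sum>c\<in>mixed_rates. max 0 (real (cnt \<rho> c h) - real (length (\<sigma> c))) + (if c = ?c then of_bool ?f else 0))
    \<le> (\<Sum>c\<in>mixed_rates. max 0 (real (cnt \<rho> c (e # h)) - real (length (\<sigma> c))))"
    by (intro sum_mono) (auto simp: fresh_def)
  moreover have "(\<Sum>c\<in>mixed_rates. (if c = ?c then of_bool ?f else 0)) = (of_bool ?f :: real)"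
    using finite_mixed_rates rate_in_mixed[of "etype e"] by (auto simp: fresh_def)
  ultimately show ?case using Cons by (simp add: sum.distrib)
qed (simp add: sum_nonneg)

end

context pairing
begin

text \<open>
  The reference price for the noise of the next period. It depends on the offline run and on the
  past only, so the noise charged at it is a martingale. Every other relevant price with a
  different price of hires is at least as costly for offline, so \<open>class_excess_le\<close>
  bounds the number of fresh outcomes by the cost at that other price alone.
\<close>

definition cheapest :: "('n, 'm) history \<Rightarrow> price" where
  "cheapest h = (SOME L. L \<in> relevant h \<and> (\<forall>L'\<in>relevant h. off_cost L \<le> off_cost L'))"

lemma cheapest:
  assumes "relevant h \<noteq> {}"
  shows "cheapest h \<in> relevant h" "L \<in> relevant h \<Longrightarrow> off_cost (cheapest h) \<le> off_cost L"
proof -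
  have "\<exists>L. L \<in> relevant h \<and> (\<forall>L'\<in>relevant h. off_cost L \<le> off_cost L')"
    using exists_minimizer[of "relevant h" off_cost] finite_subset[OF relevant_V finite_V] assms by blast
  from someI_ex[OF this] show "cheapest h \<in> relevant h" "L \<in> relevant h \<Longrightarrow> off_cost (cheapest h) \<le> off_cost L"
    unfolding cheapest_def by auto
qed

text \<open>
  Outside of good states, noise is bounded trivially.
\<close>

definition good :: "('n, 'm) history \<Rightarrow> bool" where
  "good h \<longleftrightarrow> relevant h \<noteq> {} \<and> overfull_time \<xi> < togo h"

definition counted :: "('n, 'm) history \<Rightarrow> 'n \<Rightarrow> bool" where
  "counted h j \<longleftrightarrow> good h \<and> fresh \<pi> (queue \<rho> g) h j"

definition base_noise :: "('n, 'm) history \<Rightarrow> ('n, 'm) event \<Rightarrow> real" where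
  "base_noise h e = of_bool (counted h (etype e)) * fst (cheapest h) * hire_noise \<pi> h e"

text \<open>
  The correction to \<open>base_noise\<close> if the noise is charged at the price \<open>L\<close>
  instead of the reference price.
\<close>

definition price_shift :: "price \<Rightarrow> ('n, 'm) history \<Rightarrow> ('n, 'm) event \<Rightarrow> real" where
  "price_shift L h e = of_bool (counted h (etype e) \<and> L \<in> relevant h) * (fst L - fst (cheapest h)) * hire_noise \<pi> h e"

definition shift_step :: "price \<Rightarrow> ('n, 'm) history \<Rightarrow> ('n, 'm) event \<Rightarrow> real" where
  "shift_step L h e = of_bool (counted h (etype e) \<and> L \<in> relevant h \<and> fst L \<noteq> fst (cheapest h))"

definition shift_weight :: "price \<Rightarrow> ('n, 'm) history \<Rightarrow> real" where
  "shift_weight L h = exp (noise_tilt * (path_sum (price_shift L) h - charge * path_sum (shift_step L) h))"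

lemma run_exp_base_noise: "run_exp \<pi> coupled (path_sum base_noise) [] js = 0"
proof (subst run_exp_martingale)
  fix h j
  show "(\<Sum>k\<in>UNIV. coupled h j k * base_noise h (play \<pi> h (j, k))) = 0"
  proof (cases "counted h j")
    case True
    then have "fresh \<pi> (queue \<rho> g) h j" by (simp add: counted_def)
    from fresh_noise_mean[OF this, of "fst (cheapest h)"] show ?thesis
      using True by (simp add: base_noise_def play_simps)
  qed (simp add: base_noise_def play_simps)
qed (simp_all add: replay_sum)

text \<open>
  In a step where the correction is random, its exponential moment is at most that of the charge.
\<close>

lemma run_exp_shift_weight:
  assumes V: "L \<in> V" and js: "\<forall>j\<in>set js. 0 < pmf p j"
  shows "run_exp \<pi> coupled (shift_weight L) [] js \<le> 1"
proof -
  have "run_exp \<pi> coupled (shift_weight L) [] js \<le> shift_weight L []"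
  proof (rule run_exp_supermartingale)
    fix h j
    let ?e = "\<lambda>k. play \<pi> h (j, k)"
    have Cs: "shift_weight L (?e k # h) = shift_weight L h * exp (noise_tilt * (price_shift L h (?e k) - charge * shift_step L h (?e k)))" for k
      unfolding shift_weight_def exp_add[symmetric] by (intro arg_cong[where f = exp]) (simp add: algebra_simps)
    have W: "0 < shift_weight L h" by (simp add: shift_weight_def)
    have one: "(\<Sum>k\<in>UNIV. coupled h j k * exp (noise_tilt * (price_shift L h (?e k) - charge * shift_step L h (?e k)))) \<le> 1"
    proof (cases "counted h j \<and> L \<in> relevant h \<and> fst L \<noteq> fst (cheapest h)")
      case False
      then have "noise_tilt * (price_shift L h (?e k) - charge * shift_step L h (?e k)) = 0" for k
        by (auto simp: price_shift_def shift_step_def play_simps)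
      then show ?thesis by (simp only: exp_zero mult_1_right replay_sum)
    next
      case True
      then have fr: "fresh \<pi> (queue \<rho> g) h j" and rel: "relevant h \<noteq> {}" by (auto simp: counted_def good_def)
      define b where "b = noise_tilt * (fst L - fst (cheapest h))"
      have cV: "cheapest h \<in> V" using cheapest(1)[OF rel] relevant_V by blast
      have "\<bar>fst L - fst (cheapest h)\<bar> \<le> A + 1"
        using V_nonneg(1)[OF V] V_nonneg(1)[OF cV] V_le(1)[OF V] V_le(1)[OF cV] by linarith
      then have b: "\<bar>b\<bar> \<le> noise_tilt * (A + 1)"
        using noise_tilt(1) unfolding b_def abs_mult by simp
      let ?x = "\<lambda>k. b * hire_noise \<pi> h (?e k)"
      have "exp (noise_tilt * (price_shift L h (?e k) - charge * shift_step L h (?e k))) \<le> exp (- (noise_tilt * charge)) * (1 + ?x k + noise_tilt * charge)" for k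
      proof -
        have "noise_tilt * (price_shift L h (?e k) - charge * shift_step L h (?e k)) = - (noise_tilt * charge) + ?x k"
          using True by (simp add: price_shift_def shift_step_def play_simps b_def algebra_simps)
        moreover have x: "\<bar>?x k\<bar> \<le> noise_tilt * (A + 1)"
        proof -
          have "\<bar>?x k\<bar> \<le> (noise_tilt * (A + 1)) * 1"
            unfolding abs_mult using b hire_noise_abs[of \<pi> h j k] by (intro mult_mono) auto
          then show ?thesis by simp
        qed
        moreover have "(?x k)\<^sup>2 \<le> noise_tilt * charge"
          using power_mono[OF x, of 2] unfolding noise_tilt(3) by (simp only: power2_abs abs_ge_zero)
        moreover have "exp (?x k) \<le> 1 + ?x k + (?x k)\<^sup>2"
          using x noise_tilt(2) by (intro exp_le_quadratic) linarith
        ultimately show ?thesis by (simp only: exp_add) (intro mult_left_mono, linarith, simp)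
      qed
      then have "(\<Sum>k\<in>UNIV. coupled h j k * exp (noise_tilt * (price_shift L h (?e k) - charge * shift_step L h (?e k)))) \<le>
         (\<Sum>k\<in>UNIV. coupled h j k * (exp (- (noise_tilt * charge)) * (1 + ?x k + noise_tilt * charge)))"
        using replay_nonneg by (intro sum_mono mult_left_mono) auto
      also have "\<dots> = exp (- (noise_tilt * charge)) * ((\<Sum>k\<in>UNIV. coupled h j k) * (1 + noise_tilt * charge) + (\<Sum>k\<in>UNIV. coupled h j k * ?x k))"
        by (simp add: sum_distrib_left sum_distrib_right sum.distrib algebra_simps)
      also have "\<dots> = exp (- (noise_tilt * charge)) * (1 + noise_tilt * charge)"
        unfolding fresh_noise_mean[OF fr] replay_sum by simp
      also have "\<dots> \<le> exp (- (noise_tilt * charge)) * exp (noise_tilt * charge)"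
        using exp_ge_add_one_self[of "noise_tilt * charge"] by (intro mult_left_mono) auto
      also have "\<dots> = 1" by (simp flip: exp_add)
      finally show ?thesis .
    qed
    have "(\<Sum>k\<in>UNIV. coupled h j k * shift_weight L (?e k # h)) =
      shift_weight L h * (\<Sum>k\<in>UNIV. coupled h j k * exp (noise_tilt * (price_shift L h (?e k) - charge * shift_step L h (?e k))))"
      unfolding Cs by (simp add: sum_distrib_left mult_ac)
    also have "\<dots> \<le> shift_weight L h * 1" using one W by (intro mult_left_mono) auto
    finally show "(\<Sum>k\<in>UNIV. coupled h j k * shift_weight L (?e k # h)) \<le> shift_weight L h" by simp
  qed (use js replay_nonneg in auto)
  then show ?thesis by (simp add: shift_weight_def)
qed

lemma types_tail:
  assumes "map etype (e # h) = rev (take (length (e # h)) \<xi>)" "length (e # h) \<le> T"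
  shows "map etype h = rev (take (length h) \<xi>)"
proof -
  have "take (Suc (length h)) \<xi> = take (length h) \<xi> @ [\<xi> ! length h]"
    using assms(2) len_\<xi> by (intro take_Suc_conv_app_nth) simp
  then show ?thesis using assms(1) by simp
qed

text \<open>
  At the last step with a correction both \<open>L\<close> and the reference price are still
  relevant, so \<open>class_excess_le\<close> applies to them for each of the finitely many
  classes.
\<close>

lemma shift_steps_le:
  assumes V: "L \<in> V"
    and "reachable \<pi> nature h" "length h \<le> T" "map etype h = rev (take (length h) \<xi>)"
  shows "charge * path_sum (shift_step L) h \<le> off_cost L"
  using assms(2-)
proof (induction h)
  case Nil
  then show ?case using off_cost_nonneg[OF V] by simp
next
  case (Cons e h)
  show ?case
  proof (cases "counted h (etype e) \<and> L \<in> relevant h \<and> fst L \<noteq> fst (cheapest h)")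
    case False
    then have "path_sum (shift_step L) (e # h) = path_sum (shift_step L) h" by (auto simp: shift_step_def)
    moreover have "charge * path_sum (shift_step L) h \<le> off_cost L"
      using Cons.prems types_tail[OF Cons.prems(3,2)] by (intro Cons.IH) auto
    ultimately show ?thesis by simp
  next
    case True
    then have rel: "relevant h \<noteq> {}" and late: "overfull_time \<xi> < togo h"
      by (auto simp: counted_def good_def)
    have cV: "cheapest h \<in> V" using cheapest(1)[OF rel] relevant_V by blast
    have good: "\<not> overfull (drop m \<xi>)" if "m < length (e # h)" for m
    proof
      assume "overfull (drop m \<xi>)"
      from overfull_time_ge[OF this] have "real (T - m) \<le> overfull_time \<xi>" by (simp add: len_\<xi>)
      moreover have "T - length h \<le> T - m" using that by auto
      ultimately show False using late by linarith
    qed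
    have class_le: "max 0 (real (cnt \<pi> c (e # h)) - real (cnt \<rho> c g)) \<le> 2 * off_cost L / c0" if "c \<in> mixed_rates" for c
    proof -
      have c01: "0 < c" "c < 1" using that by (auto simp: mixed_rates_def)
      have "c0 * (real (cnt \<pi> c (e # h)) - real (cnt \<rho> c g)) \<le> off_cost L + off_cost (cheapest h)"
        using True cheapest(1)[OF rel] Cons.prems good
        by (intro class_excess_le[OF _ V cV c01]) auto
      also have "\<dots> \<le> 2 * off_cost L" using cheapest(2)[OF rel, of L] True by simp
      finally have "real (cnt \<pi> c (e # h)) - real (cnt \<rho> c g) \<le> 2 * off_cost L / c0"
        using c0 by (simp add: pos_le_divide_eq mult.commute)
      moreover have "0 \<le> 2 * off_cost L / c0" using off_cost_nonneg[OF V] c0 by simp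
      ultimately show ?thesis by simp
    qed
    have "path_sum (shift_step L) h' \<le> path_sum (\<lambda>h e. of_bool (fresh \<pi> (queue \<rho> g) h (etype e))) h'" for h'
      by (induction h') (auto simp: shift_step_def counted_def)
    also have "path_sum (\<lambda>h e. of_bool (fresh \<pi> (queue \<rho> g) h (etype e))) (e # h) \<le>
       (\<Sum>c\<in>mixed_rates. max 0 (real (cnt \<pi> c (e # h)) - real (cnt \<rho> c g)))"
      by (rule fresh_count_le)
    also have "\<dots> \<le> (\<Sum>c\<in>mixed_rates. 2 * off_cost L / c0)" using class_le by (rule sum_mono)
    also have "\<dots> = real (card mixed_rates) * (2 * (off_cost L / c0))" by simp
    finally have "charge * path_sum (shift_step L) (e # h) \<le> charge * (real (card mixed_rates) * (2 * (off_cost L / c0)))"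
      using charge(1)[of 0] by (intro mult_left_mono) auto
    also have "\<dots> \<le> c0 * (off_cost L / c0)"
      using off_cost_nonneg[OF V] c0 by (intro charge(3)) auto
    finally show ?thesis using c0 by simp
  qed
qed

lemma late_steps_le:
  assumes "length h \<le> T" "0 \<le> b"
  shows "path_sum (\<lambda>h e. of_bool (togo h \<le> b)) h \<le> max 0 (b - togo h)"
  using assms(1)
proof (induction h)
  case (Cons e h)
  have "togo h = togo (e # h) + 1" using Cons.prems by simp
  then show ?case using Cons by (auto simp: max_def)
qed simp

lemma idle_steps_le: "path_sum (\<lambda>h e. of_bool (relevant h = {})) h \<le> idle h - of_bool (relevant h = {})"
proof (induction h)
  case (Cons e h)
  have "idle (e # h) - of_bool (relevant (e # h) = {}) = idle h" by simp
  then show ?case using Cons by simp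
qed (simp del: relevant.simps)

lemma fresh_noise_le:
  assumes "persists L h" "reachable \<pi> nature h" "length h \<le> T"
  shows "fst L * path_sum (\<lambda>h e. of_bool (fresh \<pi> (queue \<rho> g) h (etype e)) * hire_noise \<pi> h e) h
    \<le> path_sum base_noise h + path_sum (price_shift L) h
      + A * (path_sum (\<lambda>h e. of_bool (relevant h = {})) h + path_sum (\<lambda>h e. of_bool (togo h \<le> overfull_time \<xi>)) h)"
  using assms
proof (induction h)
  case (Cons e h)
  let ?f = "fresh \<pi> (queue \<rho> g) h (etype e)"
  have V: "L \<in> V" by (rule persists_V[OF Cons.prems(1)])
  have pers: "persists L h" using Cons.prems by simp
  have n1: "\<bar>hire_noise \<pi> h e\<bar> \<le> 1"
    using Cons.prems(2) by (rule reachable_ConsE) (simp add: hire_noise_abs)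
  have step: "fst L * (of_bool ?f * hire_noise \<pi> h e) \<le> base_noise h e + price_shift L h e
     + A * (of_bool (relevant h = {}) + of_bool (togo h \<le> overfull_time \<xi>))"
  proof (cases "good h")
    case True
    then have "L \<in> relevant h" using persists_imp[OF pers] by (simp add: good_def)
    then have "fst L * (of_bool ?f * hire_noise \<pi> h e) = base_noise h e + price_shift L h e"
      using True by (simp add: base_noise_def price_shift_def counted_def algebra_simps)
    then show ?thesis using A_nonneg by simp
  next
    case False
    then have "1 \<le> of_bool (relevant h = {}) + (of_bool (togo h \<le> overfull_time \<xi>) :: real)"
      by (auto simp: good_def not_less)
    then have "A * 1 \<le> A * (of_bool (relevant h = {}) + of_bool (togo h \<le> overfull_time \<xi>))"
      using A_nonneg by (rule mult_left_mono)
    moreover have "\<bar>fst L * (of_bool ?f * hire_noise \<pi> h e)\<bar> \<le> A * (1 * 1)"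
      unfolding abs_mult using V_nonneg(1)[OF V] V_le(1)[OF V] n1 by (intro mult_mono) auto
    moreover have "base_noise h e = 0" "price_shift L h e = 0" using False by (auto simp: base_noise_def price_shift_def counted_def)
    ultimately show ?thesis by linarith
  qed
  have "fst L * path_sum (\<lambda>h e. of_bool (fresh \<pi> (queue \<rho> g) h (etype e)) * hire_noise \<pi> h e) h
    \<le> path_sum base_noise h + path_sum (price_shift L) h
      + A * (path_sum (\<lambda>h e. of_bool (relevant h = {})) h + path_sum (\<lambda>h e. of_bool (togo h \<le> overfull_time \<xi>)) h)"
    using Cons by simp
  then show ?case using step by (simp only: path_sum.simps distrib_left)
qed simp

text \<open>
  Both gains are expanded at the final price of the online run. Offline's cost at this price then
  pays for the corrections of the noise, up to an exponential weight for every price that the final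
  price might be.
\<close>

lemma pathwise_regret:
  assumes h: "reachable \<pi> coupled h" and types: "map etype h = rev \<xi>"
  shows "gain_sum \<rho> g - gain_sum \<pi> h \<le> path_sum base_noise h + (\<Sum>L\<in>V. shift_weight L h) / noise_tilt
    - fst (final_price h) * unread \<pi> (queue \<rho> g) h + waste * idle h + A * overfull_time \<xi>"
proof -
  define L where "L = final_price h"
  have hn: "reachable \<pi> nature h" by (rule reachable_replay_imp[OF h])
  have len: "length h = T" using arg_cong[OF types, of length] len_\<xi> by simp
  have pers: "persists L h" unfolding L_def by (rule final_price_persists)
  have V: "L \<in> V" by (rule persists_V[OF pers])
  have bud: "hires_used h \<le> Bh" "probes_used h \<le> Bp" using budgets_respected[OF hn] len by auto
  have lam: "fst L * real (hires_used g) \<le> fst L * real Bh"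
    using g_hires V_nonneg(1)[OF V] by (intro mult_left_mono) auto
  have left: "fst L * (real Bh - real (hires_used h)) + snd L * (real Bp - real (probes_used h)) \<le> (rmax + 1) * idle h"
    using online_left_le[OF pers hn] len bud by (simp add: of_nat_diff)
  have "(2 * rmax + 2 * A) * (idle h - of_bool (relevant h = {})) \<le> (2 * rmax + 2 * A) * idle h"
    using rmax_nonneg A_nonneg by (intro mult_left_mono) auto
  then have loss: "loss_sum \<pi> L h \<le> (2 * rmax + 2 * A) * idle h"
    using online_loss_le[OF pers hn] len by linarith
  have "gain_sum \<rho> g - gain_sum \<pi> h = fst L * (path_sum (hire_noise \<pi>) h - path_sum (hire_noise \<rho>) g)
      - off_cost L + loss_sum \<pi> L h
      + (fst L * real (hires_used g) - fst L * real Bh)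
      + (fst L * (real Bh - real (hires_used h)) + snd L * (real Bp - real (probes_used h)))"
    unfolding gain_sum_eq[OF g_reachable, of L] gain_sum_eq[OF hn, of L] g_types types off_cost_def
    by (simp add: algebra_simps)
  also have "\<dots> \<le> fst L * (path_sum (hire_noise \<pi>) h - path_sum (hire_noise \<rho>) g)
      - off_cost L + (2 * rmax + 2 * A) * idle h + (rmax + 1) * idle h"
    using lam left loss by linarith
  also have "fst L * (path_sum (hire_noise \<pi>) h - path_sum (hire_noise \<rho>) g) =
      fst L * path_sum (\<lambda>h e. of_bool (fresh \<pi> (queue \<rho> g) h (etype e)) * hire_noise \<pi> h e) h
      - fst L * unread \<pi> (queue \<rho> g) h"
    unfolding hire_noise_difference[OF g_reachable h] by (rule right_diff_distrib)
  finally have 1: "gain_sum \<rho> g - gain_sum \<pi> h \<le>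
      fst L * path_sum (\<lambda>h e. of_bool (fresh \<pi> (queue \<rho> g) h (etype e)) * hire_noise \<pi> h e) h
      - fst L * unread \<pi> (queue \<rho> g) h - off_cost L + (2 * rmax + 2 * A) * idle h + (rmax + 1) * idle h"
    by simp
  have "path_sum (\<lambda>h e. of_bool (relevant h = {})) h \<le> idle h"
    using idle_steps_le[of h] by (simp add: of_bool_def split: if_splits)
  moreover have "path_sum (\<lambda>h e. of_bool (togo h \<le> overfull_time \<xi>)) h \<le> overfull_time \<xi>"
    using late_steps_le[of h "overfull_time \<xi>"] overfull_time_nonneg[of \<xi>] len by simp
  ultimately have "A * (path_sum (\<lambda>h e. of_bool (relevant h = {})) h + path_sum (\<lambda>h e. of_bool (togo h \<le> overfull_time \<xi>)) h)
     \<le> A * (idle h + overfull_time \<xi>)"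
    using A_nonneg by (intro mult_left_mono) auto
  then have 2: "fst L * path_sum (\<lambda>h e. of_bool (fresh \<pi> (queue \<rho> g) h (etype e)) * hire_noise \<pi> h e) h
     \<le> path_sum base_noise h + path_sum (price_shift L) h + A * (idle h + overfull_time \<xi>)"
    using fresh_noise_le[OF pers hn] len by simp
  have "charge * path_sum (shift_step L) h \<le> off_cost L"
    using types len len_\<xi> by (intro shift_steps_le[OF V hn]) auto
  moreover have "path_sum (price_shift L) h - charge * path_sum (shift_step L) h \<le> (\<Sum>L\<in>V. shift_weight L h) / noise_tilt"
  proof -
    have "noise_tilt * (path_sum (price_shift L) h - charge * path_sum (shift_step L) h) \<le> shift_weight L h"
      unfolding shift_weight_def using exp_ge_add_one_self by (smt (verit))
    also have "\<dots> \<le> (\<Sum>L\<in>V. shift_weight L h)"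
      by (rule member_le_sum[of L V "\<lambda>L. shift_weight L h"]) (use V finite_V in \<open>simp_all add: shift_weight_def\<close>)
    finally show ?thesis using noise_tilt(1) by (simp add: pos_le_divide_eq mult.commute)
  qed
  ultimately show ?thesis using 1 2 unfolding L_def[symmetric] waste_def by (simp add: algebra_simps)
qed

lemma expected_pathwise_regret:
  "run_exp \<pi> coupled (\<lambda>h. gain_sum \<rho> g - gain_sum \<pi> h) [] \<xi> \<le>
    real (card V) / noise_tilt
    - run_exp \<pi> coupled (\<lambda>h. fst (final_price h) * unread \<pi> (queue \<rho> g) h) [] \<xi>
    + waste * run_exp \<pi> coupled idle [] \<xi> + A * overfull_time \<xi>"
proof -
  let ?E = "\<lambda>f. run_exp \<pi> coupled f [] \<xi>"
  have "?E (\<lambda>h. gain_sum \<rho> g - gain_sum \<pi> h) \<le> ?E (\<lambda>h. path_sum base_noise h + (1 / noise_tilt) * (\<Sum>L\<in>V. shift_weight L h)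
    - fst (final_price h) * unread \<pi> (queue \<rho> g) h + waste * idle h + A * overfull_time \<xi>)"
    using pathwise_regret replay_nonneg pos_\<xi> by (intro run_exp_mono) auto
  also have "\<dots> = ?E (path_sum base_noise) + (1 / noise_tilt) * (\<Sum>L\<in>V. ?E (shift_weight L))
    - ?E (\<lambda>h. fst (final_price h) * unread \<pi> (queue \<rho> g) h) + waste * ?E idle + A * overfull_time \<xi>"
    by (simp only: run_exp_add run_exp_diff run_exp_cmult run_exp_sum run_exp_const[OF replay_sum])
  also have "(\<Sum>L\<in>V. ?E (shift_weight L)) \<le> (\<Sum>L\<in>V. 1)"
    using run_exp_shift_weight pos_\<xi> by (intro sum_mono) auto
  finally show ?thesis using noise_tilt(1) by (simp add: run_exp_base_noise divide_right_mono)
qed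

end

context rabbi
begin

text \<open>
  Offline knows the types, so its policy is compared with RABBI for fixed types; only its rewards
  are coupled.
\<close>

lemma regret_given_types:
  assumes \<xi>: "length \<xi> = T" "\<forall>j\<in>set \<xi>. 0 < pmf p j"
    and budget: "\<And>g. reachable \<rho> nature g \<Longrightarrow> map etype g = rev \<xi> \<Longrightarrow> hires_used g \<le> Bh \<and> probes_used g \<le> Bp"
  shows "run_exp \<rho> nature (total_gain r) [] \<xi> - run_exp \<pi> nature (total_gain r) [] \<xi> \<le>
    real (card V) / noise_tilt + waste * run_exp \<pi> nature idle [] \<xi> + A * overfull_time \<xi>"
proof -
  let ?E = "\<lambda>g f. run_exp \<pi> (replay \<pi> (queue \<rho> g)) f [] \<xi>"
  have n1: "(\<Sum>k\<in>UNIV. nature h j k) = 1" for h :: "('n, 'm) history" and j by (simp add: sum_pmf_UNIV)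
  have "run_exp \<rho> nature (total_gain r) [] \<xi> - run_exp \<pi> nature (total_gain r) [] \<xi>
    = run_exp \<rho> nature (\<lambda>g. gain_sum \<rho> g - ?E g (gain_sum \<pi>)) [] \<xi>"
    unfolding run_exp_total_gain run_exp_diff run_exp_coupled_marginal ..
  also have "\<dots> = run_exp \<rho> nature (\<lambda>g. ?E g (\<lambda>h. gain_sum \<rho> g - gain_sum \<pi> h)) [] \<xi>"
    by (simp only: run_exp_diff run_exp_const[OF replay_sum])
  also have "\<dots> \<le> run_exp \<rho> nature (\<lambda>g. real (card V) / noise_tilt - ?E g (\<lambda>h. fst (final_price h) * unread \<pi> (queue \<rho> g) h)
      + waste * ?E g idle + A * overfull_time \<xi>) [] \<xi>"
  proof (rule run_exp_mono)
    fix g assume g: "reachable \<rho> nature g" "map etype g = rev \<xi> @ map etype []"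
    interpret pairing p q r V A c0 pm T Bh Bp \<pi> \<rho> g \<xi>
      using g \<xi> budget by unfold_locales auto
    show "?E g (\<lambda>h. gain_sum \<rho> g - gain_sum \<pi> h) \<le> real (card V) / noise_tilt
      - ?E g (\<lambda>h. fst (final_price h) * unread \<pi> (queue \<rho> g) h) + waste * ?E g idle + A * overfull_time \<xi>"
      by (rule expected_pathwise_regret)
  qed (use \<xi> in auto)
  also have "\<dots> = real (card V) / noise_tilt - 0 + waste * run_exp \<pi> nature idle [] \<xi> + A * overfull_time \<xi>"
    by (simp only: run_exp_add run_exp_diff run_exp_cmult run_exp_const[OF n1] run_exp_unread run_exp_coupled_marginal)
  finally show ?thesis by simp
qed

theorem regret_le: "v_off p q r T Bh Bp - v_on p q r T \<pi> \<le> regret_bound"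
proof -
  have on: "v_on p q r T \<pi> = type_exp T (\<lambda>js. run_exp \<pi> nature (total_gain r) [] js)"
    using expectation_arrivals_type_exp[of T "\<lambda>_. total_gain r" "\<lambda>_. \<pi>" "\<lambda>_. []"]
    by (simp add: v_on_def run_def)
  have "v_off p q r T Bh Bp \<le> v_on p q r T \<pi> + regret_bound"
    unfolding v_off_def
  proof (rule cSUP_least)
    \<comment> \<open>rejecting everything is admissible, so the supremum is over a nonempty set\<close>
    define N where "N = (\<lambda>js :: 'n list. Policy (\<lambda>h j. Reject) (\<lambda>h j k. Leave) :: ('n, 'm) policy)"
    have "foldl (\<lambda>h i. play (Policy (\<lambda>h j. Reject) (\<lambda>h j k. Leave)) h i # h) h0 \<omega> = rev (map (Rejected \<circ> fst) \<omega>) @ h0"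
      for h0 :: "('n, 'm) history" and \<omega>
      by (induction \<omega> arbitrary: h0) (auto simp: play_def)
    then have "run (N js) \<omega> = rev (map (Rejected \<circ> fst) \<omega>)" for js \<omega> by (simp add: run_def N_def)
    then have "offline_admissible p q T Bh Bp N"
      by (auto simp: offline_admissible_def hires_used_def probes_used_def sum_list_0 o_def simp flip: rev_map)
    then show "{F. offline_admissible p q T Bh Bp F} \<noteq> {}" by blast
  next
    fix F assume "F \<in> {F. offline_admissible p q T Bh Bp F}"
    then have adm: "offline_admissible p q T Bh Bp F" by simp
    have "measure_pmf.expectation (arrivals p q T) (\<lambda>\<omega>. total_gain r (run (F (map fst \<omega>)) \<omega>)) =
       type_exp T (\<lambda>js. run_exp (F js) nature (total_gain r) [] js)"
      using expectation_arrivals_type_exp[of T "\<lambda>_. total_gain r" F "\<lambda>_. []"] by (simp add: run_def)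
    also have "\<dots> \<le> type_exp T (\<lambda>js. run_exp \<pi> nature (total_gain r) [] js +
        (real (card V) / noise_tilt + waste * run_exp \<pi> nature idle [] js + A * overfull_time js))"
    proof (rule type_exp_mono)
      fix js :: "'n list" assume js: "length js = T" "\<forall>j\<in>set js. 0 < pmf p j"
      have budget: "hires_used g \<le> Bh \<and> probes_used g \<le> Bp" if g: "reachable (F js) nature g" "map etype g = rev js" for g
      proof -
        obtain \<omega> where w: "run (F js) \<omega> = g" "map fst \<omega> = rev (map etype g)" "\<forall>i\<in>set \<omega>. i \<in> set_pmf (item_pmf p q)"
          using reachable_run[OF g(1)] .
        have fst: "map fst \<omega> = js" using w(2) g(2) by simp
        then have "length \<omega> = T" using js(1) by (metis length_map)
        then have "\<omega> \<in> set_pmf (arrivals p q T)" using w(3) by (auto simp: arrivals_def set_replicate_pmf)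
        then show ?thesis using adm fst w(1) unfolding offline_admissible_def by metis
      qed
      have "run_exp (F js) nature (total_gain r) [] js - run_exp \<pi> nature (total_gain r) [] js \<le>
        real (card V) / noise_tilt + waste * run_exp \<pi> nature idle [] js + A * overfull_time js"
        by (rule regret_given_types[OF js]) (rule budget)
      then show "run_exp (F js) nature (total_gain r) [] js \<le> run_exp \<pi> nature (total_gain r) [] js +
        (real (card V) / noise_tilt + waste * run_exp \<pi> nature idle [] js + A * overfull_time js)"
        by linarith
    qed
    also have "\<dots> = v_on p q r T \<pi> + (real (card V) / noise_tilt
        + waste * type_exp T (\<lambda>js. run_exp \<pi> nature idle [] js) + A * type_exp T overfull_time)"
      unfolding on by (simp only: type_exp_add type_exp_cmult type_exp_const)
    also have "\<dots> \<le> v_on p q r T \<pi> + regret_bound"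
      unfolding regret_bound_def using expected_idle expected_overfull_time[of T] A_nonneg rmax_nonneg
      by (intro add_mono mult_left_mono) (auto simp: waste_def)
    finally show "measure_pmf.expectation (arrivals p q T) (\<lambda>\<omega>. total_gain r (run (F (map fst \<omega>)) \<omega>)) \<le> v_on p q r T \<pi> + regret_bound" .
  qed
  then show ?thesis by simp
qed

end

section \<open>The constant\<close>

context probing
begin

lemma positive_lower_bound:
  assumes "finite S"
  obtains c where "0 < c" "c \<le> 1" "\<And>x. x \<in> S \<Longrightarrow> 0 < x \<Longrightarrow> c \<le> (x :: real)"
proof (rule that)
  let ?S = "insert 1 {x \<in> S. 0 < x}"
  show "0 < Min ?S" using assms by (subst Min_gr_iff) auto
  show "Min ?S \<le> 1" using assms by (intro Min_le) auto
  show "Min ?S \<le> x" if "x \<in> S" "0 < x" for x using assms that by (intro Min_le) auto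
qed

lemma price_system_exists:
  obtains V A c0 pm where "price_system p q r V A c0 pm"
proof -
  obtain V where V: "finite V" "(0, 0) \<in> V" "\<And>L. L \<in> V \<Longrightarrow> 0 \<le> fst L \<and> 0 \<le> snd L"
    "\<And>bh bp z x y. lp_optimal q r bh bp z x y \<Longrightarrow> \<exists>L\<in>V. dual_bound L bh bp z \<le> lp_value q r x y"
    using finite_price_system by blast
  define A where "A = Max (fst ` V \<union> snd ` V)"
  have A: "fst L \<le> A" "snd L \<le> A" if "L \<in> V" for L
    unfolding A_def using V(1) that by (auto intro: Max_ge)
  have "finite ((\<lambda>((j, a, w), L). loss j a w L) ` (UNIV \<times> V) \<union> snd ` V)" using V(1) by simp
  from positive_lower_bound[OF this] obtain c0 where c0: "0 < c0" "c0 \<le> 1"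
    "\<And>x. x \<in> (\<lambda>((j, a, w), L). loss j a w L) ` (UNIV \<times> V) \<union> snd ` V \<Longrightarrow> 0 < x \<Longrightarrow> c0 \<le> x" by blast
  have "finite (range (pmf p))" by simp
  from positive_lower_bound[OF this] obtain pm where pm: "0 < pm" "pm \<le> 1"
    "\<And>x. x \<in> range (pmf p) \<Longrightarrow> 0 < x \<Longrightarrow> pm \<le> x" by blast
  have "price_system p q r V A c0 pm"
  proof
    show "c0 \<le> loss j a w L" if "L \<in> V" "loss j a w L \<noteq> 0" for L j a w
    proof (rule c0(3))
      show "loss j a w L \<in> (\<lambda>((j, a, w), L). loss j a w L) ` (UNIV \<times> V) \<union> snd ` V"
        using that(1) by (intro UnI1 image_eqI[of _ _ "((j, a, w), L)"]) auto
      show "0 < loss j a w L" using that(2) loss_nonneg[of j a w L] by linarith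
    qed
    show "c0 \<le> snd L" if "L \<in> V" "snd L \<noteq> 0" for L
      using c0(3)[of "snd L"] V(3)[OF that(1)] that by auto
  qed (use V A c0 pm in auto)
  then show thesis by (rule that)
qed

end

theorem theorem2:
  fixes p :: "'n::finite pmf"
    and q :: "'n \<Rightarrow> 'm::finite pmf"
    and r :: "'n \<Rightarrow> 'm \<Rightarrow> real"
  shows "\<exists>M. \<forall>T Bh Bp. \<forall>\<pi>. probing_rabbi p q r T Bh Bp \<pi> \<longrightarrow>
           v_off p q r T Bh Bp - v_on p q r T \<pi> \<le> M"
proof -
  interpret probing p q r .
  obtain V A c0 pm where "price_system p q r V A c0 pm" by (rule price_system_exists)
  then interpret price_system p q r V A c0 pm .
  have "v_off p q r T Bh Bp - v_on p q r T \<pi> \<le> regret_bound" if "probing_rabbi p q r T Bh Bp \<pi>" for T Bh Bp \<pi>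
  proof -
    interpret rabbi p q r V A c0 pm T Bh Bp \<pi> using that by unfold_locales
    show ?thesis by (rule regret_le)
  qed
  then show ?thesis by blast
qed

end
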